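(* Let $n\in\mathbb N=\{1,2,\dots\}$ and $\alpha=n+1$. Let $\mu_1^{(n)},\dots,\mu_n^{(n)}\in(-\infty,0)$ be the $n$ distinct solutions $\mu$ of $L_n^{(1)}(-2\mu)=0$, and let $$f_k^{(n)}(x)=x\exp(\mu_k^{(n)}x)\,L_n^{(1)}(-2\mu_k^{(n)}x),\qquad x\in(0,1),\ k=1,\dots,n.$$ Let $(u_0,u_1)\in\mathcal H$. Then the solution $u$ of the damped wave equation $$\begin{cases}u_{tt}(x,t)+\frac{2\alpha}{x}u_t(x,t)=u_{xx}(x,t),& x\in(0,1),\ t>0,\\ u(0,\cdot)=u(1,\cdot)=0,\\ (u(\cdot,0),u_t(\cdot,0))=(u_0,u_1)\end{cases}$$ vanishes in finite time (i.e. there is $T>0$ with $u(\cdot,t)=0$ for all $t>T$) if and only if $$\big\langle(u_0,u_1),(f_k^{(n)},-\mu_k^{(n)}f_k^{(n)})\big\rangle_{\mathcal H}=0,\qquad k=1,\dots,n.$$ In such a case the solution vanishes for $t>2$, i.e. $u(\cdot,t)=0$ for all $t>2$.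
   Context: Let $\mathcal I=(0,1)$. $\mathcal H=W_0^{1,2}(\mathcal I)\times L^2(\mathcal I)$ is the (complex) Hilbert space with inner product $$\langle(\phi_1,\phi_2),(\psi_1,\psi_2)\rangle_{\mathcal H}=\langle\phi_1',\psi_1'\rangle_{L^2}+\langle\phi_2,\psi_2\rangle_{L^2}.$$ $L_n^{(1)}(z)=\sum_{j=0}^n\binom{n+1}{n-j}\frac{(-z)^j}{j!}$ is the associated Laguerre polynomial, which has $n$ distinct positive zeros. The solution is understood in the semigroup sense: let $G_0$ be the operator in $\mathcal H$ with domain $(W_0^{1,2}(\mathcal I)\cap W^{2,2}(\mathcal I))^2$ acting as $G_0(u,v)^t=(v,\ u''-\frac{2\alpha}{x}v)^t$, and let $G=\overline{G_0}$ be its closure, which generates a contraction semigroup $e^{tG}$ on $\mathcal H$. The solution $u(\cdot,t)$ is the first component of $e^{tG}(u_0,u_1)^t$. *)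

theory Defs
  imports "HOL-Analysis.Analysis"
begin

(* Elements of the function spaces over (0,1) are represented by functions on the real line.
   Only the values on (0,1) matter, and two representatives denote the same element iff they
   agree almost everywhere on (0,1). *)

abbreviation unit_itv :: "real measure" where
  "unit_itv \<equiv> lebesgue_on {0<..<1}"

definition L2 :: "(real \<Rightarrow> complex) set" where
  "L2 = {f. f \<in> borel_measurable unit_itv \<and> integrable unit_itv (\<lambda>x. (cmod (f x))\<^sup>2)}"

definition L2_inner :: "(real \<Rightarrow> complex) \<Rightarrow> (real \<Rightarrow> complex) \<Rightarrow> complex" where
  "L2_inner f g = (LINT x|unit_itv. f x * cnj (g x))"

definition L2_norm :: "(real \<Rightarrow> complex) \<Rightarrow> real" where
  "L2_norm f = sqrt (LINT x|unit_itv. (cmod (f x))\<^sup>2)"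

definition smooth :: "(real \<Rightarrow> complex) \<Rightarrow> bool" where
  "smooth \<phi> \<longleftrightarrow> (\<exists>D :: nat \<Rightarrow> real \<Rightarrow> complex. D 0 = \<phi> \<and>
     (\<forall>k x. (D k has_vector_derivative D (Suc k) x) (at x)))"

definition test_functions :: "(real \<Rightarrow> complex) set" where
  "test_functions = {\<phi>. smooth \<phi> \<and> (\<exists>K. compact K \<and> K \<subseteq> {0<..<1} \<and> (\<forall>x. x \<notin> K \<longrightarrow> \<phi> x = 0))}"

definition has_weak_deriv :: "(real \<Rightarrow> complex) \<Rightarrow> (real \<Rightarrow> complex) \<Rightarrow> bool" where
  "has_weak_deriv f g \<longleftrightarrow> f \<in> L2 \<and> g \<in> L2 \<and>
     (\<forall>\<phi>\<in>test_functions.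
        (LINT x|unit_itv. f x * vector_derivative \<phi> (at x)) = - (LINT x|unit_itv. g x * \<phi> x))"

(* Unique up to null sets whenever f lies in W12; only meaningful in that case. *)
definition weak_deriv :: "(real \<Rightarrow> complex) \<Rightarrow> (real \<Rightarrow> complex)" where
  "weak_deriv f = (SOME g. has_weak_deriv f g)"

definition W12 :: "(real \<Rightarrow> complex) set" where
  "W12 = {f. \<exists>g. has_weak_deriv f g}"

definition W22 :: "(real \<Rightarrow> complex) set" where
  "W22 = {f. \<exists>g h. has_weak_deriv f g \<and> has_weak_deriv g h}"

(* The closure of the test functions in the norm of W12. *)
definition W12_0 :: "(real \<Rightarrow> complex) set" where
  "W12_0 = {f \<in> W12. \<exists>\<phi> :: nat \<Rightarrow> real \<Rightarrow> complex. (\<forall>m. \<phi> m \<in> test_functions) \<and>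
     (\<lambda>m. L2_norm (\<lambda>x. \<phi> m x - f x)) \<longlonglongrightarrow> 0 \<and>
     (\<lambda>m. L2_norm (\<lambda>x. vector_derivative (\<phi> m) (at x) - weak_deriv f x)) \<longlonglongrightarrow> 0}"

type_synonym state = "(real \<Rightarrow> complex) \<times> (real \<Rightarrow> complex)"

definition H :: "state set" where
  "H = W12_0 \<times> L2"

definition H_eq :: "state \<Rightarrow> state \<Rightarrow> bool" where
  "H_eq p q \<longleftrightarrow> (AE x in unit_itv. fst p x = fst q x) \<and> (AE x in unit_itv. snd p x = snd q x)"

definition H_lincomb :: "complex \<Rightarrow> state \<Rightarrow> complex \<Rightarrow> state \<Rightarrow> state" where
  "H_lincomb a p b q = (\<lambda>x. a * fst p x + b * fst q x, \<lambda>x. a * snd p x + b * snd q x)"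

definition H_inner :: "state \<Rightarrow> state \<Rightarrow> complex" where
  "H_inner p q = L2_inner (weak_deriv (fst p)) (weak_deriv (fst q)) + L2_inner (snd p) (snd q)"

definition H_norm :: "state \<Rightarrow> real" where
  "H_norm p = sqrt (Re (H_inner p p))"

definition H_dist :: "state \<Rightarrow> state \<Rightarrow> real" where
  "H_dist p q = H_norm (H_lincomb 1 p (-1) q)"

(* Operators in H are identified with their graphs. *)

definition G0 :: "real \<Rightarrow> (state \<times> state) set" where
  "G0 \<alpha> = {((u, v), (v, \<lambda>x. weak_deriv (weak_deriv u) x - complex_of_real (2 * \<alpha> / x) * v x)) | u v.
     u \<in> W12_0 \<inter> W22 \<and> v \<in> W12_0 \<inter> W22}"

definition op_closure :: "(state \<times> state) set \<Rightarrow> (state \<times> state) set" where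
  "op_closure A = {(p, q). p \<in> H \<and> q \<in> H \<and>
     (\<exists>P Q :: nat \<Rightarrow> state. (\<forall>m. (P m, Q m) \<in> A) \<and>
        (\<lambda>m. H_dist (P m) p) \<longlonglongrightarrow> 0 \<and> (\<lambda>m. H_dist (Q m) q) \<longlonglongrightarrow> 0)}"

definition contraction_semigroup :: "(real \<Rightarrow> state \<Rightarrow> state) \<Rightarrow> bool" where
  "contraction_semigroup S \<longleftrightarrow>
     (\<forall>t\<ge>0. \<forall>p\<in>H. S t p \<in> H) \<and>
     (\<forall>t\<ge>0. \<forall>p\<in>H. \<forall>q\<in>H. \<forall>a b.
        H_eq (S t (H_lincomb a p b q)) (H_lincomb a (S t p) b (S t q))) \<and>
     (\<forall>p\<in>H. H_eq (S 0 p) p) \<and>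
     (\<forall>s\<ge>0. \<forall>t\<ge>0. \<forall>p\<in>H. H_eq (S (s + t) p) (S s (S t p))) \<and>
     (\<forall>t\<ge>0. \<forall>p\<in>H. H_norm (S t p) \<le> H_norm p) \<and>
     (\<forall>p\<in>H. ((\<lambda>t. H_dist (S t p) p) \<longlongrightarrow> 0) (at_right 0))"

definition generator :: "(real \<Rightarrow> state \<Rightarrow> state) \<Rightarrow> (state \<times> state) set" where
  "generator S = {(p, q). p \<in> H \<and> q \<in> H \<and>
     ((\<lambda>h. H_dist (H_lincomb (complex_of_real (1 / h)) (S h p) (- complex_of_real (1 / h)) p) q)
        \<longlongrightarrow> 0) (at_right 0)}"

(* The associated Laguerre polynomial with upper index 1. *)
definition laguerre1 :: "nat \<Rightarrow> real \<Rightarrow> real" where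
  "laguerre1 n z = (\<Sum>j=0..n. real ((n + 1) choose (n - j)) * (- z) ^ j / fact j)"

definition fk :: "nat \<Rightarrow> real \<Rightarrow> real \<Rightarrow> complex" where
  "fk n m x = complex_of_real (x * exp (m * x) * laguerre1 n (- 2 * m * x))"

definition vanishes_at :: "(real \<Rightarrow> state \<Rightarrow> state) \<Rightarrow> state \<Rightarrow> real \<Rightarrow> bool" where
  "vanishes_at S p t \<longleftrightarrow> (AE x in unit_itv. fst (S t p) x = 0)"

end

(* With u the first and v the second component, pair the state against (a, w): the integral of u' a + v w.
   For z'' = (zeta^2 + 2 alpha zeta / x) z + phi with z(0) = z(1) = 0, the vector (z', - zeta z) satisfies
   y' = zeta y - f along the semigroup, where f(t) is the integral of v(t) phi; hence y(0) is the Laplace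
   transform of f at zeta.  Such a z is obtained from the solution vanishing near 0, which is entire in zeta
   and of growth exp |Re zeta|, by subtracting a multiple of x exp(zeta x) L_n(-2 zeta x) to restore z(1) = 0.
   The only poles this introduces are the zeros of L_n(-2 zeta), and they are removed by the orthogonality
   conditions.  The Laplace transform of f is then entire and bounded by a polynomial times exp(2 |Re zeta|),
   so by a Paley-Wiener argument (Liouville's theorem for polynomially bounded functions) f vanishes for t > 2.
   Hence v, and then u, vanish for t > 2.  Conversely, for phi = 0 and zeta = mu_k the pairing evolves as
   exp(mu_k t) and can vanish eventually only if it vanishes initially. *)

theory Submission
  imports Defs "HOL-Complex_Analysis.Complex_Analysis" "HOL-Real_Asymp.Real_Asymp"
begin

text \<open>For alpha = n + 1 the solution of the homogeneous equation that vanishes at 0 has no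
  component exp(-zeta x): it is x exp(zeta x) times a polynomial in zeta x. Dividing by its value at
  1 therefore costs n poles but no exponential type, and this is why extinction is possible. The
  time 2 is a sum of two unit types: exp |Re zeta| for the solution vanishing near 0, and exp |Re
  zeta| for exp(-zeta) times the regular solution. The singular damping is avoided rather than
  resolved: phi is a test function, so the first of these solutions is zero until the support of phi
  is reached, and 2 alpha / x may be replaced by a bounded coefficient; elsewhere Hardy's inequality
  makes w / x square integrable. The semigroup is given only through its generator, so time
  evolution is read off scalar pairings with pairs on which the formal adjoint acts classically.
  These pairings satisfy ordinary differential equations for every initial state in
  \<open>H\<close>, also outside the domain of the generator, and they are bilinear without
  conjugation, so that they depend holomorphically on zeta.\<close>

section \<open>Smooth functions with compact support\<close>


text \<open>The powers of 1/x make the family stable under differentiation up to linear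
  combinations; the member k = 0 is the classical flat function exp(-1/x), extended by 0.\<close>

definition flat_exp :: "nat \<Rightarrow> real \<Rightarrow> real" where
  "flat_exp k x = (if x > 0 then (1 / x) ^ k * exp (- (1 / x)) else 0)"

lemma power_le_fact_exp:
  assumes "0 \<le> (y :: real)"
  shows "y ^ m \<le> fact m * exp y"
proof -
  have "y ^ m / fact m \<le> (\<Sum>j\<le>m. y ^ j / fact j)"
    by (rule member_le_sum) (use assms in auto)
  also have "\<dots> \<le> exp y"
  proof -
    have "(\<lambda>j. y ^ j / fact j) sums exp y"
      using exp_converges[of y] by (simp add: divide_inverse mult.commute)
    then show ?thesis
      using sum_le_suminf[of "\<lambda>j. y ^ j / fact j" "{..m}"] assms
      by (auto simp: sums_iff)
  qed
  finally show ?thesis by (simp add: field_simps)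
qed

text \<open>Take y = 1/x and m = k + 2 in \<open>power_le_fact_exp\<close>. The two powers to spare
  make the difference quotient at 0 tend to 0, which settles the only delicate point of
  \<open>flat_exp_deriv\<close>.\<close>

lemma flat_exp_bound: "\<bar>flat_exp k x\<bar> \<le> fact (k + 2) * x\<^sup>2"
proof (cases "x > 0")
  case True
  have "(1 / x) ^ (k + 2) \<le> fact (k + 2) * exp (1 / x)"
    by (rule power_le_fact_exp) (use True in simp)
  then have "(1 / x) ^ k * exp (- (1 / x)) \<le> fact (k + 2) * x\<^sup>2"
    using True by (simp add: field_simps exp_minus power2_eq_square)
  then show ?thesis using True by (simp add: flat_exp_def abs_mult)
qed (simp add: flat_exp_def)

lemma flat_exp_deriv:
  "(flat_exp k has_real_derivative - real k * flat_exp (k + 1) x + flat_exp (k + 2) x) (at x)"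
proof -
  consider "x > 0" | "x < 0" | "x = 0" by linarith
  then show ?thesis
  proof cases
    case 1
    have "((\<lambda>x. (1 / x) ^ k * exp (- (1 / x))) has_real_derivative
        - real k * flat_exp (k + 1) x + flat_exp (k + 2) x) (at x)"
    proof -
      have "((\<lambda>x. inverse x ^ k * exp (- inverse x)) has_real_derivative
        (of_nat k * inverse x ^ (k - 1) * (- (inverse x * inverse x))) * exp (- inverse x)
        + inverse x ^ k * (exp (- inverse x) * (inverse x * inverse x))) (at x)"
        using 1 by (auto intro!: derivative_eq_intros simp: power2_eq_square)
      also have "(of_nat k * inverse x ^ (k - 1) * (- (inverse x * inverse x))) * exp (- inverse x)
        + inverse x ^ k * (exp (- inverse x) * (inverse x * inverse x))
        = - real k * flat_exp (k + 1) x + flat_exp (k + 2) x"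
        using 1 by (cases k) (auto simp: flat_exp_def divide_inverse algebra_simps)
      finally show ?thesis by (simp add: divide_inverse)
    qed
    then show ?thesis
      by (rule has_field_derivative_transform_within_open[where S = "{0<..}"])
        (use 1 in \<open>auto simp: flat_exp_def\<close>)
  next
    case 2
    have "((\<lambda>x. 0) has_real_derivative 0) (at x)" by simp
    then have "(flat_exp k has_real_derivative 0) (at x)"
      by (rule has_field_derivative_transform_within_open[where S = "{..<0}"])
        (use 2 in \<open>auto simp: flat_exp_def\<close>)
    then show ?thesis using 2 by (simp add: flat_exp_def)
  next
    case 3
    have "((\<lambda>h. flat_exp k h / h) \<longlongrightarrow> 0) (at 0)"
    proof (rule Lim_null_comparison[where g = "\<lambda>h. fact (k + 2) * \<bar>h\<bar>"])
      show "\<forall>\<^sub>F h in at 0. norm (flat_exp k h / h) \<le> fact (k + 2) * \<bar>h\<bar>"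
        unfolding eventually_at_filter
      proof (intro always_eventually allI impI)
        fix h :: real assume "h \<noteq> 0"
        then have "\<bar>flat_exp k h\<bar> / \<bar>h\<bar> \<le> fact (k + 2) * h\<^sup>2 / \<bar>h\<bar>"
          by (intro divide_right_mono flat_exp_bound) simp
        also have "\<dots> = fact (k + 2) * \<bar>h\<bar>"
          using \<open>h \<noteq> 0\<close> by (simp add: power2_eq_square abs_if)
        finally show "norm (flat_exp k h / h) \<le> fact (k + 2) * \<bar>h\<bar>" by simp
      qed
      show "((\<lambda>h. fact (k + 2) * \<bar>h\<bar>) \<longlongrightarrow> (0::real)) (at 0)"
        by (auto intro!: tendsto_eq_intros simp del: fact_Suc)
    qed
    then show ?thesis using 3 by (simp add: flat_exp_def DERIV_def)
  qed
qed

text \<open>\<open>smooth\<close> demands all derivatives at once, so proving products smooth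
  directly would need Leibniz' formula of every order. A class closed under a single differentiation
  avoids this; the rule \<open>smth\<close> lets functions already known to be smooth enter.\<close>

inductive_set smooth_algebra :: "(real \<Rightarrow> complex) set" where
  const: "(\<lambda>_. c) \<in> smooth_algebra"
| ident: "complex_of_real \<in> smooth_algebra"
| flat: "(\<lambda>x. complex_of_real (flat_exp k x)) \<in> smooth_algebra"
| smth: "smooth f \<Longrightarrow> f \<in> smooth_algebra"
| add: "f \<in> smooth_algebra \<Longrightarrow> g \<in> smooth_algebra \<Longrightarrow> (\<lambda>x. f x + g x) \<in> smooth_algebra"
| mult: "f \<in> smooth_algebra \<Longrightarrow> g \<in> smooth_algebra \<Longrightarrow> (\<lambda>x. f x * g x) \<in> smooth_algebra"
| affine: "f \<in> smooth_algebra \<Longrightarrow> (\<lambda>x. f (a * x + b)) \<in> smooth_algebra"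

lemma smooth_deriv:
  assumes "smooth f"
  shows "\<exists>g. smooth g \<and> (\<forall>x. (f has_vector_derivative g x) (at x))"
proof -
  from assms obtain D where D: "D 0 = f" "\<And>k x. (D k has_vector_derivative D (Suc k) x) (at x)"
    by (auto simp: smooth_def)
  have "smooth (D 1)"
    unfolding smooth_def by (rule exI[of _ "\<lambda>k. D (Suc k)"]) (use D in auto)
  then show ?thesis using D by (metis One_nat_def)
qed

lemma smooth_algebra_deriv:
  assumes "f \<in> smooth_algebra"
  shows "\<exists>g\<in>smooth_algebra. \<forall>x. (f has_vector_derivative g x) (at x)"
  using assms
proof induction
  case (const c)
  show ?case by (rule bexI[OF _ smooth_algebra.const[of 0]]) simp
next
  case ident
  show ?case
    by (rule bexI[OF _ smooth_algebra.const[of 1]])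
      (auto intro!: derivative_eq_intros)
next
  case (flat k)
  have "(\<lambda>x. complex_of_real (- real k * flat_exp (k + 1) x + flat_exp (k + 2) x)) =
      (\<lambda>x. (\<lambda>_. - of_nat k) x * complex_of_real (flat_exp (k + 1) x) + complex_of_real (flat_exp (k + 2) x))"
    by auto
  also have "\<dots> \<in> smooth_algebra" by (intro smooth_algebra.add smooth_algebra.mult smooth_algebra.const smooth_algebra.flat)
  finally show ?case
    by (rule bexI[rotated]) (intro allI has_vector_derivative_of_real, 
        use flat_exp_deriv in \<open>auto simp: has_real_derivative_iff_has_vector_derivative\<close>)
next
  case (smth f)
  then show ?case using smooth_deriv smooth_algebra.smth by blast
next
  case (add f g)
  then obtain f' g' where "f' \<in> smooth_algebra" "g' \<in> smooth_algebra"
    "\<And>x. (f has_vector_derivative f' x) (at x)" "\<And>x. (g has_vector_derivative g' x) (at x)" by blast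
  then show ?case
    by (intro bexI[of _ "\<lambda>x. f' x + g' x"])
      (auto intro: smooth_algebra.add smooth_algebra.mult smooth_algebra.const derivative_intros)
next
  case (mult f g)
  then obtain f' g' where "f' \<in> smooth_algebra" "g' \<in> smooth_algebra"
    "\<And>x. (f has_vector_derivative f' x) (at x)" "\<And>x. (g has_vector_derivative g' x) (at x)" by blast
  then show ?case using mult
    by (intro bexI[of _ "\<lambda>x. f x * g' x + f' x * g x"])
      (auto intro: smooth_algebra.add smooth_algebra.mult smooth_algebra.const has_vector_derivative_mult)
next
  case (affine f a b)
  then obtain f' where f': "f' \<in> smooth_algebra" "\<And>x. (f has_vector_derivative f' x) (at x)" by blast
  have "((\<lambda>x. f (a * x + b)) has_vector_derivative complex_of_real a * f' (a * x + b)) (at x)" for x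
  proof -
    have "((\<lambda>x. a * x + b) has_vector_derivative a) (at x)"
      unfolding has_real_derivative_iff_has_vector_derivative [symmetric]
      by (rule derivative_eq_intros refl | simp)+
    from vector_diff_chain_at[OF this f'(2)] show ?thesis
      by (simp add: o_def scaleR_conv_of_real)
  qed
  moreover have "(\<lambda>x. (\<lambda>_. complex_of_real a) x * f' (a * x + b)) \<in> smooth_algebra"
    by (intro smooth_algebra.mult smooth_algebra.const smooth_algebra.affine f')
  ultimately show ?case by (intro bexI[of _ "\<lambda>x. complex_of_real a * f' (a * x + b)"]) auto
qed

text \<open>Choose a derivative operator d that stays inside the class; its iterates form the
  required sequence.\<close>

lemma smooth_algebra_smooth:
  assumes "f \<in> smooth_algebra"
  shows "smooth f"
proof -
  have "\<forall>f\<in>smooth_algebra. \<exists>g. g \<in> smooth_algebra \<and> (\<forall>x. (f has_vector_derivative g x) (at x))"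
    using smooth_algebra_deriv by blast
  from bchoice[OF this] obtain d where
    d: "\<And>f. f \<in> smooth_algebra \<Longrightarrow> d f \<in> smooth_algebra"
       "\<And>f x. f \<in> smooth_algebra \<Longrightarrow> (f has_vector_derivative d f x) (at x)"
    by blast
  have mem: "(d ^^ k) f \<in> smooth_algebra" for k
    by (induction k) (use assms d in auto)
  show ?thesis
    unfolding smooth_def
    by (rule exI[of _ "\<lambda>k. (d ^^ k) f"]) (use d mem in auto)
qed

lemma smooth_has_deriv:
  "smooth f \<Longrightarrow> (f has_vector_derivative vector_derivative f (at x)) (at x)"
proof -
  assume "smooth f"
  then obtain g where g: "\<And>x. (f has_vector_derivative g x) (at x)"
    using smooth_deriv by blast
  then show ?thesis using vector_derivative_at[OF g, of x] by simp
qed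

lemma smooth_vector_derivative: "smooth f \<Longrightarrow> smooth (\<lambda>x. vector_derivative f (at x))"
proof -
  assume "smooth f"
  then obtain g where g: "smooth g" "\<And>x. (f has_vector_derivative g x) (at x)"
    using smooth_deriv by blast
  then have "(\<lambda>x. vector_derivative f (at x)) = g" by (auto simp: vector_derivative_at)
  then show ?thesis using g by simp
qed

lemma smooth_continuous: "smooth f \<Longrightarrow> continuous_on A f"
proof -
  assume "smooth f"
  then have "isCont f x" for x
    using smooth_has_deriv has_vector_derivative_continuous by blast
  then show ?thesis by (simp add: continuous_at_imp_continuous_on)
qed

section \<open>Test functions: supporting intervals and closure properties\<close>

lemma test_functions_smooth: "\<phi> \<in> test_functions \<Longrightarrow> smooth \<phi>"
  by (simp add: test_functions_def)

lemma test_functions_support: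
  assumes "\<phi> \<in> test_functions"
  obtains a b where "0 < a" "a < b" "b < 1" "\<And>x. x \<notin> {a..b} \<Longrightarrow> \<phi> x = 0"
proof -
  from assms obtain K where K: "compact K" "K \<subseteq> {0<..<1}" "\<And>x. x \<notin> K \<Longrightarrow> \<phi> x = 0"
    by (auto simp: test_functions_def)
  show ?thesis
  proof (cases "K = {}")
    case True
    then show ?thesis using K that[of "1/3" "2/3"] by auto
  next
    case False
    obtain a where a: "a \<in> K" "\<And>x. x \<in> K \<Longrightarrow> a \<le> x"
      using compact_attains_inf[OF K(1) False] by blast
    obtain b where b: "b \<in> K" "\<And>x. x \<in> K \<Longrightarrow> x \<le> b"
      using compact_attains_sup[OF K(1) False] by blast
    have "0 < a" "a \<le> b" "b < 1" using a b K by (auto simp: subset_iff)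
    show ?thesis
    \<comment> \<open>The support may be a single point; moving the right end halfway towards 1
      keeps a < b strict.\<close>
    proof (rule that[of a "(b + 1)/2"])
      fix x assume "x \<notin> {a..(b + 1)/2}"
      then have "x \<notin> K" using a(2) b(2) \<open>b < 1\<close> by fastforce
      then show "\<phi> x = 0" by (rule K(3))
    qed (use \<open>0 < a\<close> \<open>a \<le> b\<close> \<open>b < 1\<close> in auto)
  qed
qed

lemma test_functionsI:
  assumes "smooth \<phi>" "0 < a" "b < 1" "\<And>x. x \<notin> {a..b} \<Longrightarrow> \<phi> x = 0"
  shows "\<phi> \<in> test_functions"
  unfolding test_functions_def
  using assms by (intro CollectI conjI exI[of _ "{a..b}"] allI impI compact_Icc subsetI assms) simp_all

lemma test_functions_lincomb:
  assumes "\<phi> \<in> test_functions" "\<psi> \<in> test_functions"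
  shows "(\<lambda>x. c * \<phi> x + d * \<psi> x) \<in> test_functions"
proof -
  obtain a b where ab: "0 < a" "a < b" "b < 1" "\<And>x. x \<notin> {a..b} \<Longrightarrow> \<phi> x = 0"
    using test_functions_support[OF assms(1)] by blast
  obtain a' b' where ab': "0 < a'" "a' < b'" "b' < 1" "\<And>x. x \<notin> {a'..b'} \<Longrightarrow> \<psi> x = 0"
    using test_functions_support[OF assms(2)] by blast
  have "smooth (\<lambda>x. (\<lambda>_. c) x * \<phi> x + (\<lambda>_. d) x * \<psi> x)"
    by (rule smooth_algebra_smooth, intro smooth_algebra.add smooth_algebra.mult smooth_algebra.const smooth_algebra.smth test_functions_smooth assms)
  then show ?thesis
  proof (rule test_functionsI[of _ "min a a'" "max b b'"])
    fix x assume "x \<notin> {min a a'..max b b'}"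
    then have "x \<notin> {a..b}" "x \<notin> {a'..b'}" by auto
    then show "c * \<phi> x + d * \<psi> x = 0" using ab ab' by simp
  qed (use ab ab' in auto)
qed

lemma test_functions_mult:
  assumes "smooth f" "\<phi> \<in> test_functions"
  shows "(\<lambda>x. f x * \<phi> x) \<in> test_functions"
proof -
  obtain a b where ab: "0 < a" "a < b" "b < 1" "\<And>x. x \<notin> {a..b} \<Longrightarrow> \<phi> x = 0"
    using test_functions_support[OF assms(2)] by blast
  have "smooth (\<lambda>x. f x * \<phi> x)"
    by (rule smooth_algebra_smooth, intro smooth_algebra.add smooth_algebra.mult smooth_algebra.const smooth_algebra.smth test_functions_smooth assms)
  then show ?thesis
    by (rule test_functionsI[of _ a b]) (simp_all add: ab)
qed

lemma test_functions_deriv: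
  assumes "\<phi> \<in> test_functions"
  shows "(\<lambda>x. vector_derivative \<phi> (at x)) \<in> test_functions"
proof -
  obtain a b where ab: "0 < a" "a < b" "b < 1" "\<And>x. x \<notin> {a..b} \<Longrightarrow> \<phi> x = 0"
    using test_functions_support[OF assms(1)] by blast
  have "vector_derivative \<phi> (at x) = 0" if "x \<notin> {a..b}" for x
  proof -
    have "((\<lambda>_. 0) has_vector_derivative 0) (at x)" by simp
    then have "(\<phi> has_vector_derivative 0) (at x)"
      by (rule has_vector_derivative_transform_within_open[where S = "- {a..b}"])
        (use ab that in \<open>auto simp: open_Compl\<close>)
    then show ?thesis by (rule vector_derivative_at)
  qed
  then show ?thesis
    using ab assms
    by (intro test_functionsI[of _ a b]) (auto intro: smooth_vector_derivative test_functions_smooth)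
qed

text \<open>For k > 0 the argument k^2 x - k is positive exactly when x > 1/k, and for fixed x > 0
  it tends to infinity with k. So the support stays in [1/k, 1 - 1/k] while the values at every
  point of (0,1) tend to exp(0) = 1.\<close>

definition cutoff :: "nat \<Rightarrow> real \<Rightarrow> complex" where
  "cutoff k x = complex_of_real (flat_exp 0 ((real k)\<^sup>2 * x - real k) * flat_exp 0 ((real k)\<^sup>2 * (1 - x) - real k))"

lemma cutoff_test_function:
  assumes "k \<ge> 2"
  shows "cutoff k \<in> test_functions"
proof (rule test_functionsI[of _ "1 / real k" "1 - 1 / real k"])
  let ?f = "\<lambda>x. complex_of_real (flat_exp 0 x)"
  have "(\<lambda>x. ?f ((real k)\<^sup>2 * x + (- real k)) * ?f ((- (real k)\<^sup>2) * x + ((real k)\<^sup>2 - real k))) \<in> smooth_algebra"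
    by (intro smooth_algebra.mult smooth_algebra.affine[of ?f] smooth_algebra.flat)
  also have "(\<lambda>x. ?f ((real k)\<^sup>2 * x + (- real k)) * ?f ((- (real k)\<^sup>2) * x + ((real k)\<^sup>2 - real k))) = cutoff k"
    by (rule ext) (simp add: cutoff_def algebra_simps)
  finally show "smooth (cutoff k)" by (rule smooth_algebra_smooth)
  show "cutoff k x = 0" if "x \<notin> {1 / real k..1 - 1 / real k}" for x
  proof -
    from that consider "x < 1 / real k" | "x > 1 - 1 / real k" by fastforce
    then show ?thesis
    proof cases
      case 1
      then have "real k * (real k * x) \<le> real k * 1"
        using assms by (intro mult_left_mono) (auto simp: field_simps)
      then have "(real k)\<^sup>2 * x - real k \<le> 0" by (simp add: power2_eq_square mult.assoc)
      then show ?thesis by (simp add: cutoff_def flat_exp_def)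
    next
      case 2
      then have "real k * (real k * (1 - x)) \<le> real k * 1"
        using assms by (intro mult_left_mono) (auto simp: field_simps)
      then have "(real k)\<^sup>2 * (1 - x) - real k \<le> 0" by (simp add: power2_eq_square mult.assoc)
      then show ?thesis by (simp add: cutoff_def flat_exp_def)
    qed
  qed
qed (use assms in auto)

lemma flat_exp_0_bounds: "0 \<le> flat_exp 0 x" "flat_exp 0 x \<le> 1"
  by (auto simp: flat_exp_def)

lemma cutoff_le_1: "cmod (cutoff k x) \<le> 1"
proof -
  have "flat_exp 0 a * flat_exp 0 b \<le> 1 * 1" for a b
    by (rule mult_mono) (rule flat_exp_0_bounds zero_le_one)+
  then show ?thesis
    unfolding cutoff_def norm_of_real using flat_exp_0_bounds(1) by (simp add: abs_mult)
qed

lemma cutoff_tendsto: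
  assumes "0 < x" "x < 1"
  shows "(\<lambda>k. cutoff k x) \<longlonglongrightarrow> 1"
proof -
  have *: "(\<lambda>k. flat_exp 0 ((real k)\<^sup>2 * y - real k)) \<longlonglongrightarrow> 1" if "y > 0" for y
  proof -
    have lim: "filterlim (\<lambda>k. (real k)\<^sup>2 * y - real k) at_top sequentially"
    proof -
      have "filterlim (\<lambda>k. real k * (- 1 + y * real k)) at_top sequentially"
        by (intro filterlim_at_top_mult_at_top filterlim_real_sequentially
            filterlim_tendsto_add_at_top[OF tendsto_const]
            filterlim_tendsto_pos_mult_at_top[OF tendsto_const that])
      then show ?thesis by (simp add: algebra_simps power2_eq_square)
    qed
    have "((\<lambda>z::real. exp (- (1 / z))) \<longlongrightarrow> 1) at_top"
      by real_asymp
    from filterlim_compose[OF this lim]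
    have "(\<lambda>k. exp (- (1 / ((real k)\<^sup>2 * y - real k)))) \<longlonglongrightarrow> 1" .
    moreover have "\<forall>\<^sub>F k in sequentially. exp (- (1 / ((real k)\<^sup>2 * y - real k))) = flat_exp 0 ((real k)\<^sup>2 * y - real k)"
      using filterlim_at_top_dense[THEN iffD1, OF lim, rule_format, of 0]
      by eventually_elim (simp add: flat_exp_def)
    ultimately show ?thesis by (rule Lim_transform_eventually)
  qed
  have "(\<lambda>k. cutoff k x) \<longlonglongrightarrow> of_real (1 * 1)"
    unfolding cutoff_def by (intro tendsto_intros *) (use assms in auto)
  then show ?thesis by simp
qed

section \<open>The space of square integrable functions\<close>


lemma finite_measure_unit_itv: "finite_measure unit_itv"
  by (rule finite_measure_lebesgue_on) (auto intro: bounded_set_imp_lmeasurable)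

lemma measure_unit_itv [simp]: "measure unit_itv {0<..<1} = 1"
  by (simp add: measure_restrict_space)

lemma measurable_unit_itv_continuous:
  fixes f :: "real \<Rightarrow> 'a::euclidean_space"
  assumes "continuous_on {0<..<1} f"
  shows "f \<in> borel_measurable unit_itv"
  using continuous_imp_measurable_on_sets_lebesgue[OF assms] by simp

lemma AE_unit_itv_I: "(\<And>x. 0 < x \<Longrightarrow> x < 1 \<Longrightarrow> P x) \<Longrightarrow> AE x in unit_itv. P x"
  by (rule AE_I2) simp

text \<open>Bridge to the gauge integral, in which the fundamental theorem of calculus is available;
  the end points are negligible.\<close>

lemma unit_itv_continuous:
  fixes f :: "real \<Rightarrow> complex"
  assumes "continuous_on {0..1} f"
  shows "integrable unit_itv f" and "(LINT x|unit_itv. f x) = integral {0..1} f"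
proof -
  have "f absolutely_integrable_on {0<..<1}"
    using absolutely_integrable_continuous_real[OF assms] by (rule set_integrable_subset) auto
  then show *: "integrable unit_itv f"
    by (rule absolutely_integrable_imp_integrable) simp
  show "(LINT x|unit_itv. f x) = integral {0..1} f"
    using lebesgue_integral_eq_integral[OF *] integral_open_interval_real[of 0 1 f] by simp
qed

lemma unit_itv_bounded_integrable:
  fixes f :: "real \<Rightarrow> 'a::euclidean_space"
  assumes "f \<in> borel_measurable unit_itv" "\<And>x. 0 < x \<Longrightarrow> x < 1 \<Longrightarrow> norm (f x) \<le> B"
  shows "integrable unit_itv f"
  by (rule finite_measure.integrable_const_bound[OF finite_measure_unit_itv, where B = B])
    (use assms in \<open>auto intro: AE_unit_itv_I\<close>)

lemma L2_I:
  assumes "f \<in> borel_measurable unit_itv" "integrable unit_itv g" "\<And>x. 0 < x \<Longrightarrow> x < 1 \<Longrightarrow> (cmod (f x))\<^sup>2 \<le> g x"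
  shows "f \<in> L2"
proof -
  have "integrable unit_itv (\<lambda>x. (cmod (f x))\<^sup>2)"
    by (rule Bochner_Integration.integrable_bound[OF assms(2)])
      (use assms in \<open>auto intro!: AE_unit_itv_I intro: order_trans[OF _ abs_ge_self]\<close>)
  then show ?thesis using assms by (simp add: L2_def)
qed

lemma L2_measurable: "f \<in> L2 \<Longrightarrow> f \<in> borel_measurable unit_itv"
  and L2_integrable: "f \<in> L2 \<Longrightarrow> integrable unit_itv (\<lambda>x. (cmod (f x))\<^sup>2)"
  by (auto simp: L2_def)

lemma L2_norm_nonneg [simp]: "0 \<le> L2_norm f"
  by (simp add: L2_norm_def)

lemma L2_norm_power2: "(L2_norm f)\<^sup>2 = (LINT x|unit_itv. (cmod (f x))\<^sup>2)"
  by (simp add: L2_norm_def)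

lemma L2_bounded:
  assumes "f \<in> borel_measurable unit_itv" "\<And>x. 0 < x \<Longrightarrow> x < 1 \<Longrightarrow> cmod (f x) \<le> B"
  shows "f \<in> L2"
  by (rule L2_I[where g = "\<lambda>_. B\<^sup>2"]) (use assms in \<open>auto intro!: power_mono unit_itv_bounded_integrable\<close>)

lemma L2_continuous:
  assumes "continuous_on {0..1} f"
  shows "f \<in> L2"
proof -
  have "bounded (f ` {0..1})"
    using assms by (intro compact_imp_bounded compact_continuous_image) auto
  then obtain B where "\<And>x. x \<in> {0..1} \<Longrightarrow> cmod (f x) \<le> B" by (force simp: bounded_iff)
  moreover have "f \<in> borel_measurable unit_itv"
    by (rule measurable_unit_itv_continuous[OF continuous_on_subset[OF assms]]) auto
  ultimately show ?thesis by (intro L2_bounded[of f B]) auto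
qed

lemma L2_mult_integrable:
  assumes "f \<in> L2" "g \<in> L2"
  shows "integrable unit_itv (\<lambda>x. f x * g x)"
proof (rule Bochner_Integration.integrable_bound)
  show "integrable unit_itv (\<lambda>x. (cmod (f x))\<^sup>2 + (cmod (g x))\<^sup>2)"
    using assms by (simp add: L2_integrable)
  show "(\<lambda>x. f x * g x) \<in> borel_measurable unit_itv"
    using assms[THEN L2_measurable] by measurable
  show "AE x in unit_itv. norm (f x * g x) \<le> norm ((cmod (f x))\<^sup>2 + (cmod (g x))\<^sup>2)"
  proof (rule AE_I2)
    fix x
    have "2 * (cmod (f x) * cmod (g x)) \<le> (cmod (f x))\<^sup>2 + (cmod (g x))\<^sup>2"
      using sum_squares_bound[of "cmod (f x)" "cmod (g x)"] by (simp add: mult.assoc)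
    moreover have "0 \<le> cmod (f x) * cmod (g x)" by simp
    ultimately have "cmod (f x) * cmod (g x) \<le> (cmod (f x))\<^sup>2 + (cmod (g x))\<^sup>2" by linarith
    then show "norm (f x * g x) \<le> norm ((cmod (f x))\<^sup>2 + (cmod (g x))\<^sup>2)"
      by (simp add: norm_mult)
  qed
qed

text \<open>A quadratic in s that never becomes negative has nonpositive discriminant; s = C / A is
  its minimiser. It will be applied to the integral of (s |f| - |g|)^2.\<close>

lemma discriminant_bound:
  assumes "\<And>s::real. 0 \<le> s\<^sup>2 * A - 2 * s * C + B" "0 \<le> A" "0 \<le> B" "0 \<le> C"
  shows "C \<le> sqrt A * sqrt B"
proof (cases "A = 0")
  case True
  have "C = 0"
  proof (rule ccontr)
    assume "C \<noteq> 0"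
    \<comment> \<open>With A = 0 the quadratic degenerates to B - 2 s C, and this s gives the value
      -1.\<close>
    with assms(1)[of "(B + 1) / (2 * C)"] True show False by simp
  qed
  then show ?thesis using assms by simp
next
  case False
  then have "0 < A" using assms by simp
  have "0 \<le> (C / A)\<^sup>2 * A - 2 * (C / A) * C + B" by (rule assms)
  also have "\<dots> = B - C\<^sup>2 / A" using False by (simp add: power2_eq_square field_simps)
  finally have "C\<^sup>2 \<le> A * B" using \<open>0 < A\<close> by (simp add: field_simps)
  then have "sqrt (C\<^sup>2) \<le> sqrt (A * B)" by (rule real_sqrt_le_mono)
  then show ?thesis using assms by (simp add: real_sqrt_mult)
qed

lemma L2_cauchy_schwarz_abs:
  assumes "f \<in> L2" "g \<in> L2"
  shows "(LINT x|unit_itv. cmod (f x) * cmod (g x)) \<le> L2_norm f * L2_norm g"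
  unfolding L2_norm_def
proof (rule discriminant_bound)
  fix s :: real
  have i: "integrable unit_itv (\<lambda>x. cmod (f x) * cmod (g x))"
    using integrable_norm[OF L2_mult_integrable[OF assms]] by (simp add: norm_mult)
  have "0 \<le> (LINT x|unit_itv. (s * cmod (f x) - cmod (g x))\<^sup>2)" by simp
  also have "(LINT x|unit_itv. (s * cmod (f x) - cmod (g x))\<^sup>2) =
      (LINT x|unit_itv. s\<^sup>2 * (cmod (f x))\<^sup>2 - 2 * s * (cmod (f x) * cmod (g x)) + (cmod (g x))\<^sup>2)"
    by (rule Bochner_Integration.integral_cong) (auto simp: power2_eq_square algebra_simps)
  also have "\<dots> = s\<^sup>2 * (LINT x|unit_itv. (cmod (f x))\<^sup>2)
      - 2 * s * (LINT x|unit_itv. cmod (f x) * cmod (g x)) + (LINT x|unit_itv. (cmod (g x))\<^sup>2)"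
    using assms i by (simp add: L2_integrable)
  finally show "0 \<le> s\<^sup>2 * (LINT x|unit_itv. (cmod (f x))\<^sup>2)
      - 2 * s * (LINT x|unit_itv. cmod (f x) * cmod (g x)) + (LINT x|unit_itv. (cmod (g x))\<^sup>2)" .
qed (auto intro!: integral_nonneg_AE)

lemma L2_cauchy_schwarz:
  assumes "f \<in> L2" "g \<in> L2"
  shows "cmod (LINT x|unit_itv. f x * g x) \<le> L2_norm f * L2_norm g"
proof -
  have "cmod (LINT x|unit_itv. f x * g x) \<le> (LINT x|unit_itv. cmod (f x * g x))"
    by (rule integral_norm_bound)
  also have "\<dots> \<le> L2_norm f * L2_norm g"
    using L2_cauchy_schwarz_abs[OF assms] by (simp add: norm_mult)
  finally show ?thesis .
qed

lemma L2_lincomb: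
  assumes "f \<in> L2" "g \<in> L2"
  shows "(\<lambda>x. a * f x + b * g x) \<in> L2"
proof (rule L2_I)
  show "(\<lambda>x. a * f x + b * g x) \<in> borel_measurable unit_itv"
    using assms[THEN L2_measurable] by measurable
  show "integrable unit_itv (\<lambda>x. 2 * (cmod a)\<^sup>2 * (cmod (f x))\<^sup>2 + 2 * (cmod b)\<^sup>2 * (cmod (g x))\<^sup>2)"
    using assms by (simp add: L2_integrable)
  fix x
  have "(cmod (a * f x + b * g x))\<^sup>2 \<le> (cmod a * cmod (f x) + cmod b * cmod (g x))\<^sup>2"
    by (rule power_mono) (metis norm_mult norm_triangle_ineq, simp)
  also have "\<dots> \<le> 2 * (cmod a * cmod (f x))\<^sup>2 + 2 * (cmod b * cmod (g x))\<^sup>2"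
    using sum_squares_bound[of "cmod a * cmod (f x)" "cmod b * cmod (g x)"]
    by (simp add: power2_sum)
  finally show "(cmod (a * f x + b * g x))\<^sup>2 \<le> 2 * (cmod a)\<^sup>2 * (cmod (f x))\<^sup>2 + 2 * (cmod b)\<^sup>2 * (cmod (g x))\<^sup>2"
    by (simp add: power_mult_distrib)
qed

lemma L2_zero: "(\<lambda>_. 0) \<in> L2" by (rule L2_bounded[of _ 0]) auto

lemma L2_add: "f \<in> L2 \<Longrightarrow> g \<in> L2 \<Longrightarrow> (\<lambda>x. f x + g x) \<in> L2"
  using L2_lincomb[of f g 1 1] by simp

lemma L2_diff: "f \<in> L2 \<Longrightarrow> g \<in> L2 \<Longrightarrow> (\<lambda>x. f x - g x) \<in> L2"
  using L2_lincomb[of f g 1 "-1"] by simp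

lemma L2_cmult: "f \<in> L2 \<Longrightarrow> (\<lambda>x. c * f x) \<in> L2"
  using L2_lincomb[of f f c 0] by simp

lemma L2_uminus: "f \<in> L2 \<Longrightarrow> (\<lambda>x. - f x) \<in> L2"
  using L2_cmult[of f "-1"] by simp

lemma L2_cnj: "f \<in> L2 \<Longrightarrow> (\<lambda>x. cnj (f x)) \<in> L2"
  by (auto simp: L2_def intro: borel_measurable_continuous_onI[THEN measurable_compose_rev] continuous_intros)

lemma L2_mult_bounded:
  assumes "f \<in> L2" "h \<in> borel_measurable unit_itv" "\<And>x. 0 < x \<Longrightarrow> x < 1 \<Longrightarrow> cmod (h x) \<le> B"
  shows "(\<lambda>x. f x * h x) \<in> L2" "L2_norm (\<lambda>x. f x * h x) \<le> \<bar>B\<bar> * L2_norm f"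
proof -
  have le: "(cmod (f x * h x))\<^sup>2 \<le> B\<^sup>2 * (cmod (f x))\<^sup>2" if "0 < x" "x < 1" for x
  proof -
    have "(cmod (h x))\<^sup>2 * (cmod (f x))\<^sup>2 \<le> B\<^sup>2 * (cmod (f x))\<^sup>2"
      using power_mono[OF assms(3)[OF that], of 2] by (intro mult_right_mono) auto
    then show ?thesis by (simp add: norm_mult power_mult_distrib mult.commute)
  qed
  show L: "(\<lambda>x. f x * h x) \<in> L2"
  proof (rule L2_I)
    show "(\<lambda>x. f x * h x) \<in> borel_measurable unit_itv"
      using assms(2) L2_measurable[OF assms(1)] by measurable
    show "integrable unit_itv (\<lambda>x. B\<^sup>2 * (cmod (f x))\<^sup>2)" using assms by (simp add: L2_integrable)
  qed (rule le)
  have "(LINT x|unit_itv. (cmod (f x * h x))\<^sup>2) \<le> (LINT x|unit_itv. B\<^sup>2 * (cmod (f x))\<^sup>2)"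
    by (rule integral_mono_AE) (use L assms in \<open>auto simp: L2_integrable intro!: AE_unit_itv_I le\<close>)
  then have "L2_norm (\<lambda>x. f x * h x) \<le> sqrt (B\<^sup>2 * (LINT x|unit_itv. (cmod (f x))\<^sup>2))"
    unfolding L2_norm_def by simp
  then show "L2_norm (\<lambda>x. f x * h x) \<le> \<bar>B\<bar> * L2_norm f"
    by (simp add: L2_norm_def real_sqrt_mult)
qed

lemma L2_norm_triangle:
  assumes "f \<in> L2" "g \<in> L2"
  shows "L2_norm (\<lambda>x. f x + g x) \<le> L2_norm f + L2_norm g"
proof (rule power2_le_imp_le)
  have i: "integrable unit_itv (\<lambda>x. cmod (f x) * cmod (g x))"
    using integrable_norm[OF L2_mult_integrable[OF assms]] by (simp add: norm_mult)
  have "(L2_norm (\<lambda>x. f x + g x))\<^sup>2 = (LINT x|unit_itv. (cmod (f x + g x))\<^sup>2)"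
    by (rule L2_norm_power2)
  also have "\<dots> \<le> (LINT x|unit_itv. (cmod (f x))\<^sup>2 + 2 * (cmod (f x) * cmod (g x)) + (cmod (g x))\<^sup>2)"
  proof (rule integral_mono_AE)
    show "AE x in unit_itv. (cmod (f x + g x))\<^sup>2 \<le> (cmod (f x))\<^sup>2 + 2 * (cmod (f x) * cmod (g x)) + (cmod (g x))\<^sup>2"
    proof (rule AE_I2)
      fix x
      have "(cmod (f x + g x))\<^sup>2 \<le> (cmod (f x) + cmod (g x))\<^sup>2"
        by (intro power_mono norm_triangle_ineq) simp
      then show "(cmod (f x + g x))\<^sup>2 \<le> (cmod (f x))\<^sup>2 + 2 * (cmod (f x) * cmod (g x)) + (cmod (g x))\<^sup>2"
        by (simp add: power2_sum)
    qed
  qed (use assms i L2_add[OF assms] in \<open>simp_all add: L2_integrable\<close>)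
  also have "\<dots> = (L2_norm f)\<^sup>2 + 2 * (LINT x|unit_itv. cmod (f x) * cmod (g x)) + (L2_norm g)\<^sup>2"
    using assms i by (simp add: L2_integrable L2_norm_power2)
  also have "\<dots> \<le> (L2_norm f + L2_norm g)\<^sup>2"
    using L2_cauchy_schwarz_abs[OF assms] by (simp add: power2_sum)
  finally show "(L2_norm (\<lambda>x. f x + g x))\<^sup>2 \<le> (L2_norm f + L2_norm g)\<^sup>2" .
qed simp

lemma L2_norm_cmult: "L2_norm (\<lambda>x. c * f x) = cmod c * L2_norm f"
  by (simp add: L2_norm_def norm_mult power_mult_distrib real_sqrt_mult)

lemma L2_norm_minus_commute: "L2_norm (\<lambda>x. f x - g x) = L2_norm (\<lambda>x. g x - f x)"
  by (simp add: L2_norm_def norm_minus_commute)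

lemma L2_norm_triangle_diff:
  assumes "f \<in> L2" "g \<in> L2" "h \<in> L2"
  shows "L2_norm (\<lambda>x. f x - h x) \<le> L2_norm (\<lambda>x. f x - g x) + L2_norm (\<lambda>x. g x - h x)"
  using L2_norm_triangle[OF L2_diff[OF assms(1,2)] L2_diff[OF assms(2,3)]] by simp

lemma L2_norm_cong_AE:
  assumes "AE x in unit_itv. f x = g x" "f \<in> borel_measurable unit_itv" "g \<in> borel_measurable unit_itv"
  shows "L2_norm f = L2_norm g"
  unfolding L2_norm_def using assms
  by (intro arg_cong[where f = sqrt] integral_cong_AE) (auto elim: eventually_mono)

lemma L2_norm_eq_0:
  assumes "f \<in> L2" "L2_norm f = 0"
  shows "AE x in unit_itv. f x = 0"
proof -
  have "(LINT x|unit_itv. (cmod (f x))\<^sup>2) = 0" using assms by (simp add: L2_norm_def)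
  then have "AE x in unit_itv. (cmod (f x))\<^sup>2 = 0"
    using assms by (subst (asm) integral_nonneg_eq_0_iff_AE) (auto simp: L2_integrable)
  then show ?thesis by simp
qed

lemma L2_AE:
  assumes "f \<in> L2" "AE x in unit_itv. f x = g x" "g \<in> borel_measurable unit_itv"
  shows "g \<in> L2"
proof -
  have "integrable unit_itv (\<lambda>x. (cmod (g x))\<^sup>2)"
    using assms by (intro integrable_cong_AE_imp[OF L2_integrable[OF assms(1)]])
      (auto elim: eventually_mono intro: L2_measurable)
  then show ?thesis using assms by (simp add: L2_def)
qed

lemma L2_integral_tendsto:
  assumes "\<And>m. f m \<in> L2" "h \<in> L2" "g \<in> L2" "(\<lambda>m. L2_norm (\<lambda>x. f m x - h x)) \<longlonglongrightarrow> 0"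
  shows "(\<lambda>m. LINT x|unit_itv. f m x * g x) \<longlonglongrightarrow> (LINT x|unit_itv. h x * g x)"
proof (rule LIM_zero_cancel, rule Lim_null_comparison)
  show "\<forall>\<^sub>F m in sequentially. norm ((LINT x|unit_itv. f m x * g x) - (LINT x|unit_itv. h x * g x))
      \<le> L2_norm (\<lambda>x. f m x - h x) * L2_norm g"
  proof (rule always_eventually, rule allI)
    fix m
    have "(LINT x|unit_itv. f m x * g x) - (LINT x|unit_itv. h x * g x) = (LINT x|unit_itv. (f m x - h x) * g x)"
      using L2_mult_integrable[OF assms(1,3)] L2_mult_integrable[OF assms(2,3)] by (simp add: left_diff_distrib)
    then show "norm ((LINT x|unit_itv. f m x * g x) - (LINT x|unit_itv. h x * g x))
      \<le> L2_norm (\<lambda>x. f m x - h x) * L2_norm g"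
      using L2_cauchy_schwarz[OF L2_diff[OF assms(1,2)] assms(3)] by simp
  qed
  show "(\<lambda>m. L2_norm (\<lambda>x. f m x - h x) * L2_norm g) \<longlonglongrightarrow> 0"
    using tendsto_mult_left_zero[OF assms(4)] .
qed

lemma L2_dominated_convergence:
  assumes "\<And>m. f m \<in> borel_measurable unit_itv" "h \<in> borel_measurable unit_itv"
    and "integrable unit_itv (\<lambda>x. (G x)\<^sup>2)"
    and "\<And>m x. 0 < x \<Longrightarrow> x < 1 \<Longrightarrow> cmod (f m x - h x) \<le> G x"
    and "AE x in unit_itv. (\<lambda>m. f m x) \<longlonglongrightarrow> h x"
  shows "(\<lambda>m. L2_norm (\<lambda>x. f m x - h x)) \<longlonglongrightarrow> 0"
proof -
  have "(\<lambda>m. LINT x|unit_itv. (cmod (f m x - h x))\<^sup>2) \<longlonglongrightarrow> (LINT x|unit_itv. 0)"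
  proof (rule integral_dominated_convergence)
    show "AE x in unit_itv. (\<lambda>m. (cmod (f m x - h x))\<^sup>2) \<longlonglongrightarrow> 0"
      using assms(5)
    proof eventually_elim
      fix x assume "(\<lambda>m. f m x) \<longlonglongrightarrow> h x"
      from LIM_zero[OF this] have "(\<lambda>m. (cmod (f m x - h x))\<^sup>2) \<longlonglongrightarrow> (cmod 0)\<^sup>2"
        by (intro tendsto_intros)
      then show "(\<lambda>m. (cmod (f m x - h x))\<^sup>2) \<longlonglongrightarrow> 0" by simp
    qed
    show "AE x in unit_itv. norm ((cmod (f m x - h x))\<^sup>2) \<le> (G x)\<^sup>2" for m
      using assms(4) by (auto intro!: AE_unit_itv_I power_mono)
  qed (use assms(1-3) in \<open>measurable\<close>)
  then have "(\<lambda>m. sqrt (LINT x|unit_itv. (cmod (f m x - h x))\<^sup>2)) \<longlonglongrightarrow> sqrt 0"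
    by (intro tendsto_intros) simp
  then show ?thesis by (simp add: L2_norm_def)
qed

section \<open>Density of the test functions\<close>


text \<open>The same iteration as for \<open>smooth_algebra\<close>: polynomial functions have
  polynomial derivatives.\<close>

lemma polynomial_function_smooth:
  fixes p :: "real \<Rightarrow> complex"
  assumes "polynomial_function p"
  shows "smooth p"
proof -
  have "\<forall>p\<in>Collect polynomial_function. \<exists>p'. polynomial_function p' \<and> (\<forall>x. ((p::real\<Rightarrow>complex) has_vector_derivative p' x) (at x))"
    using has_vector_derivative_polynomial_function by blast
  from bchoice[OF this] obtain d where
    d: "\<And>p::real\<Rightarrow>complex. polynomial_function p \<Longrightarrow> polynomial_function (d p)"
       "\<And>p x. polynomial_function p \<Longrightarrow> ((p::real\<Rightarrow>complex) has_vector_derivative d p x) (at x)"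
    by blast
  have mem: "polynomial_function ((d ^^ k) p)" for k
    by (induction k) (use assms d in auto)
  show ?thesis
    unfolding smooth_def
    by (rule exI[of _ "\<lambda>k. (d ^^ k) p"]) (use d mem in auto)
qed

lemma test_functions_L2: "\<phi> \<in> test_functions \<Longrightarrow> \<phi> \<in> L2"
  by (intro L2_continuous smooth_continuous test_functions_smooth)

text \<open>Membership in the L2 closure of the test functions. As a predicate stable under L2
  limits it allows the density proof to climb from smooth to continuous, to bounded measurable, and
  finally to all square integrable functions.\<close>

definition L2_approx :: "(real \<Rightarrow> complex) \<Rightarrow> bool" where
  "L2_approx g \<longleftrightarrow> g \<in> L2 \<and> (\<forall>e>0. \<exists>\<phi>\<in>test_functions. L2_norm (\<lambda>x. \<phi> x - g x) < e)"

lemma L2_approx_close: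
  assumes "g \<in> L2" "\<And>e. e > 0 \<Longrightarrow> \<exists>h. L2_approx h \<and> L2_norm (\<lambda>x. h x - g x) < e"
  shows "L2_approx g"
  unfolding L2_approx_def
proof (intro conjI allI impI assms(1))
  fix e :: real assume "e > 0"
  then obtain h where h: "L2_approx h" "L2_norm (\<lambda>x. h x - g x) < e / 2"
    using assms(2)[of "e / 2"] by auto
  then obtain \<phi> where phi: "\<phi> \<in> test_functions" "L2_norm (\<lambda>x. \<phi> x - h x) < e / 2"
    using \<open>e > 0\<close> unfolding L2_approx_def by (meson half_gt_zero)
  have "L2_norm (\<lambda>x. \<phi> x - g x) \<le> L2_norm (\<lambda>x. \<phi> x - h x) + L2_norm (\<lambda>x. h x - g x)"
    using h(1) assms(1) by (intro L2_norm_triangle_diff test_functions_L2[OF phi(1)]) (auto simp: L2_approx_def)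
  then have "L2_norm (\<lambda>x. \<phi> x - g x) < e" using h phi by linarith
  then show "\<exists>\<phi>\<in>test_functions. L2_norm (\<lambda>x. \<phi> x - g x) < e" using phi by blast
qed

lemma L2_approx_limit:
  assumes "g \<in> L2" "\<And>m. L2_approx (f m)" "(\<lambda>m. L2_norm (\<lambda>x. f m x - g x)) \<longlonglongrightarrow> 0"
  shows "L2_approx g"
proof (rule L2_approx_close[OF assms(1)])
  fix e :: real assume "e > 0"
  then have "\<forall>\<^sub>F m in sequentially. L2_norm (\<lambda>x. f m x - g x) < e"
    using order_tendstoD(2)[OF assms(3)] by blast
  then obtain m where "L2_norm (\<lambda>x. f m x - g x) < e"
    by (auto simp: eventually_sequentially)
  then show "\<exists>h. L2_approx h \<and> L2_norm (\<lambda>x. h x - g x) < e" using assms(2) by blast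
qed

lemma L2_approx_test: "\<phi> \<in> test_functions \<Longrightarrow> L2_approx \<phi>"
  unfolding L2_approx_def
  by (intro conjI allI impI bexI[of _ \<phi>] test_functions_L2) (simp_all add: L2_norm_def)

lemma continuous_01_bounded:
  fixes f :: "real \<Rightarrow> complex"
  assumes "continuous_on {0..1} f"
  obtains B where "0 < B" "\<And>x. 0 \<le> x \<Longrightarrow> x \<le> 1 \<Longrightarrow> cmod (f x) \<le> B"
proof -
  have "bounded (f ` {0..1})"
    using assms by (intro compact_imp_bounded compact_continuous_image) auto
  then obtain B where "0 < B" "\<forall>y\<in>f ` {0..1}. cmod y \<le> B" by (auto simp: bounded_pos)
  then show ?thesis by (intro that[of B]) auto
qed

lemma L2_approx_smooth:
  assumes "smooth p"
  shows "L2_approx p"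
proof (rule L2_approx_limit)
  have cont: "continuous_on A p" for A using assms by (rule smooth_continuous)
  show p: "p \<in> L2" using cont by (rule L2_continuous)
  \<comment> \<open>The index is shifted because \<open>cutoff_test_function\<close> asks for k >=
    2.\<close>
  let ?f = "\<lambda>m x. p x * cutoff (m + 2) x"
  show test: "L2_approx (?f m)" for m
    by (intro L2_approx_test test_functions_mult assms cutoff_test_function) simp
  obtain B where B: "\<And>x. 0 \<le> x \<Longrightarrow> x \<le> 1 \<Longrightarrow> cmod (p x) \<le> B"
    using continuous_01_bounded[OF cont] by metis
  show "(\<lambda>m. L2_norm (\<lambda>x. ?f m x - p x)) \<longlonglongrightarrow> 0"
  proof (rule L2_dominated_convergence[where G = "\<lambda>_. B * 2"])
    show "?f m \<in> borel_measurable unit_itv" for m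
      using test[of m] by (simp add: L2_approx_def L2_measurable)
    show "p \<in> borel_measurable unit_itv" using p by (rule L2_measurable)
    show "integrable unit_itv (\<lambda>x. (B * 2)\<^sup>2)" by (rule unit_itv_bounded_integrable) auto
    show "cmod (?f m x - p x) \<le> B * 2" if "0 < x" "x < 1" for m x
    proof -
      have "cmod (?f m x - p x) = cmod (p x) * cmod (cutoff (m + 2) x - 1)"
        by (simp add: algebra_simps flip: norm_mult)
      also have "\<dots> \<le> B * 2"
        using that norm_triangle_ineq4[of "cutoff (m + 2) x" 1] cutoff_le_1[of "m + 2" x] B[of x]
        by (intro mult_mono) (auto intro: order_trans[OF norm_ge_zero])
      finally show ?thesis .
    qed
    show "AE x in unit_itv. (\<lambda>m. ?f m x) \<longlonglongrightarrow> p x"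
    proof (rule AE_unit_itv_I)
      fix x :: real assume "0 < x" "x < 1"
      from LIMSEQ_ignore_initial_segment[OF cutoff_tendsto[OF this], of 2]
      have "(\<lambda>m. p x * cutoff (m + 2) x) \<longlonglongrightarrow> p x * 1" by (intro tendsto_intros)
      then show "(\<lambda>m. ?f m x) \<longlonglongrightarrow> p x" by simp
    qed
  qed
qed

lemma L2_norm_le_bound:
  assumes "f \<in> borel_measurable unit_itv" "\<And>x. 0 < x \<Longrightarrow> x < 1 \<Longrightarrow> cmod (f x) \<le> B" "0 \<le> B"
  shows "L2_norm f \<le> B"
proof -
  have "(\<lambda>_. 1) \<in> L2" by (rule L2_bounded[of _ 1]) auto
  from L2_mult_bounded(2)[OF this assms(1,2)] assms(3)
  show ?thesis by (simp add: L2_norm_def)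
qed

text \<open>Weierstrass approximation: polynomials are smooth, and uniform closeness bounds the L2
  distance because the interval has measure 1.\<close>

lemma L2_approx_continuous:
  assumes "continuous_on {0..1} g"
  shows "L2_approx g"
proof (rule L2_approx_close)
  show g: "g \<in> L2" using assms by (rule L2_continuous)
  fix e :: real assume "e > 0"
  then obtain p where p: "polynomial_function p" "\<And>x. x \<in> {0..1} \<Longrightarrow> norm (g x - p x) < e / 2"
    using Stone_Weierstrass_polynomial_function[OF compact_Icc assms, of "e / 2"] by auto
  have ap: "L2_approx p" using p by (intro L2_approx_smooth polynomial_function_smooth)
  have "L2_norm (\<lambda>x. p x - g x) \<le> e / 2"
  proof (rule L2_norm_le_bound)
    show "(\<lambda>x. p x - g x) \<in> borel_measurable unit_itv"
      using L2_diff[OF _ g] ap by (auto simp: L2_approx_def intro: L2_measurable)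
    show "cmod (p x - g x) \<le> e / 2" if "0 < x" "x < 1" for x
      using p(2)[of x] that by (simp add: norm_minus_commute)
  qed (use \<open>e > 0\<close> in simp)
  then show "\<exists>h. L2_approx h \<and> L2_norm (\<lambda>x. h x - g x) < e"
    using ap \<open>e > 0\<close> by (intro exI[of _ p]) auto
qed

lemma L2_approx_bounded:
  assumes "f \<in> borel_measurable unit_itv" "\<And>x. 0 < x \<Longrightarrow> x < 1 \<Longrightarrow> cmod (f x) \<le> B" "0 < B"
  shows "L2_approx f"
proof -
  have "f measurable_on {0<..<1}" using assms(1) by (simp add: measurable_on_iff_borel_measurable)
  then obtain N g where g: "negligible N" "\<And>n::nat. continuous_on UNIV (g n)"
    "\<And>x. x \<notin> N \<Longrightarrow> (\<lambda>n. g n x) \<longlonglongrightarrow> (if x \<in> {0<..<1} then f x else 0)"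
    unfolding measurable_on_def by blast
  \<comment> \<open>Radial retraction of g n onto the disc of radius B. It is continuous, provides
    the dominating constant, and does not change the limit since |f| <= B.\<close>
  define h where "h n x = g n x / complex_of_real (max 1 (cmod (g n x) / B))" for n x
  have hcont: "continuous_on A (h n)" for A n
    unfolding h_def using \<open>0 < B\<close> by (intro continuous_intros continuous_on_subset[OF g(2)]) auto
  have hB: "cmod (h n x) \<le> B" for n x
  proof (cases "cmod (g n x) / B \<le> 1")
    case True
    then show ?thesis using \<open>0 < B\<close> by (simp add: h_def norm_divide max_absorb1 field_simps)
  next
    case False
    then have "g n x \<noteq> 0" "1 \<le> cmod (g n x) / B" by auto
    then show ?thesis using \<open>0 < B\<close> by (simp add: h_def norm_divide norm_mult max_absorb2)
  qed
  show ?thesis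
  proof (rule L2_approx_limit[where f = h])
    show "f \<in> L2" using assms by (intro L2_bounded)
    show "L2_approx (h m)" for m by (rule L2_approx_continuous[OF hcont])
    show "(\<lambda>m. L2_norm (\<lambda>x. h m x - f x)) \<longlonglongrightarrow> 0"
    proof (rule L2_dominated_convergence[where G = "\<lambda>_. B + B"])
      show "h m \<in> borel_measurable unit_itv" for m by (rule measurable_unit_itv_continuous[OF hcont])
      show "integrable unit_itv (\<lambda>x. (B + B)\<^sup>2)" by (rule unit_itv_bounded_integrable) auto
      show "cmod (h m x - f x) \<le> B + B" if "0 < x" "x < 1" for m x
        using norm_triangle_ineq4[of "h m x" "f x"] hB[of m x] assms(2)[OF that] by linarith
      have "AE x in lebesgue. x \<notin> N"
        using g(1) by (auto simp: negligible_iff_null_sets intro: AE_not_in)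
      then have "AE x in unit_itv. x \<notin> N" by (auto simp: AE_restrict_space_iff elim: eventually_mono)
      then show "AE x in unit_itv. (\<lambda>m. h m x) \<longlonglongrightarrow> f x"
        using AE_space
      proof eventually_elim
        case (elim x)
        then have x: "0 < x" "x < 1" and lim: "(\<lambda>n. g n x) \<longlonglongrightarrow> f x" using g(3)[of x] by auto
        have "(\<lambda>m. h m x) \<longlonglongrightarrow> f x / complex_of_real (max 1 (cmod (f x) / B))"
          unfolding h_def by (intro tendsto_intros lim) (use \<open>0 < B\<close> in auto)
        moreover have "max 1 (cmod (f x) / B) = 1"
          using assms(2)[OF x] \<open>0 < B\<close> by (simp add: field_simps)
        ultimately show ?case by simp
      qed
    qed (use assms in auto)
  qed
qed

text \<open>Truncation by size: the truncated functions are bounded, at each point they eventually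
  equal g, and they differ from g by at most |g|.\<close>

theorem L2_test_dense:
  assumes "g \<in> L2" "e > 0"
  obtains \<phi> where "\<phi> \<in> test_functions" "L2_norm (\<lambda>x. \<phi> x - g x) < e"
proof -
  have meas: "g \<in> borel_measurable unit_itv" using assms(1) by (rule L2_measurable)
  let ?f = "\<lambda>m::nat. \<lambda>x. if cmod (g x) \<le> real m + 1 then g x else 0"
  have fm: "?f m \<in> borel_measurable unit_itv" for m using meas by measurable
  have "L2_approx g"
  proof (rule L2_approx_limit[where f = ?f])
    show "L2_approx (?f m)" for m
      by (rule L2_approx_bounded[where B = "real m + 1", OF fm]) auto
    show "(\<lambda>m. L2_norm (\<lambda>x. ?f m x - g x)) \<longlonglongrightarrow> 0"
    proof (rule L2_dominated_convergence[where G = "\<lambda>x. cmod (g x)", OF fm meas])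
      show "integrable unit_itv (\<lambda>x. (cmod (g x))\<^sup>2)" using assms(1) by (rule L2_integrable)
      show "AE x in unit_itv. (\<lambda>m. ?f m x) \<longlonglongrightarrow> g x"
      proof (rule AE_I2)
        fix x
        have "\<forall>\<^sub>F m in sequentially. g x = ?f m x"
        proof (rule eventually_sequentiallyI)
          fix m assume "nat \<lceil>cmod (g x)\<rceil> \<le> m"
          then have "cmod (g x) \<le> real m + 1" by linarith
          then show "g x = ?f m x" by simp
        qed
        with tendsto_const show "(\<lambda>m. ?f m x) \<longlonglongrightarrow> g x" by (rule Lim_transform_eventually)
      qed
    qed auto
  qed (rule assms)
  then show ?thesis using assms that by (auto simp: L2_approx_def)
qed

lemma L2_test_sequence:
  assumes "g \<in> L2"
  obtains \<phi> where "\<And>m::nat. \<phi> m \<in> test_functions" "(\<lambda>m. L2_norm (\<lambda>x. \<phi> m x - g x)) \<longlonglongrightarrow> 0"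
proof -
  have "\<exists>\<phi>\<in>test_functions. L2_norm (\<lambda>x. \<phi> x - g x) < 1 / real (Suc m)" for m
    using L2_test_dense[OF assms, of "1 / real (Suc m)"] by (metis divide_pos_pos of_nat_0_less_iff zero_less_Suc zero_less_one)
  then obtain \<phi> where phi: "\<And>m. \<phi> m \<in> test_functions" "\<And>m. L2_norm (\<lambda>x. \<phi> m x - g x) < 1 / real (Suc m)"
    by metis
  have "(\<lambda>m. L2_norm (\<lambda>x. \<phi> m x - g x)) \<longlonglongrightarrow> 0"
  proof (rule Lim_null_comparison)
    show "\<forall>\<^sub>F m in sequentially. norm (L2_norm (\<lambda>x. \<phi> m x - g x)) \<le> 1 / real (Suc m)"
      using phi(2) by (auto intro!: always_eventually less_imp_le)
    show "(\<lambda>m. 1 / real (Suc m)) \<longlonglongrightarrow> 0" using LIMSEQ_inverse_real_of_nat by (simp add: divide_inverse)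
  qed
  with phi(1) show ?thesis by (rule that)
qed

text \<open>The pairing has no conjugation, so the test functions have to approximate cnj g; in the
  limit the integral of |g|^2 is 0.\<close>

lemma L2_orthogonal_test_AE_0:
  assumes "g \<in> L2" "\<And>\<phi>. \<phi> \<in> test_functions \<Longrightarrow> (LINT x|unit_itv. g x * \<phi> x) = 0"
  shows "AE x in unit_itv. g x = 0"
proof (rule L2_norm_eq_0[OF assms(1)])
  have c: "(\<lambda>x. cnj (g x)) \<in> L2" using assms(1) by (rule L2_cnj)
  obtain \<phi> where phi: "\<And>m::nat. \<phi> m \<in> test_functions" "(\<lambda>m. L2_norm (\<lambda>x. \<phi> m x - cnj (g x))) \<longlonglongrightarrow> 0"
    using L2_test_sequence[OF c] by blast
  have "(\<lambda>m. LINT x|unit_itv. \<phi> m x * g x) \<longlonglongrightarrow> (LINT x|unit_itv. cnj (g x) * g x)"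
    by (rule L2_integral_tendsto[OF test_functions_L2[OF phi(1)] c assms(1) phi(2)])
  moreover have "(LINT x|unit_itv. \<phi> m x * g x) = 0" for m
    using assms(2)[OF phi(1)] by (simp add: mult.commute)
  ultimately have "(LINT x|unit_itv. cnj (g x) * g x) = 0"
    using LIMSEQ_unique[OF _ tendsto_const[of 0]] by simp
  moreover have "(LINT x|unit_itv. cnj (g x) * g x) = complex_of_real ((L2_norm g)\<^sup>2)"
    unfolding L2_norm_power2 integral_complex_of_real[symmetric]
    by (rule Bochner_Integration.integral_cong) (simp_all add: complex_norm_square[symmetric] mult.commute)
  ultimately show "L2_norm g = 0" by simp
qed

section \<open>Weak derivatives\<close>


lemma test_functions_boundary: "\<phi> \<in> test_functions \<Longrightarrow> \<phi> 0 = 0 \<and> \<phi> 1 = 0"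
  by (rule test_functions_support) auto

lemma test_functions_has_deriv:
  "\<phi> \<in> test_functions \<Longrightarrow> (\<phi> has_vector_derivative vector_derivative \<phi> (at x)) (at x within A)"
  by (rule has_vector_derivative_at_within[OF smooth_has_deriv[OF test_functions_smooth]])

lemma test_functions_continuous: "\<phi> \<in> test_functions \<Longrightarrow> continuous_on A \<phi>"
  by (intro smooth_continuous test_functions_smooth)

lemma unit_itv_FTC:
  fixes f :: "real \<Rightarrow> complex"
  assumes "continuous_on {0..1} f'" "\<And>x. x \<in> {0..1} \<Longrightarrow> (f has_vector_derivative f' x) (at x within {0..1})"
  shows "(LINT x|unit_itv. f' x) = f 1 - f 0"
  using fundamental_theorem_of_calculus[of 0 1 f f'] assms
  by (simp add: unit_itv_continuous(2) integral_unique)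

lemma unit_itv_integration_by_parts:
  fixes f g :: "real \<Rightarrow> complex"
  assumes "continuous_on {0..1} f'" "\<And>x. x \<in> {0..1} \<Longrightarrow> (f has_vector_derivative f' x) (at x within {0..1})"
    and "continuous_on {0..1} g'" "\<And>x. x \<in> {0..1} \<Longrightarrow> (g has_vector_derivative g' x) (at x within {0..1})"
    and "f 0 * g 0 = f 1 * g 1"
  shows "(LINT x|unit_itv. f x * g' x) = - (LINT x|unit_itv. f' x * g x)"
proof -
  have cf: "continuous_on {0..1} f" and cg: "continuous_on {0..1} g"
    using continuous_on_vector_derivative[OF assms(2)] continuous_on_vector_derivative[OF assms(4)] by blast+
  have i: "integrable unit_itv (\<lambda>x. f x * g' x)" "integrable unit_itv (\<lambda>x. f' x * g x)"
    by (intro unit_itv_continuous(1) continuous_intros cf cg assms)+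
  have "(LINT x|unit_itv. f x * g' x + f' x * g x) = f 1 * g 1 - f 0 * g 0"
  proof (rule unit_itv_FTC[where f = "\<lambda>x. f x * g x"])
    show "continuous_on {0..1} (\<lambda>x. f x * g' x + f' x * g x)"
      by (intro continuous_intros cf cg assms(1,3))
    show "((\<lambda>x. f x * g x) has_vector_derivative f x * g' x + f' x * g x) (at x within {0..1})"
      if "x \<in> {0..1}" for x
      by (rule has_vector_derivative_mult[OF assms(2)[OF that] assms(4)[OF that]])
  qed
  then show ?thesis using i assms(5) by (simp add: add_eq_0_iff)
qed

lemma has_weak_deriv_C1:
  assumes "continuous_on {0..1} f'" "\<And>x. x \<in> {0..1} \<Longrightarrow> (f has_vector_derivative f' x) (at x within {0..1})"
  shows "has_weak_deriv f f'"
  unfolding has_weak_deriv_def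
proof (intro conjI ballI)
  show "f \<in> L2" using continuous_on_vector_derivative[OF assms(2)] by (rule L2_continuous)
  show "f' \<in> L2" using assms(1) by (rule L2_continuous)
  fix \<phi> assume phi: "\<phi> \<in> test_functions"
  show "(LINT x|unit_itv. f x * vector_derivative \<phi> (at x)) = - (LINT x|unit_itv. f' x * \<phi> x)"
    by (rule unit_itv_integration_by_parts[OF assms])
      (use phi test_functions_boundary[OF phi] in
        \<open>auto intro: test_functions_has_deriv test_functions_continuous[OF test_functions_deriv]\<close>)
qed

lemma has_weak_deriv_test:
  "\<phi> \<in> test_functions \<Longrightarrow> has_weak_deriv \<phi> (\<lambda>x. vector_derivative \<phi> (at x))"
  by (intro has_weak_deriv_C1 test_functions_continuous test_functions_deriv test_functions_has_deriv)

lemma has_weak_deriv_L2: "has_weak_deriv f g \<Longrightarrow> f \<in> L2" "has_weak_deriv f g \<Longrightarrow> g \<in> L2"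
  by (auto simp: has_weak_deriv_def)

lemma has_weak_deriv_test_eq:
  "has_weak_deriv f g \<Longrightarrow> \<phi> \<in> test_functions \<Longrightarrow>
    (LINT x|unit_itv. f x * vector_derivative \<phi> (at x)) = - (LINT x|unit_itv. g x * \<phi> x)"
  by (auto simp: has_weak_deriv_def)

lemma has_weak_deriv_unique:
  assumes "has_weak_deriv f g" "has_weak_deriv f h"
  shows "AE x in unit_itv. g x = h x"
proof -
  note L = has_weak_deriv_L2[OF assms(1)] has_weak_deriv_L2[OF assms(2)]
  have "AE x in unit_itv. g x - h x = 0"
  proof (rule L2_orthogonal_test_AE_0)
    show "(\<lambda>x. g x - h x) \<in> L2" using L by (intro L2_diff)
    fix \<phi> assume phi: "\<phi> \<in> test_functions"
    have "(LINT x|unit_itv. g x * \<phi> x) = (LINT x|unit_itv. h x * \<phi> x)"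
      using assms[THEN has_weak_deriv_test_eq, OF phi] by simp
    then show "(LINT x|unit_itv. (g x - h x) * \<phi> x) = 0"
      using L L2_mult_integrable[OF _ test_functions_L2[OF phi]] by (simp add: left_diff_distrib)
  qed
  then show ?thesis by simp
qed

lemma has_weak_deriv_cong:
  assumes "has_weak_deriv f g" "AE x in unit_itv. f x = f' x" "AE x in unit_itv. g x = g' x"
    "f' \<in> borel_measurable unit_itv" "g' \<in> borel_measurable unit_itv"
  shows "has_weak_deriv f' g'"
  unfolding has_weak_deriv_def
proof (intro conjI ballI)
  note L = has_weak_deriv_L2[OF assms(1)]
  show L': "f' \<in> L2" "g' \<in> L2" using L assms by (auto intro: L2_AE)
  fix \<phi> assume phi: "\<phi> \<in> test_functions"
  note [measurable] = L[THEN L2_measurable] assms(4,5) test_functions_L2[OF phi, THEN L2_measurable]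
    test_functions_L2[OF test_functions_deriv[OF phi], THEN L2_measurable]
  have "(LINT x|unit_itv. f x * vector_derivative \<phi> (at x)) = (LINT x|unit_itv. f' x * vector_derivative \<phi> (at x))"
    using assms(2) by (intro integral_cong_AE) (auto elim: eventually_mono)
  moreover have "(LINT x|unit_itv. g x * \<phi> x) = (LINT x|unit_itv. g' x * \<phi> x)"
    using assms(3) by (intro integral_cong_AE) (auto elim: eventually_mono)
  ultimately show "(LINT x|unit_itv. f' x * vector_derivative \<phi> (at x)) = - (LINT x|unit_itv. g' x * \<phi> x)"
    using has_weak_deriv_test_eq[OF assms(1) phi] by simp
qed

lemma has_weak_deriv_weak_deriv: "has_weak_deriv f g \<Longrightarrow> has_weak_deriv f (weak_deriv f)"
  unfolding weak_deriv_def by (rule someI[where P = "has_weak_deriv f"])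

lemma weak_deriv_AE: "has_weak_deriv f g \<Longrightarrow> AE x in unit_itv. weak_deriv f x = g x"
  using has_weak_deriv_unique has_weak_deriv_weak_deriv by blast

lemma has_weak_deriv_lincomb:
  assumes "has_weak_deriv f f'" "has_weak_deriv g g'"
  shows "has_weak_deriv (\<lambda>x. a * f x + b * g x) (\<lambda>x. a * f' x + b * g' x)"
  unfolding has_weak_deriv_def
proof (intro conjI ballI)
  note L = has_weak_deriv_L2[OF assms(1)] has_weak_deriv_L2[OF assms(2)]
  show "(\<lambda>x. a * f x + b * g x) \<in> L2" "(\<lambda>x. a * f' x + b * g' x) \<in> L2"
    using L by (auto intro: L2_lincomb)
  fix \<phi> assume phi: "\<phi> \<in> test_functions"
  let ?d = "\<lambda>x. vector_derivative \<phi> (at x)"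
  have i: "integrable unit_itv (\<lambda>x. f x * ?d x)" "integrable unit_itv (\<lambda>x. g x * ?d x)"
    "integrable unit_itv (\<lambda>x. f' x * \<phi> x)" "integrable unit_itv (\<lambda>x. g' x * \<phi> x)"
    using L phi by (auto intro!: L2_mult_integrable test_functions_L2 test_functions_deriv)
  have "(LINT x|unit_itv. (a * f x + b * g x) * ?d x) = (LINT x|unit_itv. a * (f x * ?d x) + b * (g x * ?d x))"
    by (simp add: algebra_simps)
  also have "\<dots> = a * (LINT x|unit_itv. f x * ?d x) + b * (LINT x|unit_itv. g x * ?d x)"
    using i by simp
  also have "\<dots> = - (a * (LINT x|unit_itv. f' x * \<phi> x) + b * (LINT x|unit_itv. g' x * \<phi> x))"
    using assms[THEN has_weak_deriv_test_eq, OF phi] by simp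
  also have "\<dots> = - (LINT x|unit_itv. a * (f' x * \<phi> x) + b * (g' x * \<phi> x))"
    using i by simp
  also have "\<dots> = - (LINT x|unit_itv. (a * f' x + b * g' x) * \<phi> x)"
    by (simp add: algebra_simps)
  finally show "(LINT x|unit_itv. (a * f x + b * g x) * ?d x) = - (LINT x|unit_itv. (a * f' x + b * g' x) * \<phi> x)" .
qed

lemma W12_0_weak_deriv: "f \<in> W12_0 \<Longrightarrow> has_weak_deriv f (weak_deriv f)"
proof -
  assume "f \<in> W12_0"
  then obtain g where "has_weak_deriv f g" unfolding W12_0_def W12_def by blast
  then show ?thesis by (rule has_weak_deriv_weak_deriv)
qed

lemma W12_0_L2: "f \<in> W12_0 \<Longrightarrow> f \<in> L2" "f \<in> W12_0 \<Longrightarrow> weak_deriv f \<in> L2"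
  using has_weak_deriv_L2[OF W12_0_weak_deriv[of f]] by auto

lemma W12_0_approx:
  assumes "f \<in> W12_0"
  obtains \<phi> where "\<And>m::nat. \<phi> m \<in> test_functions" "(\<lambda>m. L2_norm (\<lambda>x. \<phi> m x - f x)) \<longlonglongrightarrow> 0"
    "(\<lambda>m. L2_norm (\<lambda>x. vector_derivative (\<phi> m) (at x) - weak_deriv f x)) \<longlonglongrightarrow> 0"
proof -
  have "\<exists>\<phi> :: nat \<Rightarrow> real \<Rightarrow> complex. (\<forall>m. \<phi> m \<in> test_functions) \<and>
     (\<lambda>m. L2_norm (\<lambda>x. \<phi> m x - f x)) \<longlonglongrightarrow> 0 \<and>
     (\<lambda>m. L2_norm (\<lambda>x. vector_derivative (\<phi> m) (at x) - weak_deriv f x)) \<longlonglongrightarrow> 0"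
    using assms unfolding W12_0_def by simp
  then show ?thesis by (elim exE conjE) (rule that, simp_all)
qed

text \<open>Frees membership from the choice made in \<open>weak_deriv\<close>. Integration by parts
  against a test function passes to the L2 limit, so any limit g of the derivatives is itself a weak
  derivative.\<close>

lemma W12_0_I:
  assumes "f \<in> L2" "g \<in> L2" "\<And>m. \<phi> m \<in> test_functions" "(\<lambda>m. L2_norm (\<lambda>x. \<phi> m x - f x)) \<longlonglongrightarrow> 0"
    "(\<lambda>m. L2_norm (\<lambda>x. vector_derivative (\<phi> m) (at x) - g x)) \<longlonglongrightarrow> 0"
  shows "f \<in> W12_0" "has_weak_deriv f g"
proof -
  show w: "has_weak_deriv f g"
    unfolding has_weak_deriv_def
  proof (intro conjI ballI assms)
    fix \<psi> assume psi: "\<psi> \<in> test_functions"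
    have "(\<lambda>m. LINT x|unit_itv. \<phi> m x * vector_derivative \<psi> (at x)) \<longlonglongrightarrow> (LINT x|unit_itv. f x * vector_derivative \<psi> (at x))"
      by (intro L2_integral_tendsto test_functions_L2 test_functions_deriv psi assms)
    moreover have "(\<lambda>m. LINT x|unit_itv. vector_derivative (\<phi> m) (at x) * \<psi> x) \<longlonglongrightarrow> (LINT x|unit_itv. g x * \<psi> x)"
      by (intro L2_integral_tendsto test_functions_L2 test_functions_deriv psi assms)
    then have "(\<lambda>m. LINT x|unit_itv. \<phi> m x * vector_derivative \<psi> (at x)) \<longlonglongrightarrow> - (LINT x|unit_itv. g x * \<psi> x)"
      using has_weak_deriv_test_eq[OF has_weak_deriv_test[OF assms(3)] psi] by (simp add: tendsto_minus)
    ultimately show "(LINT x|unit_itv. f x * vector_derivative \<psi> (at x)) = - (LINT x|unit_itv. g x * \<psi> x)"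
      by (rule LIMSEQ_unique)
  qed
  note wd = has_weak_deriv_weak_deriv[OF w]
  \<comment> \<open>The chosen derivative agrees with g only almost everywhere, a difference that
    the norm does not see.\<close>
  have "L2_norm (\<lambda>x. vector_derivative (\<phi> m) (at x) - weak_deriv f x) = L2_norm (\<lambda>x. vector_derivative (\<phi> m) (at x) - g x)" for m
    by (rule L2_norm_cong_AE)
      (use weak_deriv_AE[OF w] in \<open>auto elim: eventually_mono intro!: L2_measurable L2_diff
        test_functions_L2[OF test_functions_deriv[OF assms(3)]] assms(2) has_weak_deriv_L2(2)[OF wd]\<close>)
  then show "f \<in> W12_0"
    unfolding W12_0_def W12_def using w assms(3-5) by (intro CollectI conjI exI[of _ \<phi>] exI[of _ g]) auto
qed

lemma test_functions_W12_0: "\<phi> \<in> test_functions \<Longrightarrow> \<phi> \<in> W12_0"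
  by (rule W12_0_I(1)[where \<phi> = "\<lambda>_. \<phi>" and g = "\<lambda>x. vector_derivative \<phi> (at x)"])
    (simp_all add: test_functions_L2 test_functions_deriv L2_norm_def)

lemma tendsto_lincomb_norm:
  assumes "\<And>m. F m \<in> L2" "f \<in> L2" "\<And>m. G m \<in> L2" "g \<in> L2"
    "(\<lambda>m. L2_norm (\<lambda>x. F m x - f x)) \<longlonglongrightarrow> 0" "(\<lambda>m. L2_norm (\<lambda>x. G m x - g x)) \<longlonglongrightarrow> 0"
  shows "(\<lambda>m. L2_norm (\<lambda>x. (a * F m x + b * G m x) - (a * f x + b * g x))) \<longlonglongrightarrow> 0"
proof (rule Lim_null_comparison)
  show "\<forall>\<^sub>F m in sequentially. norm (L2_norm (\<lambda>x. (a * F m x + b * G m x) - (a * f x + b * g x)))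
     \<le> cmod a * L2_norm (\<lambda>x. F m x - f x) + cmod b * L2_norm (\<lambda>x. G m x - g x)"
  proof (rule always_eventually, rule allI)
    fix m
    have "L2_norm (\<lambda>x. a * (F m x - f x) + b * (G m x - g x))
      \<le> L2_norm (\<lambda>x. a * (F m x - f x)) + L2_norm (\<lambda>x. b * (G m x - g x))"
      by (intro L2_norm_triangle L2_cmult L2_diff assms)
    also have "(\<lambda>x. a * (F m x - f x) + b * (G m x - g x)) = (\<lambda>x. (a * F m x + b * G m x) - (a * f x + b * g x))"
      by (rule ext) (simp add: algebra_simps)
    finally show "norm (L2_norm (\<lambda>x. (a * F m x + b * G m x) - (a * f x + b * g x)))
     \<le> cmod a * L2_norm (\<lambda>x. F m x - f x) + cmod b * L2_norm (\<lambda>x. G m x - g x)"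
      by (simp add: L2_norm_cmult)
  qed
  show "(\<lambda>m. cmod a * L2_norm (\<lambda>x. F m x - f x) + cmod b * L2_norm (\<lambda>x. G m x - g x)) \<longlonglongrightarrow> 0"
    using tendsto_add[OF tendsto_mult_right_zero[OF assms(5)] tendsto_mult_right_zero[OF assms(6)]] by simp
qed

lemma test_functions_deriv_lincomb:
  assumes "\<phi> \<in> test_functions" "\<psi> \<in> test_functions"
  shows "vector_derivative (\<lambda>x. a * \<phi> x + b * \<psi> x) (at x) = a * vector_derivative \<phi> (at x) + b * vector_derivative \<psi> (at x)"
  by (intro vector_derivative_at has_vector_derivative_add has_vector_derivative_mult_right test_functions_has_deriv assms)

lemma W12_0_lincomb:
  assumes "f \<in> W12_0" "g \<in> W12_0"
  shows "(\<lambda>x. a * f x + b * g x) \<in> W12_0"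
proof -
  obtain \<phi> where phi: "\<And>m::nat. \<phi> m \<in> test_functions" "(\<lambda>m. L2_norm (\<lambda>x. \<phi> m x - f x)) \<longlonglongrightarrow> 0"
    "(\<lambda>m. L2_norm (\<lambda>x. vector_derivative (\<phi> m) (at x) - weak_deriv f x)) \<longlonglongrightarrow> 0"
    using W12_0_approx[OF assms(1)] by blast
  obtain \<psi> where psi: "\<And>m::nat. \<psi> m \<in> test_functions" "(\<lambda>m. L2_norm (\<lambda>x. \<psi> m x - g x)) \<longlonglongrightarrow> 0"
    "(\<lambda>m. L2_norm (\<lambda>x. vector_derivative (\<psi> m) (at x) - weak_deriv g x)) \<longlonglongrightarrow> 0"
    using W12_0_approx[OF assms(2)] by blast
  show ?thesis
  proof (rule W12_0_I(1)[where \<phi> = "\<lambda>m x. a * \<phi> m x + b * \<psi> m x"])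
    show "(\<lambda>x. a * f x + b * g x) \<in> L2" "(\<lambda>x. a * weak_deriv f x + b * weak_deriv g x) \<in> L2"
      by (intro L2_lincomb W12_0_L2 assms)+
    show "(\<lambda>x. a * \<phi> m x + b * \<psi> m x) \<in> test_functions" for m
      by (intro test_functions_lincomb phi psi)
    show "(\<lambda>m. L2_norm (\<lambda>x. a * \<phi> m x + b * \<psi> m x - (a * f x + b * g x))) \<longlonglongrightarrow> 0"
      by (intro tendsto_lincomb_norm phi psi test_functions_L2 W12_0_L2 assms)
    show "(\<lambda>m. L2_norm (\<lambda>x. vector_derivative (\<lambda>x. a * \<phi> m x + b * \<psi> m x) (at x) - (a * weak_deriv f x + b * weak_deriv g x))) \<longlonglongrightarrow> 0"
      unfolding test_functions_deriv_lincomb[OF phi(1) psi(1)]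
      by (intro tendsto_lincomb_norm phi psi test_functions_L2 test_functions_deriv W12_0_L2 assms)
  qed
qed

lemma weak_deriv_lincomb_AE:
  assumes "f \<in> W12_0" "g \<in> W12_0"
  shows "AE x in unit_itv. weak_deriv (\<lambda>x. a * f x + b * g x) x = a * weak_deriv f x + b * weak_deriv g x"
  by (intro weak_deriv_AE has_weak_deriv_lincomb W12_0_weak_deriv assms)

text \<open>The choice in \<open>weak_deriv\<close> depends on the representative, so invariance
  under almost everywhere equality is not automatic.\<close>

lemma weak_deriv_cong_AE:
  assumes "f \<in> W12_0" "AE x in unit_itv. f x = g x" "g \<in> borel_measurable unit_itv"
  shows "AE x in unit_itv. weak_deriv f x = weak_deriv g x"
proof -
  have "has_weak_deriv g (weak_deriv f)"
    by (rule has_weak_deriv_cong[OF W12_0_weak_deriv[OF assms(1)] assms(2)])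
      (use assms in \<open>auto intro: L2_measurable W12_0_L2\<close>)
  from weak_deriv_AE[OF this] show ?thesis by (auto elim: eventually_mono)
qed

section \<open>Hardy's inequality\<close>


text \<open>The derivative of -|phi|^2 / x is |psi|^2 - 2 Re (psi cnj phi') with psi = phi / x, and
  its integral is 0 because phi vanishes near both ends. Completing a square then gives the constant
  2.\<close>

lemma hardy_test:
  assumes "\<phi> \<in> test_functions"
  shows "(\<lambda>x. \<phi> x / of_real x) \<in> L2" "L2_norm (\<lambda>x. \<phi> x / of_real x) \<le> 2 * L2_norm (\<lambda>x. vector_derivative \<phi> (at x))"
proof -
  let ?d = "\<lambda>x. vector_derivative \<phi> (at x)"
  let ?\<psi> = "\<lambda>x. \<phi> x / of_real x"
  obtain a b where ab: "0 < a" "a < b" "b < 1" "\<And>x. x \<notin> {a..b} \<Longrightarrow> \<phi> x = 0"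
    using test_functions_support[OF assms] by blast
  have phi: "\<phi> \<in> L2" and d: "?d \<in> L2" using assms by (auto intro: test_functions_L2 test_functions_deriv)
  \<comment> \<open>Below a the function phi is 0, so the singular factor 1/x may be replaced by the
    continuous 1 / max x a.\<close>
  have psi_eq: "?\<psi> x = \<phi> x * of_real (1 / max x a)" for x
    using ab(4)[of x] ab(1) by (cases "x < a") (auto simp: max_def divide_inverse)
  have psi_cont: "continuous_on {0..1} ?\<psi>"
    unfolding psi_eq using ab(1) by (intro continuous_intros test_functions_continuous assms) (auto simp: max_def)
  show psi: "?\<psi> \<in> L2" by (rule L2_continuous[OF psi_cont])
  define k where "k x = (cmod (?\<psi> x))\<^sup>2 - 2 * (?\<psi> x \<bullet> ?d x)" for x
  \<comment> \<open>At 0 the primitive reads 0 / 0, which is 0 in HOL and fits its vanishing on all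
    of [0,a).\<close>
  have k_hk: "(k has_integral (- ((cmod (\<phi> 1))\<^sup>2 / 1)) - (- ((cmod (\<phi> 0))\<^sup>2 / 0))) {0..1}"
  proof (rule fundamental_theorem_of_calculus)
    fix x :: real assume x: "x \<in> {0..1}"
    show "((\<lambda>x. - ((cmod (\<phi> x))\<^sup>2 / x)) has_vector_derivative k x) (at x within {0..1})"
    proof (cases "x < a")
      case True
      have "((\<lambda>_. 0) has_vector_derivative 0) (at x)" by simp
      then have "((\<lambda>x. - ((cmod (\<phi> x))\<^sup>2 / x)) has_vector_derivative 0) (at x)"
        by (rule has_vector_derivative_transform_within_open[where S = "{..<a}"]) (use True ab in auto)
      moreover have "k x = 0" using ab(4)[of x] True by (simp add: k_def)
      ultimately show ?thesis by (simp add: has_vector_derivative_at_within)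
    next
      case False
      then have "0 < x" using ab by simp
      have "((\<lambda>x. \<phi> x \<bullet> \<phi> x) has_derivative (\<lambda>h. \<phi> x \<bullet> (h *\<^sub>R ?d x) + (h *\<^sub>R ?d x) \<bullet> \<phi> x)) (at x)"
        using test_functions_has_deriv[OF assms, of x UNIV]
        by (intro has_derivative_inner) (simp_all add: has_vector_derivative_def)
      moreover have "(\<lambda>h. \<phi> x \<bullet> (h *\<^sub>R ?d x) + (h *\<^sub>R ?d x) \<bullet> \<phi> x) = (*) (2 * (\<phi> x \<bullet> ?d x))"
        by (auto simp: inner_commute)
      ultimately have "((\<lambda>x. (cmod (\<phi> x))\<^sup>2) has_real_derivative 2 * (\<phi> x \<bullet> ?d x)) (at x)"
        by (simp add: has_field_derivative_def power2_norm_eq_inner)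
      then have "((\<lambda>x. - ((cmod (\<phi> x))\<^sup>2 / x)) has_real_derivative
          - ((2 * (\<phi> x \<bullet> ?d x) * x - (cmod (\<phi> x))\<^sup>2 * 1) / (x * x))) (at x)"
        using \<open>0 < x\<close> by (intro DERIV_minus DERIV_divide DERIV_ident) auto
      moreover have "?\<psi> x \<bullet> ?d x = (\<phi> x \<bullet> ?d x) / x"
      proof -
        have "?\<psi> x = (1 / x) *\<^sub>R \<phi> x" by (simp add: scaleR_conv_of_real)
        then show ?thesis by simp
      qed
      then have "- ((2 * (\<phi> x \<bullet> ?d x) * x - (cmod (\<phi> x))\<^sup>2 * 1) / (x * x)) = k x"
        using \<open>0 < x\<close> by (simp add: k_def norm_divide power_divide field_simps power2_eq_square)
      ultimately show ?thesis
        by (simp add: has_real_derivative_iff_has_vector_derivative has_vector_derivative_at_within)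
    qed
  qed simp
  then have k0: "(k has_integral 0) {0..1}" using test_functions_boundary[OF assms] by simp
  have i: "integrable unit_itv (\<lambda>x. (cmod (?\<psi> x))\<^sup>2)" "integrable unit_itv (\<lambda>x. (cmod (?d x))\<^sup>2)"
    using psi d by (auto intro: L2_integrable)
  have k_int: "integrable unit_itv k"
  proof (rule Bochner_Integration.integrable_bound)
    show "integrable unit_itv (\<lambda>x. 2 * (cmod (?\<psi> x))\<^sup>2 + (cmod (?d x))\<^sup>2)" using i by simp
    show "k \<in> borel_measurable unit_itv"
      unfolding k_def using L2_measurable[OF psi] L2_measurable[OF d] by measurable
    show "AE x in unit_itv. norm (k x) \<le> norm (2 * (cmod (?\<psi> x))\<^sup>2 + (cmod (?d x))\<^sup>2)"
    proof (rule AE_I2)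
      fix x
      have "\<bar>?\<psi> x \<bullet> ?d x\<bar> \<le> cmod (?\<psi> x) * cmod (?d x)" by (rule Cauchy_Schwarz_ineq2)
      moreover have "2 * (cmod (?\<psi> x) * cmod (?d x)) \<le> (cmod (?\<psi> x))\<^sup>2 + (cmod (?d x))\<^sup>2"
        using sum_squares_bound[of "cmod (?\<psi> x)" "cmod (?d x)"] by (simp only: mult.assoc)
      ultimately have "\<bar>k x\<bar> \<le> 2 * (cmod (?\<psi> x))\<^sup>2 + (cmod (?d x))\<^sup>2"
        unfolding k_def using zero_le_power2[of "cmod (?\<psi> x)"] zero_le_power2[of "cmod (?d x)"]
        by linarith
      then show "norm (k x) \<le> norm (2 * (cmod (?\<psi> x))\<^sup>2 + (cmod (?d x))\<^sup>2)" by simp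
    qed
  qed
  have "(LINT x|unit_itv. k x) = integral {0<..<1} k"
    by (rule lebesgue_integral_eq_integral[OF k_int]) simp
  also have "\<dots> = 0" using k0 integral_open_interval_real[of 0 1 k] by (simp add: integral_unique)
  finally have k_lint: "(LINT x|unit_itv. k x) = 0" .
  \<comment> \<open>The second premise will be (|psi| - 2 |phi'|)^2 >= 0 written out, with A =
    |psi|^2, D = |phi'|^2 and I the real inner product of psi and phi'.\<close>
  have aux: "A - 2 * (A - 2 * I) \<le> 4 * D" if "I \<le> P" "4 * P \<le> A + 4 * D" for A I P D :: real
  proof -
    have "4 * I \<le> 4 * P" using that(1) by simp
    then have "4 * I \<le> A + 4 * D" using that(2) by linarith
    then show ?thesis by (simp add: algebra_simps)
  qed
  \<comment> \<open>Subtracting twice a vanishing integral reverses the sign of |psi|^2 in the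
    integrand, so that the completed square applies pointwise.\<close>
  have "(LINT x|unit_itv. (cmod (?\<psi> x))\<^sup>2) = (LINT x|unit_itv. (cmod (?\<psi> x))\<^sup>2) - 2 * (LINT x|unit_itv. k x)"
    using k_lint by simp
  also have "\<dots> = (LINT x|unit_itv. (cmod (?\<psi> x))\<^sup>2 - 2 * k x)"
    using i k_int by simp
  also have "\<dots> \<le> (LINT x|unit_itv. 4 * (cmod (?d x))\<^sup>2)"
  proof (rule integral_mono_AE)
    show "AE x in unit_itv. (cmod (?\<psi> x))\<^sup>2 - 2 * k x \<le> 4 * (cmod (?d x))\<^sup>2"
    proof (rule AE_I2)
      fix x
      have "?\<psi> x \<bullet> ?d x \<le> cmod (?\<psi> x) * cmod (?d x)" by (rule norm_cauchy_schwarz)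
      moreover have "4 * (cmod (?\<psi> x) * cmod (?d x)) \<le> (cmod (?\<psi> x))\<^sup>2 + 4 * (cmod (?d x))\<^sup>2"
        using sum_squares_bound[of "cmod (?\<psi> x)" "2 * cmod (?d x)"] by (simp add: power_mult_distrib mult.assoc)
      ultimately show "(cmod (?\<psi> x))\<^sup>2 - 2 * k x \<le> 4 * (cmod (?d x))\<^sup>2"
        unfolding k_def by (rule aux)
    qed
  qed (use i k_int in simp_all)
  finally have "(L2_norm ?\<psi>)\<^sup>2 \<le> (2 * L2_norm ?d)\<^sup>2"
    by (simp add: L2_norm_power2 power_mult_distrib)
  then show "L2_norm ?\<psi> \<le> 2 * L2_norm ?d" by (rule power2_le_imp_le) simp
qed

text \<open>Convergence of the approximating test functions in L2 says nothing about division by x.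
  The multiplier 1/x is therefore first truncated to a bounded one, the approximation is carried
  out, and monotone convergence removes the truncation.\<close>

lemma hardy_W12_0:
  assumes "v \<in> W12_0"
  shows "(\<lambda>x. v x / of_real x) \<in> L2" "L2_norm (\<lambda>x. v x / of_real x) \<le> 2 * L2_norm (weak_deriv v)"
proof -
  obtain \<phi> where phi: "\<And>m::nat. \<phi> m \<in> test_functions" "(\<lambda>m. L2_norm (\<lambda>x. \<phi> m x - v x)) \<longlonglongrightarrow> 0"
    "(\<lambda>m. L2_norm (\<lambda>x. vector_derivative (\<phi> m) (at x) - weak_deriv v x)) \<longlonglongrightarrow> 0"
    using W12_0_approx[OF assms(1)] by blast
  note v = W12_0_L2[OF assms]
  define h where "h k x = (if 1 / real (Suc k) < x then complex_of_real (1 / x) else 0)" for k x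
  have h_meas: "h k \<in> borel_measurable unit_itv" for k
  proof -
    have "(\<lambda>x. complex_of_real (1 / x)) \<in> borel_measurable unit_itv"
      by (rule measurable_unit_itv_continuous) (auto intro!: continuous_intros)
    moreover have "(\<lambda>x::real. x) \<in> borel_measurable unit_itv"
      by (rule measurable_unit_itv_continuous) (auto intro!: continuous_intros)
    ultimately show ?thesis unfolding h_def by measurable
  qed
  have h_bound: "cmod (h k x) \<le> real (Suc k)" for k x
  proof (cases "1 / real (Suc k) < x")
    case True
    then have "0 < x" by (meson less_trans of_nat_0_less_iff zero_less_Suc zero_less_divide_1_iff)
    then show ?thesis using True by (simp add: h_def norm_divide divide_simps mult.commute)
  qed (simp add: h_def)
  have h_le: "cmod (y * h k x) \<le> cmod (y / of_real x)" if "0 < x" for y k x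
    using that by (simp add: h_def norm_mult norm_divide)
  have vh: "(\<lambda>x. v x * h k x) \<in> L2" for k by (rule L2_mult_bounded(1)[OF v(1) h_meas h_bound])
  have bound: "L2_norm (\<lambda>x. v x * h k x) \<le> 2 * L2_norm (weak_deriv v)" for k
  proof (rule LIMSEQ_le_const)
    \<comment> \<open>The truncated multiplier costs the factor Suc k, which is harmless because k
      stays fixed while m tends to infinity.\<close>
    let ?R = "\<lambda>m. real (Suc k) * L2_norm (\<lambda>x. \<phi> m x - v x)
        + 2 * (L2_norm (\<lambda>x. vector_derivative (\<phi> m) (at x) - weak_deriv v x) + L2_norm (weak_deriv v))"
    have "?R \<longlonglongrightarrow> real (Suc k) * 0 + 2 * (0 + L2_norm (weak_deriv v))"
      by (intro tendsto_intros phi)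
    then show "?R \<longlonglongrightarrow> 2 * L2_norm (weak_deriv v)" by simp
    have "L2_norm (\<lambda>x. v x * h k x) \<le> ?R m" for m
    proof -
      have t: "\<phi> m \<in> L2" "(\<lambda>x. vector_derivative (\<phi> m) (at x)) \<in> L2"
        using phi(1) by (auto intro: test_functions_L2 test_functions_deriv)
      have ph: "(\<lambda>x. \<phi> m x * h k x) \<in> L2" by (rule L2_mult_bounded(1)[OF t(1) h_meas h_bound])
      have "L2_norm (\<lambda>x. v x * h k x) = L2_norm (\<lambda>x. (v x * h k x - \<phi> m x * h k x) + \<phi> m x * h k x)" by simp
      also have "\<dots> \<le> L2_norm (\<lambda>x. v x * h k x - \<phi> m x * h k x) + L2_norm (\<lambda>x. \<phi> m x * h k x)"
        by (intro L2_norm_triangle L2_diff vh ph)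
      also have "L2_norm (\<lambda>x. v x * h k x - \<phi> m x * h k x) = L2_norm (\<lambda>x. (\<phi> m x - v x) * h k x)"
        by (subst L2_norm_minus_commute) (simp add: left_diff_distrib)
      also have "\<dots> \<le> real (Suc k) * L2_norm (\<lambda>x. \<phi> m x - v x)"
        using L2_mult_bounded(2)[OF L2_diff[OF t(1) v(1)] h_meas h_bound] by simp
      also have "L2_norm (\<lambda>x. \<phi> m x * h k x) \<le> L2_norm (\<lambda>x. \<phi> m x / of_real x)"
        unfolding L2_norm_def
        by (intro real_sqrt_le_mono integral_mono_AE L2_integrable ph hardy_test(1) phi(1) AE_unit_itv_I power_mono h_le) auto
      also have "\<dots> \<le> 2 * L2_norm (\<lambda>x. vector_derivative (\<phi> m) (at x))"
        by (rule hardy_test(2)[OF phi(1)])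
      also have "L2_norm (\<lambda>x. vector_derivative (\<phi> m) (at x))
          = L2_norm (\<lambda>x. (vector_derivative (\<phi> m) (at x) - weak_deriv v x) + weak_deriv v x)" by simp
      also have "\<dots> \<le> L2_norm (\<lambda>x. vector_derivative (\<phi> m) (at x) - weak_deriv v x) + L2_norm (weak_deriv v)"
        by (intro L2_norm_triangle L2_diff t v)
      finally show ?thesis by simp
    qed
    then show "\<exists>N. \<forall>n\<ge>N. L2_norm (\<lambda>x. v x * h k x) \<le> ?R n" by blast
  qed
  let ?I = "\<lambda>k. LINT x|unit_itv. (cmod (v x * h k x))\<^sup>2"
  have I_le: "?I k \<le> (2 * L2_norm (weak_deriv v))\<^sup>2" for k
    using power_mono[OF bound[of k], of 2] by (simp add: L2_norm_power2)
  have mono: "cmod (v x * h k x) \<le> cmod (v x * h l x)" if "k \<le> l" "0 < x" for k l x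
  proof -
    have "1 / real (Suc l) \<le> 1 / real (Suc k)" using that by (simp add: divide_simps)
    then show ?thesis using that by (auto simp: h_def norm_mult)
  qed
  have "incseq ?I"
  proof (rule incseq_SucI)
    fix k
    show "?I k \<le> ?I (Suc k)"
      by (intro integral_mono_AE L2_integrable vh AE_unit_itv_I power_mono mono) auto
  qed
  then obtain L where L: "?I \<longlonglongrightarrow> L" using incseq_convergent[of ?I] I_le by blast
  have meas: "(\<lambda>x. v x / of_real x) \<in> borel_measurable unit_itv"
  proof -
    have "(\<lambda>x. complex_of_real (1 / x)) \<in> borel_measurable unit_itv"
      by (rule measurable_unit_itv_continuous) (auto intro!: continuous_intros)
    then have "(\<lambda>x. v x * complex_of_real (1 / x)) \<in> borel_measurable unit_itv"
      using L2_measurable[OF v(1)] by measurable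
    then show ?thesis by simp
  qed
  have mono_AE: "AE x in unit_itv. mono (\<lambda>k. (cmod (v x * h k x))\<^sup>2)"
    by (rule AE_unit_itv_I) (auto intro!: monoI power_mono mono)
  have lim_AE: "AE x in unit_itv. (\<lambda>k. (cmod (v x * h k x))\<^sup>2) \<longlonglongrightarrow> (cmod (v x / of_real x))\<^sup>2"
  proof (rule AE_unit_itv_I)
    fix x :: real assume x: "0 < x" "x < 1"
    have "\<forall>\<^sub>F k in sequentially. 1 / real (Suc k) < x"
      using order_tendstoD(2)[OF LIMSEQ_inverse_real_of_nat x(1)] by (simp add: divide_inverse)
    then have "\<forall>\<^sub>F k in sequentially. (cmod (v x / of_real x))\<^sup>2 = (cmod (v x * h k x))\<^sup>2"
      by eventually_elim (simp add: h_def)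
    with tendsto_const show "(\<lambda>k. (cmod (v x * h k x))\<^sup>2) \<longlonglongrightarrow> (cmod (v x / of_real x))\<^sup>2"
      by (rule Lim_transform_eventually)
  qed
  have meas2: "(\<lambda>x. (cmod (v x / of_real x))\<^sup>2) \<in> borel_measurable unit_itv" using meas by measurable
  note mc = L2_integrable[OF vh] mono_AE lim_AE L meas2
  have "integrable unit_itv (\<lambda>x. (cmod (v x / of_real x))\<^sup>2)"
    by (rule integrable_monotone_convergence[OF mc])
  then show "(\<lambda>x. v x / of_real x) \<in> L2" using meas by (simp add: L2_def)
  have "(LINT x|unit_itv. (cmod (v x / of_real x))\<^sup>2) = L"
    by (rule integral_monotone_convergence[OF mc])
  also have "L \<le> (2 * L2_norm (weak_deriv v))\<^sup>2"
    using LIMSEQ_le_const2[OF L] I_le by blast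
  finally have "(L2_norm (\<lambda>x. v x / of_real x))\<^sup>2 \<le> (2 * L2_norm (weak_deriv v))\<^sup>2"
    by (simp add: L2_norm_power2)
  then show "L2_norm (\<lambda>x. v x / of_real x) \<le> 2 * L2_norm (weak_deriv v)" by (rule power2_le_imp_le) simp
qed

text \<open>Hardy's inequality doubles as a Poincare inequality: it forces f / x to vanish almost
  everywhere.\<close>

lemma W12_0_deriv_0:
  assumes "f \<in> W12_0" "AE x in unit_itv. weak_deriv f x = 0"
  shows "AE x in unit_itv. f x = 0"
proof -
  have "L2_norm (weak_deriv f) = L2_norm (\<lambda>_. 0)"
    using assms by (intro L2_norm_cong_AE) (auto intro: L2_measurable W12_0_L2)
  also have "\<dots> = 0" by (simp add: L2_norm_def)
  finally have "L2_norm (\<lambda>x. f x / of_real x) \<le> 0"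
    using hardy_W12_0(2)[OF assms(1)] by simp
  then have "L2_norm (\<lambda>x. f x / of_real x) = 0" by (intro antisym L2_norm_nonneg)
  from L2_norm_eq_0[OF hardy_W12_0(1)[OF assms(1)] this] AE_space show ?thesis
    by eventually_elim auto
qed

text \<open>Mean zero is what makes the primitive from 0 vanish again to the right of the
  support.\<close>

lemma test_functions_antideriv:
  assumes "g \<in> test_functions" "(LINT x|unit_itv. g x) = 0"
  obtains \<psi> where "\<psi> \<in> test_functions" "\<And>x. vector_derivative \<psi> (at x) = g x"
proof -
  obtain a b where ab: "0 < a" "a < b" "b < 1" "\<And>x. x \<notin> {a..b} \<Longrightarrow> g x = 0"
    using test_functions_support[OF assms(1)] by blast
  have cont: "continuous_on A g" for A by (rule test_functions_continuous[OF assms(1)])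
  define \<psi> where "\<psi> x = integral {0..x} g" for x
  have zero_left: "\<psi> x = 0" if "x < a" for x
    unfolding \<psi>_def using ab that by (intro integral_eq_0_iff[THEN iffD2] integral_unique has_integral_is_0) auto
  have deriv: "(\<psi> has_vector_derivative g x) (at x)" for x
  proof (cases "x < a")
    case True
    have "((\<lambda>_. 0) has_vector_derivative 0) (at x)" by simp
    then have "(\<psi> has_vector_derivative 0) (at x)"
      by (rule has_vector_derivative_transform_within_open[where S = "{..<a}"]) (use True zero_left in auto)
    then show ?thesis using ab(4)[of x] True by simp
  next
    case False
    then have "0 < x" using ab by simp
    have "(\<psi> has_vector_derivative g x) (at x within {0..x + 1})"
      unfolding \<psi>_def using \<open>0 < x\<close> by (intro integral_has_vector_derivative cont) auto
    moreover have "at x within {0..x + 1} = at x"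
      using \<open>0 < x\<close> by (intro at_within_interior) auto
    ultimately show ?thesis by simp
  qed
  obtain D where D: "D 0 = g" "\<And>k x. (D k has_vector_derivative D (Suc k) x) (at x)"
    using test_functions_smooth[OF assms(1)] unfolding smooth_def by blast
  have "smooth \<psi>"
    unfolding smooth_def
    by (rule exI[of _ "\<lambda>k. case k of 0 \<Rightarrow> \<psi> | Suc j \<Rightarrow> D j"]) (use D deriv in \<open>auto split: nat.split\<close>)
  moreover have "\<psi> x = 0" if "x \<notin> {a..b}" for x
  proof (cases "x < a")
    case False
    with that have "b < x" by auto
    have "integral {0..1} g = 0"
      using assms(2) unit_itv_continuous(2)[OF cont[of "{0..1}"]] by simp
    moreover have "integral {0..x} g = integral {0..b} g + integral {b..x} g"
      "integral {0..1} g = integral {0..b} g + integral {b..1} g"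
      using ab \<open>b < x\<close> by (intro Henstock_Kurzweil_Integration.integral_combine[symmetric] integrable_continuous_real cont; simp)+
    moreover have "integral {b..y} g = 0" if "b < y" for y
    proof -
      have "(g has_integral 0) {b..y}"
        by (rule has_integral_spike_finite[of "{b}" _ _ "\<lambda>_. 0"]) (use ab in auto)
      then show ?thesis by (rule integral_unique)
    qed
    ultimately show ?thesis using ab \<open>b < x\<close> by (simp add: \<psi>_def)
  qed (rule zero_left)
  ultimately have "\<psi> \<in> test_functions" using ab by (intro test_functionsI[of _ a b]) auto
  moreover have "vector_derivative \<psi> (at x) = g x" for x using deriv by (rule vector_derivative_at)
  ultimately show ?thesis by (rule that)
qed

text \<open>Test functions approximating f' need not have test functions as primitives. Their means
  tend to the mean of f', which is f 1 - f 0 = 0, so a small multiple of one fixed bump corrects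
  them without spoiling the approximation.\<close>

lemma W12_0_C1:
  assumes "continuous_on {0..1} f'" "\<And>x. x \<in> {0..1} \<Longrightarrow> (f has_vector_derivative f' x) (at x within {0..1})"
    and "f 0 = 0" "f 1 = 0"
  shows "f \<in> W12_0"
proof -
  have f': "f' \<in> L2" by (rule L2_continuous[OF assms(1)])
  have cf: "continuous_on {0..1} f" using continuous_on_vector_derivative[OF assms(2)] .
  have one: "(\<lambda>_. 1) \<in> L2" by (rule L2_bounded[of _ 1]) auto
  \<comment> \<open>If all test functions had mean zero, the constant 1 would be orthogonal to them
    and hence 0 almost everywhere.\<close>
  have "\<exists>\<eta>\<in>test_functions. (LINT x|unit_itv. \<eta> x) \<noteq> 0"
  proof (rule ccontr)
    assume "\<not> ?thesis"
    then have "AE x in unit_itv. (1::complex) = 0"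
      by (intro L2_orthogonal_test_AE_0 one) auto
    then have "AE x in unit_itv. False" by simp
    then have "(LINT x|unit_itv. (1::real)) = (LINT x|unit_itv. 0)"
      by (intro integral_cong_AE) (auto elim: eventually_mono)
    then show False by simp
  qed
  then obtain \<eta> where chi: "\<eta> \<in> test_functions" "(LINT x|unit_itv. \<eta> x) \<noteq> 0" by blast
  let ?X = "LINT x|unit_itv. \<eta> x"
  obtain g where g: "\<And>m::nat. g m \<in> test_functions" "(\<lambda>m. L2_norm (\<lambda>x. g m x - f' x)) \<longlonglongrightarrow> 0"
    using L2_test_sequence[OF f'] by blast
  \<comment> \<open>The multiple of the bump \<eta> that removes the mean of g m.\<close>
  define c where "c m = (LINT x|unit_itv. g m x) / ?X" for m
  have "(\<lambda>m. LINT x|unit_itv. g m x * 1) \<longlonglongrightarrow> (LINT x|unit_itv. f' x * 1)"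
    by (intro L2_integral_tendsto test_functions_L2 g f' one)
  moreover have "(LINT x|unit_itv. f' x) = 0" using unit_itv_FTC[OF assms(1,2)] assms(3,4) by simp
  ultimately have "c \<longlonglongrightarrow> 0 / ?X"
    unfolding c_def using chi by (intro tendsto_intros) auto
  then have c: "c \<longlonglongrightarrow> 0" by simp
  define G where "G m x = 1 * g m x + (- c m) * \<eta> x" for m x
  have G: "G m \<in> test_functions" for m unfolding G_def by (intro test_functions_lincomb g chi)
  have "(LINT x|unit_itv. G m x) = 0" for m
  proof -
    have "integrable unit_itv (g m)" "integrable unit_itv \<eta>"
      by (intro unit_itv_continuous(1) test_functions_continuous g chi)+
    then show ?thesis using chi(2) by (simp add: G_def c_def)
  qed
  then have "\<exists>\<psi>. \<psi> \<in> test_functions \<and> (\<forall>x. vector_derivative \<psi> (at x) = G m x)" for m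
    by (metis G test_functions_antideriv)
  then obtain \<psi> where psi: "\<And>m. \<psi> m \<in> test_functions" "\<And>m x. vector_derivative (\<psi> m) (at x) = G m x"
    by metis
  have "(\<lambda>m. L2_norm (\<lambda>x. G m x - f' x)) \<longlonglongrightarrow> 0"
  proof (rule Lim_null_comparison)
    show "\<forall>\<^sub>F m in sequentially. norm (L2_norm (\<lambda>x. G m x - f' x)) \<le> L2_norm (\<lambda>x. g m x - f' x) + cmod (c m) * L2_norm \<eta>"
    proof (rule always_eventually, rule allI)
      fix m
      have "L2_norm (\<lambda>x. (g m x - f' x) + (- c m) * \<eta> x) \<le> L2_norm (\<lambda>x. g m x - f' x) + L2_norm (\<lambda>x. (- c m) * \<eta> x)"
        by (intro L2_norm_triangle L2_diff L2_cmult test_functions_L2[OF g(1)] test_functions_L2[OF chi(1)] f')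
      then show "norm (L2_norm (\<lambda>x. G m x - f' x)) \<le> L2_norm (\<lambda>x. g m x - f' x) + cmod (c m) * L2_norm \<eta>"
        unfolding L2_norm_cmult by (simp add: G_def algebra_simps)
    qed
    have "(\<lambda>m. L2_norm (\<lambda>x. g m x - f' x) + cmod (c m) * L2_norm \<eta>) \<longlonglongrightarrow> 0 + cmod 0 * L2_norm \<eta>"
      by (intro tendsto_intros g c)
    then show "(\<lambda>m. L2_norm (\<lambda>x. g m x - f' x) + cmod (c m) * L2_norm \<eta>) \<longlonglongrightarrow> 0" by simp
  qed
  note lim = this
  \<comment> \<open>Both functions vanish at 0, so their difference is bounded pointwise by the L1
    norm, hence by the L2 norm, of the difference of the derivatives.\<close>
  have le: "L2_norm (\<lambda>x. \<psi> m x - f x) \<le> L2_norm (\<lambda>x. G m x - f' x)" for m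
  proof (rule L2_norm_le_bound)
    have Gf: "(\<lambda>x. G m x - f' x) \<in> L2" by (intro L2_diff test_functions_L2[OF G] f')
    have contGf: "continuous_on {0..1} (\<lambda>x. G m x - f' x)"
      by (intro continuous_intros test_functions_continuous G assms)
    show "(\<lambda>x. \<psi> m x - f x) \<in> borel_measurable unit_itv"
      by (intro L2_measurable L2_diff test_functions_L2[OF psi(1)] L2_continuous[OF cf])
    fix x :: real assume x: "0 < x" "x < 1"
    have "((\<lambda>x. G m x - f' x) has_integral (\<psi> m x - f x) - (\<psi> m 0 - f 0)) {0..x}"
    proof (rule fundamental_theorem_of_calculus)
      fix y assume y: "y \<in> {0..x}"
      have "(f has_vector_derivative f' y) (at y within {0..x})"
        using x y by (intro has_vector_derivative_within_subset[OF assms(2)]) auto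
      then show "((\<lambda>x. \<psi> m x - f x) has_vector_derivative G m y - f' y) (at y within {0..x})"
        using test_functions_has_deriv[OF psi(1), of m y "{0..x}"] psi(2) by (intro has_vector_derivative_diff) auto
    qed (use x in simp)
    then have "\<psi> m x - f x = integral {0..x} (\<lambda>x. G m x - f' x)"
      using assms(3) test_functions_boundary[OF psi(1)] by (simp add: integral_unique)
    also have "cmod \<dots> \<le> integral {0..x} (\<lambda>x. cmod (G m x - f' x))"
      using x by (intro Henstock_Kurzweil_Integration.integral_norm_bound_integral integrable_continuous_real
        continuous_intros continuous_on_subset[OF contGf]) auto
    also have "\<dots> \<le> integral {0..1} (\<lambda>x. cmod (G m x - f' x))"
      using x by (intro integral_subset_le integrable_continuous_real
        continuous_intros continuous_on_subset[OF contGf]) auto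
    also have "\<dots> = (LINT x|unit_itv. cmod (G m x - f' x) * cmod 1)"
    proof -
      have "integrable unit_itv (\<lambda>x. cmod (G m x - f' x))"
        by (intro integrable_norm unit_itv_continuous(1) contGf)
      from lebesgue_integral_eq_integral[OF this] show ?thesis
        using integral_open_interval_real[of 0 1 "\<lambda>x. cmod (G m x - f' x)"] by simp
    qed
    also have "\<dots> \<le> L2_norm (\<lambda>x. G m x - f' x) * L2_norm (\<lambda>_. 1)"
      by (rule L2_cauchy_schwarz_abs[OF Gf one])
    also have "\<dots> = L2_norm (\<lambda>x. G m x - f' x)" by (simp add: L2_norm_def)
    finally show "cmod (\<psi> m x - f x) \<le> L2_norm (\<lambda>x. G m x - f' x)" .
  qed simp
  show ?thesis
  proof (rule W12_0_I(1)[OF L2_continuous[OF cf] f' psi(1)])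
    show "(\<lambda>m. L2_norm (\<lambda>x. vector_derivative (\<psi> m) (at x) - f' x)) \<longlonglongrightarrow> 0"
      using lim by (simp add: psi)
    show "(\<lambda>m. L2_norm (\<lambda>x. \<psi> m x - f x)) \<longlonglongrightarrow> 0"
      by (rule Lim_null_comparison[OF _ lim]) (use le in \<open>auto intro: always_eventually\<close>)
  qed
qed

section \<open>The energy space and the generator\<close>


text \<open>Bilinear rather than sesquilinear, and with an arbitrary function a in the place of a
  derivative. The pairs inserted later depend on zeta, and without conjugation this dependence stays
  holomorphic.\<close>

definition pairing :: "(real \<Rightarrow> complex) \<Rightarrow> (real \<Rightarrow> complex) \<Rightarrow> state \<Rightarrow> complex" where
  "pairing a b p = (LINT x|unit_itv. weak_deriv (fst p) x * a x) + (LINT x|unit_itv. snd p x * b x)"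

lemma H_D: "p \<in> H \<Longrightarrow> fst p \<in> W12_0" "p \<in> H \<Longrightarrow> snd p \<in> L2"
  "p \<in> H \<Longrightarrow> fst p \<in> L2" "p \<in> H \<Longrightarrow> weak_deriv (fst p) \<in> L2"
  by (auto simp: H_def mem_Times_iff W12_0_L2)

lemma H_lincomb_in_H: "p \<in> H \<Longrightarrow> q \<in> H \<Longrightarrow> H_lincomb a p b q \<in> H"
  using H_D(1,2)[of p] H_D(1,2)[of q] by (simp add: H_def H_lincomb_def W12_0_lincomb L2_lincomb)

lemma L2_inner_self: "L2_inner f f = complex_of_real ((L2_norm f)\<^sup>2)"
  unfolding L2_inner_def L2_norm_power2 integral_complex_of_real[symmetric]
  by (rule Bochner_Integration.integral_cong) (simp_all add: complex_norm_square[symmetric])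

lemma H_norm_eq: "H_norm p = sqrt ((L2_norm (weak_deriv (fst p)))\<^sup>2 + (L2_norm (snd p))\<^sup>2)"
  by (simp add: H_norm_def H_inner_def L2_inner_self)

lemma H_norm_ge:
  "L2_norm (weak_deriv (fst p)) \<le> H_norm p" "L2_norm (snd p) \<le> H_norm p"
  by (simp_all add: H_norm_eq real_le_rsqrt)

lemma H_norm_nonneg: "0 \<le> H_norm p"
  by (simp add: H_norm_eq)

lemma H_norm_le: "H_norm p \<le> L2_norm (weak_deriv (fst p)) + L2_norm (snd p)"
  unfolding H_norm_eq by (rule real_le_lsqrt) (simp_all add: power2_sum)

lemma pairing_bound:
  assumes "a \<in> L2" "b \<in> L2" "p \<in> H"
  shows "cmod (pairing a b p) \<le> (L2_norm a + L2_norm b) * H_norm p"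
proof -
  have "cmod (pairing a b p) \<le> L2_norm (weak_deriv (fst p)) * L2_norm a + L2_norm (snd p) * L2_norm b"
    unfolding pairing_def
    by (intro order_trans[OF norm_triangle_ineq] add_mono L2_cauchy_schwarz assms H_D)
  also have "\<dots> \<le> H_norm p * L2_norm a + H_norm p * L2_norm b"
    by (intro add_mono mult_right_mono H_norm_ge L2_norm_nonneg)
  finally show ?thesis by (simp add: algebra_simps)
qed

lemma pairing_lincomb:
  assumes "a \<in> L2" "b \<in> L2" "p \<in> H" "q \<in> H"
  shows "pairing a b (H_lincomb c p d q) = c * pairing a b p + d * pairing a b q"
proof -
  have i: "integrable unit_itv (\<lambda>x. weak_deriv (fst p) x * a x)" "integrable unit_itv (\<lambda>x. weak_deriv (fst q) x * a x)"
    "integrable unit_itv (\<lambda>x. snd p x * b x)" "integrable unit_itv (\<lambda>x. snd q x * b x)"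
    by (intro L2_mult_integrable H_D assms)+
  have "(LINT x|unit_itv. weak_deriv (fst (H_lincomb c p d q)) x * a x)
      = (LINT x|unit_itv. c * (weak_deriv (fst p) x * a x) + d * (weak_deriv (fst q) x * a x))"
  proof (rule integral_cong_AE)
    show "(\<lambda>x. weak_deriv (fst (H_lincomb c p d q)) x * a x) \<in> borel_measurable unit_itv"
      using L2_mult_integrable[OF H_D(4)[OF H_lincomb_in_H[OF assms(3,4)]] assms(1)] by auto
    show "(\<lambda>x. c * (weak_deriv (fst p) x * a x) + d * (weak_deriv (fst q) x * a x)) \<in> borel_measurable unit_itv"
      using i by auto
    show "AE x in unit_itv. weak_deriv (fst (H_lincomb c p d q)) x * a x
        = c * (weak_deriv (fst p) x * a x) + d * (weak_deriv (fst q) x * a x)"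
      using weak_deriv_lincomb_AE[OF H_D(1)[OF assms(3)] H_D(1)[OF assms(4)], of c d]
      by eventually_elim (simp add: H_lincomb_def algebra_simps)
  qed
  moreover have "(LINT x|unit_itv. snd (H_lincomb c p d q) x * b x)
      = (LINT x|unit_itv. c * (snd p x * b x) + d * (snd q x * b x))"
    by (rule Bochner_Integration.integral_cong) (simp_all add: H_lincomb_def algebra_simps)
  ultimately show ?thesis unfolding pairing_def using i by (simp add: algebra_simps)
qed

lemma pairing_cong:
  assumes "a \<in> L2" "b \<in> L2" "p \<in> H" "q \<in> H" "H_eq p q"
  shows "pairing a b p = pairing a b q"
proof -
  have "AE x in unit_itv. weak_deriv (fst p) x = weak_deriv (fst q) x"
    by (rule weak_deriv_cong_AE) (use assms in \<open>auto simp: H_eq_def intro: H_D L2_measurable\<close>)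
  then have "(LINT x|unit_itv. weak_deriv (fst p) x * a x) = (LINT x|unit_itv. weak_deriv (fst q) x * a x)"
    by (intro integral_cong_AE borel_measurable_integrable L2_mult_integrable H_D assms) (auto elim: eventually_mono)
  moreover have "(LINT x|unit_itv. snd p x * b x) = (LINT x|unit_itv. snd q x * b x)"
    using assms(5) unfolding H_eq_def
    by (intro integral_cong_AE borel_measurable_integrable L2_mult_integrable H_D assms) (auto elim: eventually_mono)
  ultimately show ?thesis by (simp add: pairing_def)
qed

lemma pairing_diff:
  assumes "a \<in> L2" "b \<in> L2" "p \<in> H" "q \<in> H"
  shows "cmod (pairing a b p - pairing a b q) \<le> (L2_norm a + L2_norm b) * H_dist p q"
  using pairing_bound[OF assms(1,2) H_lincomb_in_H[OF assms(3,4), of 1 "-1"]]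
    pairing_lincomb[OF assms, of 1 "-1"] by (simp add: H_dist_def)

lemma pairing_tendsto:
  assumes "a \<in> L2" "b \<in> L2" "\<And>m. P m \<in> H" "p \<in> H" "((\<lambda>m. H_dist (P m) p) \<longlongrightarrow> 0) F"
  shows "((\<lambda>m. pairing a b (P m)) \<longlongrightarrow> pairing a b p) F"
proof (rule LIM_zero_cancel, rule Lim_null_comparison)
  show "\<forall>\<^sub>F m in F. norm (pairing a b (P m) - pairing a b p) \<le> (L2_norm a + L2_norm b) * H_dist (P m) p"
    by (intro always_eventually allI pairing_diff assms)
  show "((\<lambda>m. (L2_norm a + L2_norm b) * H_dist (P m) p) \<longlongrightarrow> 0) F"
    by (rule tendsto_mult_right_zero[OF assms(5)])
qed

lemma H_norm_cong:
  assumes "p \<in> H" "q \<in> H" "H_eq p q"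
  shows "H_norm p = H_norm q"
proof -
  have "AE x in unit_itv. weak_deriv (fst p) x = weak_deriv (fst q) x"
    by (rule weak_deriv_cong_AE) (use assms in \<open>auto simp: H_eq_def intro: H_D L2_measurable\<close>)
  then have "L2_norm (weak_deriv (fst p)) = L2_norm (weak_deriv (fst q))"
    by (rule L2_norm_cong_AE) (intro L2_measurable H_D assms)+
  moreover have "L2_norm (snd p) = L2_norm (snd q)"
    using assms(3) unfolding H_eq_def by (intro L2_norm_cong_AE L2_measurable H_D assms) auto
  ultimately show ?thesis by (simp add: H_norm_eq)
qed

text \<open>Not immediate, because \<open>weak_deriv\<close> is a choice: for the zero function it
  is only almost everywhere 0. The fact makes constant sequences admissible in
  \<open>op_closure\<close>.\<close>

lemma H_dist_self:
  assumes "p \<in> H"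
  shows "H_dist p p = 0"
proof -
  have "has_weak_deriv (\<lambda>_. 0) (\<lambda>_. 0)" by (rule has_weak_deriv_C1) auto
  note w = weak_deriv_AE[OF this] has_weak_deriv_L2(2)[OF has_weak_deriv_weak_deriv[OF this]]
  have "L2_norm (weak_deriv (\<lambda>_. 0)) = L2_norm (\<lambda>_. 0)"
    by (rule L2_norm_cong_AE) (use w in \<open>auto intro: L2_measurable\<close>)
  then show ?thesis by (simp add: H_dist_def H_norm_eq H_lincomb_def L2_norm_def)
qed

text \<open>The boundary terms are killed by v alone. This is why \<open>adjoint_domain\<close>
  imposes boundary values on w but none on a.\<close>

lemma W12_0_integration_by_parts:
  assumes "v \<in> W12_0" "continuous_on {0..1} a'"
    "\<And>x. x \<in> {0..1} \<Longrightarrow> (a has_vector_derivative a' x) (at x within {0..1})"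
  shows "(LINT x|unit_itv. weak_deriv v x * a x) = - (LINT x|unit_itv. v x * a' x)"
proof -
  obtain \<phi> where phi: "\<And>m::nat. \<phi> m \<in> test_functions" "(\<lambda>m. L2_norm (\<lambda>x. \<phi> m x - v x)) \<longlonglongrightarrow> 0"
    "(\<lambda>m. L2_norm (\<lambda>x. vector_derivative (\<phi> m) (at x) - weak_deriv v x)) \<longlonglongrightarrow> 0"
    using W12_0_approx[OF assms(1)] by blast
  have a: "a \<in> L2" "a' \<in> L2" using L2_continuous continuous_on_vector_derivative[OF assms(3)] assms(2) by auto
  have "(\<lambda>m. LINT x|unit_itv. vector_derivative (\<phi> m) (at x) * a x) \<longlonglongrightarrow> (LINT x|unit_itv. weak_deriv v x * a x)"
    by (intro L2_integral_tendsto test_functions_L2 test_functions_deriv phi W12_0_L2 assms a)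
  moreover have "(\<lambda>m. LINT x|unit_itv. \<phi> m x * a' x) \<longlonglongrightarrow> (LINT x|unit_itv. v x * a' x)"
    by (intro L2_integral_tendsto test_functions_L2 phi W12_0_L2 assms a)
  moreover have "(LINT x|unit_itv. \<phi> m x * a' x) = - (LINT x|unit_itv. vector_derivative (\<phi> m) (at x) * a x)" for m
    by (rule unit_itv_integration_by_parts)
      (use test_functions_boundary[OF phi(1)] test_functions_continuous[OF test_functions_deriv[OF phi(1)]]
        test_functions_has_deriv[OF phi(1)] assms in auto)
  ultimately have "(\<lambda>m. LINT x|unit_itv. vector_derivative (\<phi> m) (at x) * a x) \<longlonglongrightarrow> - (LINT x|unit_itv. v x * a' x)"
    "(\<lambda>m. LINT x|unit_itv. vector_derivative (\<phi> m) (at x) * a x) \<longlonglongrightarrow> (LINT x|unit_itv. weak_deriv v x * a x)"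
    by (auto dest: tendsto_minus)
  then show ?thesis using LIMSEQ_unique by blast
qed

text \<open>By density, the test functions in the definition of a weak derivative may be replaced by
  elements of \<open>W12_0\<close>.\<close>

lemma has_weak_deriv_W12_0_test:
  assumes "has_weak_deriv f g" "w \<in> W12_0"
  shows "(LINT x|unit_itv. g x * w x) = - (LINT x|unit_itv. f x * weak_deriv w x)"
proof -
  obtain \<phi> where phi: "\<And>m::nat. \<phi> m \<in> test_functions" "(\<lambda>m. L2_norm (\<lambda>x. \<phi> m x - w x)) \<longlonglongrightarrow> 0"
    "(\<lambda>m. L2_norm (\<lambda>x. vector_derivative (\<phi> m) (at x) - weak_deriv w x)) \<longlonglongrightarrow> 0"
    using W12_0_approx[OF assms(2)] by blast
  note L = has_weak_deriv_L2[OF assms(1)]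
  have "(\<lambda>m. LINT x|unit_itv. vector_derivative (\<phi> m) (at x) * f x) \<longlonglongrightarrow> (LINT x|unit_itv. weak_deriv w x * f x)"
    by (intro L2_integral_tendsto test_functions_L2 test_functions_deriv phi W12_0_L2 assms L)
  moreover have "(\<lambda>m. LINT x|unit_itv. \<phi> m x * g x) \<longlonglongrightarrow> (LINT x|unit_itv. w x * g x)"
    by (intro L2_integral_tendsto test_functions_L2 phi W12_0_L2 assms L)
  moreover have "(LINT x|unit_itv. \<phi> m x * g x) = - (LINT x|unit_itv. vector_derivative (\<phi> m) (at x) * f x)" for m
    using has_weak_deriv_test_eq[OF assms(1) phi(1), of m] by (simp add: mult.commute)
  ultimately have "(\<lambda>m. LINT x|unit_itv. \<phi> m x * g x) \<longlonglongrightarrow> - (LINT x|unit_itv. weak_deriv w x * f x)"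
    "(\<lambda>m. LINT x|unit_itv. \<phi> m x * g x) \<longlonglongrightarrow> (LINT x|unit_itv. w x * g x)"
    by (auto dest: tendsto_minus)
  then show ?thesis using LIMSEQ_unique by (fastforce simp: mult.commute)
qed

text \<open>The pairs \<open>(a, w)\<close> on which the formal adjoint \<open>(a, w) \<mapsto> (- w', - a' - 2\<alpha> w / x)\<close> of the
  generator is classically defined; here \<open>a\<close> plays the role of the derivative of the first component.\<close>

definition adjoint_domain :: "(real \<Rightarrow> complex) \<Rightarrow> (real \<Rightarrow> complex) \<Rightarrow> (real \<Rightarrow> complex) \<Rightarrow> (real \<Rightarrow> complex) \<Rightarrow> bool" where
  "adjoint_domain a a' w w' \<longleftrightarrow> continuous_on {0..1} a' \<and> continuous_on {0..1} w' \<and> w 0 = 0 \<and> w 1 = 0 \<and>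
     (\<forall>x\<in>{0..1}. (a has_vector_derivative a' x) (at x within {0..1})) \<and>
     (\<forall>x\<in>{0..1}. (w has_vector_derivative w' x) (at x within {0..1}))"

lemma adjoint_domain_W12_0: "adjoint_domain a a' w w' \<Longrightarrow> w \<in> W12_0"
  by (rule W12_0_C1[of w']) (auto simp: adjoint_domain_def)

text \<open>Only the damping term is critical: w vanishes at 0, and Hardy's inequality puts w / x
  into L2.\<close>

lemma adjoint_domain_L2:
  assumes "adjoint_domain a a' w w'"
  shows "a \<in> L2" "w \<in> L2" "(\<lambda>x. - w' x) \<in> L2" "(\<lambda>x. - a' x - complex_of_real (2 * \<alpha> / x) * w x) \<in> L2"
proof -
  show "a \<in> L2" using assms unfolding adjoint_domain_def
    by (intro L2_continuous continuous_on_vector_derivative[of _ a a']) blast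
  show "w \<in> L2" using adjoint_domain_W12_0[OF assms] W12_0_L2 by blast
  show "(\<lambda>x. - w' x) \<in> L2" using assms unfolding adjoint_domain_def
    by (intro L2_uminus L2_continuous) blast
  have "a' \<in> L2" using assms unfolding adjoint_domain_def by (intro L2_continuous) blast
  from L2_lincomb[OF this hardy_W12_0(1)[OF adjoint_domain_W12_0[OF assms]], of "-1" "- complex_of_real (2 * \<alpha>)"]
  show "(\<lambda>x. - a' x - complex_of_real (2 * \<alpha> / x) * w x) \<in> L2" by simp
qed

lemma W22_weak_deriv: 
  assumes "u \<in> W22"
  shows "has_weak_deriv (weak_deriv u) (weak_deriv (weak_deriv u))"
proof -
  obtain g h where gh: "has_weak_deriv u g" "has_weak_deriv g h" using assms unfolding W22_def by blast
  have "has_weak_deriv (weak_deriv u) h"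
    by (rule has_weak_deriv_cong[OF gh(2)])
      (use weak_deriv_AE[OF gh(1)] has_weak_deriv_L2(2)[OF has_weak_deriv_weak_deriv[OF gh(1)]] has_weak_deriv_L2(2)[OF gh(2)]
        in \<open>auto elim: eventually_mono intro: L2_measurable\<close>)
  then show ?thesis by (rule has_weak_deriv_weak_deriv)
qed

lemma G0_H: 
  assumes "(P, Q) \<in> G0 \<alpha>"
  shows "P \<in> H" "Q \<in> H"
proof -
  obtain u v where uv: "P = (u, v)" "Q = (v, \<lambda>x. weak_deriv (weak_deriv u) x - complex_of_real (2 * \<alpha> / x) * v x)"
    "u \<in> W12_0" "u \<in> W22" "v \<in> W12_0" using assms unfolding G0_def by blast
  show "P \<in> H" using uv by (auto simp: H_def intro: W12_0_L2)
  have "(\<lambda>x. 1 * weak_deriv (weak_deriv u) x + (- complex_of_real (2 * \<alpha>)) * (v x / of_real x)) \<in> L2"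
    using uv by (intro L2_lincomb hardy_W12_0 has_weak_deriv_L2(2)[OF W22_weak_deriv])
  then show "Q \<in> H" using uv by (simp add: H_def)
qed

text \<open>The integral of v' a moves its derivative to a, that of u'' w moves one derivative to w,
  and the damping is symmetric. What remains multiplies u' and v, which is again a pairing with (u,
  v).\<close>

lemma G0_pairing:
  assumes "(P, Q) \<in> G0 \<alpha>" "adjoint_domain a a' w w'"
  shows "pairing a w Q = pairing (\<lambda>x. - w' x) (\<lambda>x. - a' x - complex_of_real (2 * \<alpha> / x) * w x) P"
proof -
  obtain u v where uv: "P = (u, v)" "Q = (v, \<lambda>x. weak_deriv (weak_deriv u) x - complex_of_real (2 * \<alpha> / x) * v x)"
    "u \<in> W12_0" "u \<in> W22" "v \<in> W12_0" using assms unfolding G0_def by blast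
  let ?h = "weak_deriv (weak_deriv u)"
  have w: "w \<in> W12_0" using assms(2) by (rule adjoint_domain_W12_0)
  note wL = W12_0_L2[OF w] and vL = W12_0_L2[OF uv(5)] and uL = W12_0_L2[OF uv(3)]
  have hL: "?h \<in> L2" using W22_weak_deriv[OF uv(4)] has_weak_deriv_L2 by blast
  have a': "a' \<in> L2" using assms(2) unfolding adjoint_domain_def by (intro L2_continuous) blast
  have vx: "(\<lambda>x. v x / of_real x) \<in> L2" and wx: "(\<lambda>x. w x / of_real x) \<in> L2"
    using hardy_W12_0(1) uv(5) w by auto
  have 1: "(LINT x|unit_itv. weak_deriv v x * a x) = - (LINT x|unit_itv. v x * a' x)"
    by (rule W12_0_integration_by_parts[OF uv(5)]) (use assms(2) in \<open>auto simp: adjoint_domain_def\<close>)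
  have wd: "has_weak_deriv w w'"
    by (rule has_weak_deriv_C1) (use assms(2) in \<open>auto simp: adjoint_domain_def\<close>)
  have "(LINT x|unit_itv. ?h x * w x) = - (LINT x|unit_itv. weak_deriv u x * weak_deriv w x)"
    by (rule has_weak_deriv_W12_0_test[OF W22_weak_deriv[OF uv(4)] w])
  also have "(LINT x|unit_itv. weak_deriv u x * weak_deriv w x) = (LINT x|unit_itv. weak_deriv u x * w' x)"
    using weak_deriv_AE[OF wd] has_weak_deriv_L2(2)[OF wd] uL wL
    by (intro integral_cong_AE borel_measurable_integrable L2_mult_integrable) (auto elim: eventually_mono)
  finally have 2: "(LINT x|unit_itv. ?h x * w x) = - (LINT x|unit_itv. weak_deriv u x * w' x)" .
  \<comment> \<open>The singular term is regrouped as (v / x) * w, a product of two square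
    integrable functions by Hardy's inequality.\<close>
  have "(LINT x|unit_itv. (?h x - complex_of_real (2 * \<alpha> / x) * v x) * w x)
      = (LINT x|unit_itv. ?h x * w x - complex_of_real (2 * \<alpha>) * ((v x / of_real x) * w x))"
    by (rule Bochner_Integration.integral_cong) (simp_all add: algebra_simps)
  also have "\<dots> = (LINT x|unit_itv. ?h x * w x) - complex_of_real (2 * \<alpha>) * (LINT x|unit_itv. (v x / of_real x) * w x)"
    unfolding Bochner_Integration.integral_diff[OF L2_mult_integrable[OF hL wL(1)]
        integrable_mult_right[OF L2_mult_integrable[OF vx wL(1)]]] integral_mult_right_zero ..
  finally have 3: "(LINT x|unit_itv. (?h x - complex_of_real (2 * \<alpha> / x) * v x) * w x)
    = (LINT x|unit_itv. ?h x * w x) - complex_of_real (2 * \<alpha>) * (LINT x|unit_itv. (v x / of_real x) * w x)" .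
  have "(LINT x|unit_itv. v x * (- a' x - complex_of_real (2 * \<alpha> / x) * w x))
      = (LINT x|unit_itv. - (v x * a' x) - complex_of_real (2 * \<alpha>) * ((v x / of_real x) * w x))"
    by (rule Bochner_Integration.integral_cong) (simp_all add: algebra_simps)
  also have "\<dots> = - (LINT x|unit_itv. v x * a' x) - complex_of_real (2 * \<alpha>) * (LINT x|unit_itv. (v x / of_real x) * w x)"
    unfolding Bochner_Integration.integral_diff[OF integrable_minus[OF L2_mult_integrable[OF vL(1) a']]
        integrable_mult_right[OF L2_mult_integrable[OF vx wL(1)]]] integral_mult_right_zero integral_minus ..
  finally show ?thesis
    unfolding pairing_def uv(1,2) fst_conv snd_conv 3 1 2 by simp
qed

text \<open>Both sides are continuous on \<open>H\<close>, so the identity passes to limits of graph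
  elements and the closure never has to be computed.\<close>

lemma op_closure_G0_pairing:
  assumes "(p, q) \<in> op_closure (G0 \<alpha>)" "adjoint_domain a a' w w'"
  shows "pairing a w q = pairing (\<lambda>x. - w' x) (\<lambda>x. - a' x - complex_of_real (2 * \<alpha> / x) * w x) p"
proof -
  obtain P Q where PQ: "p \<in> H" "q \<in> H" "\<And>m::nat. (P m, Q m) \<in> G0 \<alpha>"
    "(\<lambda>m. H_dist (P m) p) \<longlonglongrightarrow> 0" "(\<lambda>m. H_dist (Q m) q) \<longlonglongrightarrow> 0"
    using assms(1) unfolding op_closure_def by auto
  note L = adjoint_domain_L2[OF assms(2)]
  have "(\<lambda>m. pairing a w (Q m)) \<longlonglongrightarrow> pairing a w q"
    by (intro pairing_tendsto L PQ G0_H(2)[OF PQ(3)])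
  moreover have "(\<lambda>m. pairing (\<lambda>x. - w' x) (\<lambda>x. - a' x - complex_of_real (2 * \<alpha> / x) * w x) (P m))
     \<longlonglongrightarrow> pairing (\<lambda>x. - w' x) (\<lambda>x. - a' x - complex_of_real (2 * \<alpha> / x) * w x) p"
    by (intro pairing_tendsto L PQ G0_H(1)[OF PQ(3)])
  ultimately show ?thesis
    unfolding G0_pairing[OF PQ(3) assms(2)] using LIMSEQ_unique by blast
qed

text \<open>Pairs of test functions lie in the domain of \<open>G0\<close>, and constant sequences
  place \<open>G0\<close> inside its closure.\<close>

lemma op_closure_G0_dense:
  assumes "p \<in> H"
  obtains P where "\<And>m::nat. P m \<in> Domain (op_closure (G0 \<alpha>))" "(\<lambda>m. H_dist (P m) p) \<longlonglongrightarrow> 0"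
proof -
  obtain \<phi> where phi: "\<And>m::nat. \<phi> m \<in> test_functions" "(\<lambda>m. L2_norm (\<lambda>x. \<phi> m x - fst p x)) \<longlonglongrightarrow> 0"
    "(\<lambda>m. L2_norm (\<lambda>x. vector_derivative (\<phi> m) (at x) - weak_deriv (fst p) x)) \<longlonglongrightarrow> 0"
    using W12_0_approx[OF H_D(1)[OF assms]] by blast
  obtain \<psi> where psi: "\<And>m::nat. \<psi> m \<in> test_functions" "(\<lambda>m. L2_norm (\<lambda>x. \<psi> m x - snd p x)) \<longlonglongrightarrow> 0"
    using L2_test_sequence[OF H_D(2)[OF assms]] by blast
  have W22: "\<phi> \<in> W22" if "\<phi> \<in> test_functions" for \<phi>
    unfolding W22_def using has_weak_deriv_test[OF that] has_weak_deriv_test[OF test_functions_deriv[OF that]] by blast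
  show ?thesis
  proof (rule that)
    fix m
    let ?q = "(\<psi> m, \<lambda>x. weak_deriv (weak_deriv (\<phi> m)) x - complex_of_real (2 * \<alpha> / x) * \<psi> m x)"
    have G: "((\<phi> m, \<psi> m), ?q) \<in> G0 \<alpha>"
      unfolding G0_def using W22 test_functions_W12_0 phi psi by blast
    have "((\<phi> m, \<psi> m), ?q) \<in> op_closure (G0 \<alpha>)"
      unfolding op_closure_def
      by (intro CollectI case_prodI conjI exI[of _ "\<lambda>_::nat. (\<phi> m, \<psi> m)"] exI[of _ "\<lambda>_::nat. ?q"] allI G G0_H[OF G])
        (simp_all only: H_dist_self[OF G0_H(1)[OF G]] H_dist_self[OF G0_H(2)[OF G]] tendsto_const)
    then show "(\<phi> m, \<psi> m) \<in> Domain (op_closure (G0 \<alpha>))" by blast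
  next
    show "(\<lambda>m. H_dist (\<phi> m, \<psi> m) p) \<longlonglongrightarrow> 0"
    proof (rule Lim_null_comparison)
      show "(\<lambda>m. L2_norm (\<lambda>x. vector_derivative (\<phi> m) (at x) - weak_deriv (fst p) x) + L2_norm (\<lambda>x. \<psi> m x - snd p x)) \<longlonglongrightarrow> 0"
        using tendsto_add[OF phi(3) psi(2)] by simp
      show "\<forall>\<^sub>F m in sequentially. norm (H_dist (\<phi> m, \<psi> m) p)
          \<le> L2_norm (\<lambda>x. vector_derivative (\<phi> m) (at x) - weak_deriv (fst p) x) + L2_norm (\<lambda>x. \<psi> m x - snd p x)"
      proof (rule always_eventually, rule allI)
        fix m
        have wd: "has_weak_deriv (\<lambda>x. 1 * \<phi> m x + (-1) * fst p x)
            (\<lambda>x. 1 * vector_derivative (\<phi> m) (at x) + (-1) * weak_deriv (fst p) x)"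
          by (intro has_weak_deriv_lincomb has_weak_deriv_test phi W12_0_weak_deriv H_D assms)
        have "L2_norm (weak_deriv (\<lambda>x. 1 * \<phi> m x + (-1) * fst p x))
           = L2_norm (\<lambda>x. 1 * vector_derivative (\<phi> m) (at x) + (-1) * weak_deriv (fst p) x)"
          by (rule L2_norm_cong_AE[OF weak_deriv_AE[OF wd]])
            (use has_weak_deriv_L2(2)[OF wd] has_weak_deriv_L2(2)[OF has_weak_deriv_weak_deriv[OF wd]] L2_measurable in blast)+
        then show "norm (H_dist (\<phi> m, \<psi> m) p)
          \<le> L2_norm (\<lambda>x. vector_derivative (\<phi> m) (at x) - weak_deriv (fst p) x) + L2_norm (\<lambda>x. \<psi> m x - snd p x)"
          using H_norm_le[of "H_lincomb 1 (\<phi> m, \<psi> m) (-1) p"]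
          by (simp add: H_dist_def H_lincomb_def H_norm_nonneg)
      qed
    qed
  qed
qed

section \<open>Contraction semigroups\<close>


locale contraction_semigroup_on_H =
  fixes S :: "real \<Rightarrow> state \<Rightarrow> state"
  assumes sg: "contraction_semigroup S"
begin

lemma S_in_H: "0 \<le> t \<Longrightarrow> p \<in> H \<Longrightarrow> S t p \<in> H"
  using sg unfolding contraction_semigroup_def by blast

lemma S_lincomb: "0 \<le> t \<Longrightarrow> p \<in> H \<Longrightarrow> q \<in> H \<Longrightarrow> H_eq (S t (H_lincomb a p b q)) (H_lincomb a (S t p) b (S t q))"
  using sg unfolding contraction_semigroup_def by blast

lemma S_0: "p \<in> H \<Longrightarrow> H_eq (S 0 p) p"
  using sg unfolding contraction_semigroup_def by blast

lemma S_add: "0 \<le> s \<Longrightarrow> 0 \<le> t \<Longrightarrow> p \<in> H \<Longrightarrow> H_eq (S (s + t) p) (S s (S t p))"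
  using sg unfolding contraction_semigroup_def by blast

lemma S_norm: "0 \<le> t \<Longrightarrow> p \<in> H \<Longrightarrow> H_norm (S t p) \<le> H_norm p"
  using sg unfolding contraction_semigroup_def by blast

lemma S_cont: "p \<in> H \<Longrightarrow> ((\<lambda>t. H_dist (S t p) p) \<longlongrightarrow> 0) (at_right 0)"
  using sg unfolding contraction_semigroup_def by blast

lemma pairing_S_bound:
  assumes "a \<in> L2" "b \<in> L2" "p \<in> H" "0 \<le> t"
  shows "cmod (pairing a b (S t p)) \<le> (L2_norm a + L2_norm b) * H_norm p"
  by (rule order_trans[OF pairing_bound[OF assms(1,2) S_in_H[OF assms(4,3)]]])
    (intro mult_left_mono S_norm assms add_nonneg_nonneg L2_norm_nonneg)

lemma pairing_S_lincomb:
  assumes "a \<in> L2" "b \<in> L2" "p \<in> H" "q \<in> H" "0 \<le> t"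
  shows "pairing a b (S t (H_lincomb c p d q)) = c * pairing a b (S t p) + d * pairing a b (S t q)"
  using pairing_cong[OF assms(1,2) S_in_H[OF assms(5) H_lincomb_in_H[OF assms(3,4)]]
      H_lincomb_in_H[OF S_in_H[OF assms(5,3)] S_in_H[OF assms(5,4)]] S_lincomb[OF assms(5,3,4)]]
    pairing_lincomb[OF assms(1,2) S_in_H[OF assms(5,3)] S_in_H[OF assms(5,4)]] by metis

lemma pairing_S_diff:
  assumes "a \<in> L2" "b \<in> L2" "p \<in> H" "q \<in> H" "0 \<le> t"
  shows "cmod (pairing a b (S t p) - pairing a b (S t q)) \<le> (L2_norm a + L2_norm b) * H_dist p q"
  using pairing_S_bound[OF assms(1,2) H_lincomb_in_H[OF assms(3,4), of 1 "-1"] assms(5)]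
    pairing_S_lincomb[OF assms, of 1 "-1"] by (simp add: H_dist_def)

lemma pairing_S_add:
  assumes "a \<in> L2" "b \<in> L2" "p \<in> H" "0 \<le> s" "0 \<le> t"
  shows "pairing a b (S (s + t) p) = pairing a b (S s (S t p))"
  by (intro pairing_cong assms S_in_H S_add add_nonneg_nonneg)

lemma pairing_S_0:
  assumes "a \<in> L2" "b \<in> L2" "p \<in> H"
  shows "pairing a b (S 0 p) = pairing a b p"
  by (intro pairing_cong assms S_in_H S_0 order_refl)

text \<open>\<open>contraction_semigroup\<close> grants only right continuity at time 0. Since every
  S s is a contraction, the modulus found at 0 serves at every base time s, and being uniform in s
  it also gives continuity from the left.\<close>

lemma pairing_S_continuous:
  assumes "a \<in> L2" "b \<in> L2" "p \<in> H"
  shows "continuous_on {0..} (\<lambda>t. pairing a b (S t p))"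
  unfolding continuous_on_iff
proof (intro ballI allI impI)
  fix t e :: real assume t: "t \<in> {0..}" and "e > 0"
  let ?C = "L2_norm a + L2_norm b"
  have "((\<lambda>h. ?C * H_dist (S h p) p) \<longlongrightarrow> 0) (at_right 0)"
    using tendsto_mult_right_zero[OF S_cont[OF assms(3)]] .
  from order_tendstoD(2)[OF this \<open>e > 0\<close>] obtain d where d: "d > 0"
    "\<And>h. 0 < h \<Longrightarrow> h < d \<Longrightarrow> ?C * H_dist (S h p) p < e"
    unfolding eventually_at_right_field by auto
  have *: "cmod (pairing a b (S s' p) - pairing a b (S s p)) < e" if "0 \<le> s" "s < s'" "s' < s + d" for s s'
  proof -
    have "pairing a b (S s' p) = pairing a b (S s (S (s' - s) p))"
      using pairing_S_add[OF assms, of s "s' - s"] that by simp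
    then have "cmod (pairing a b (S s' p) - pairing a b (S s p)) \<le> ?C * H_dist (S (s' - s) p) p"
      using pairing_S_diff[OF assms(1,2) S_in_H[OF _ assms(3)] assms(3), of "s' - s" s] that by simp
    also have "\<dots> < e" using d(2)[of "s' - s"] that by simp
    finally show ?thesis .
  qed
  show "\<exists>d>0. \<forall>x'\<in>{0..}. dist x' t < d \<longrightarrow> dist (pairing a b (S x' p)) (pairing a b (S t p)) < e"
  proof (intro exI[of _ d] conjI ballI impI d(1))
    fix x' assume x': "x' \<in> {0..}" "dist x' t < d"
    consider "x' = t" | "t < x'" | "x' < t" by linarith
    then show "dist (pairing a b (S x' p)) (pairing a b (S t p)) < e"
    proof cases
      case 1 then show ?thesis using \<open>e > 0\<close> by simp
    next
      case 2 then show ?thesis using *[of t x'] t x' by (simp add: dist_norm)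
    next
      case 3 then show ?thesis using *[of x' t] t x' by (simp add: dist_norm norm_minus_commute)
    qed
  qed
qed

lemma generator_D:
  assumes "(p, q) \<in> generator S"
  shows "p \<in> H" "q \<in> H"
    "((\<lambda>h. H_dist (H_lincomb (complex_of_real (1 / h)) (S h p) (- complex_of_real (1 / h)) p) q) \<longlongrightarrow> 0) (at_right 0)"
  using assms unfolding generator_def by auto

text \<open>\<open>generator\<close> speaks of right difference quotients only. Contractivity makes
  their error uniform in the base time, so a left quotient at t can be based at the earlier time and
  compared with t through continuity of the pairing with q.\<close>

lemma pairing_S_deriv:
  assumes "a \<in> L2" "b \<in> L2" "(p, q) \<in> generator S" "0 \<le> t"
  shows "((\<lambda>t. pairing a b (S t p)) has_vector_derivative pairing a b (S t q)) (at t within {0..})"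
proof -
  note pq = generator_D[OF assms(3)]
  let ?f = "\<lambda>t. pairing a b (S t p)" and ?g = "\<lambda>t. pairing a b (S t q)"
  let ?C = "L2_norm a + L2_norm b"
  let ?r = "\<lambda>h. H_lincomb (complex_of_real (1 / h)) (S h p) (- complex_of_real (1 / h)) p"
  have r: "?r h \<in> H" if "0 \<le> h" for h by (intro H_lincomb_in_H S_in_H pq that)
  have key: "cmod (?f s' - ?f s - (s' - s) *\<^sub>R ?g s) \<le> (s' - s) * (?C * H_dist (?r (s' - s)) q)"
    if "0 \<le> s" "s < s'" for s s'
  proof -
    let ?h = "s' - s"
    have "?f s' = pairing a b (S s (S ?h p))"
      using pairing_S_add[OF assms(1,2) pq(1), of s ?h] that by simp
    then have "pairing a b (S s (?r ?h)) = complex_of_real (1 / ?h) * (?f s' - ?f s)"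
      using pairing_S_lincomb[OF assms(1,2) S_in_H[OF _ pq(1)] pq(1) that(1), of ?h "complex_of_real (1 / ?h)" "- complex_of_real (1 / ?h)"] that
      by (simp add: algebra_simps)
    then have "?f s' - ?f s - ?h *\<^sub>R ?g s = ?h *\<^sub>R (pairing a b (S s (?r ?h)) - ?g s)"
      using that by (simp add: scaleR_conv_of_real right_diff_distrib)
    then have "cmod (?f s' - ?f s - ?h *\<^sub>R ?g s) = ?h * cmod (pairing a b (S s (?r ?h)) - ?g s)"
      using that by simp
    also have "\<dots> \<le> ?h * (?C * H_dist (?r ?h) q)"
      using that by (intro mult_left_mono pairing_S_diff assms r pq) auto
    finally show ?thesis .
  qed
  have lim: "((\<lambda>h. ?C * H_dist (?r h) q) \<longlongrightarrow> 0) (at_right 0)"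
    using tendsto_mult_right_zero[OF pq(3)] .
  show ?thesis
    unfolding has_vector_derivative_def has_derivative_within_alt2
  proof (intro conjI allI impI)
    show "bounded_linear (\<lambda>h. h *\<^sub>R ?g t)" by (rule bounded_linear_scaleR_left)
    fix e :: real assume "e > 0"
    then have e2: "e / 2 > 0" by simp
    from order_tendstoD(2)[OF lim e2] obtain d where d: "d > 0"
      "\<And>h. 0 < h \<Longrightarrow> h < d \<Longrightarrow> ?C * H_dist (?r h) q < e / 2"
      unfolding eventually_at_right_field by auto
    obtain d' where d': "d' > 0" "\<And>s. s \<in> {0..} \<Longrightarrow> dist s t < d' \<Longrightarrow> dist (?g s) (?g t) < e / 2"
    proof -
      have "t \<in> {0..}" using assms(4) by simp
      with pairing_S_continuous[OF assms(1,2) pq(2)] e2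
      have "\<exists>d'>0. \<forall>s\<in>{0..}. dist s t < d' \<longrightarrow> dist (?g s) (?g t) < e / 2"
        unfolding continuous_on_iff by blast
      then show ?thesis using that by blast
    qed
    show "\<forall>\<^sub>F y in at t within {0..}. norm (?f y - ?f t - (y - t) *\<^sub>R ?g t) \<le> e * norm (y - t)"
      unfolding eventually_at
    proof (intro exI[of _ "min d d'"] conjI ballI impI)
      show "0 < min d d'" using d d' by simp
      fix y assume y: "y \<in> {0..}" "y \<noteq> t \<and> dist y t < min d d'"
      consider "t < y" | "y < t" using y by linarith
      then show "norm (?f y - ?f t - (y - t) *\<^sub>R ?g t) \<le> e * norm (y - t)"
      proof cases
        case 1
        have "norm (?f y - ?f t - (y - t) *\<^sub>R ?g t) \<le> (y - t) * (?C * H_dist (?r (y - t)) q)"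
          using key[OF assms(4) 1] .
        also have "\<dots> \<le> (y - t) * e"
          using d(2)[of "y - t"] 1 y \<open>e > 0\<close> by (intro mult_left_mono) (auto simp: dist_real_def)
        finally show ?thesis using 1 by (simp add: mult.commute)
      next
        case 2
        \<comment> \<open>Expansion from the earlier time y; the last summand corrects the slope
          from y to t and is small by continuity.\<close>
        have "?f y - ?f t - (y - t) *\<^sub>R ?g t = - (?f t - ?f y - (t - y) *\<^sub>R ?g y) + (t - y) *\<^sub>R (?g t - ?g y)"
          by (simp add: algebra_simps)
        also have "norm \<dots> \<le> norm (?f t - ?f y - (t - y) *\<^sub>R ?g y) + norm ((t - y) *\<^sub>R (?g t - ?g y))"
          by (metis norm_minus_cancel norm_triangle_ineq)
        also have "\<dots> \<le> (t - y) * (e / 2) + (t - y) * (e / 2)"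
        proof (rule add_mono)
          have "0 \<le> y" using y by simp
          then have "norm (?f t - ?f y - (t - y) *\<^sub>R ?g y) \<le> (t - y) * (?C * H_dist (?r (t - y)) q)"
            by (rule key[OF _ 2])
          also have "\<dots> \<le> (t - y) * (e / 2)"
            by (rule mult_left_mono) (use d(2)[of "t - y"] y 2 in \<open>simp_all only: dist_real_def, linarith+\<close>)
          finally show "norm (?f t - ?f y - (t - y) *\<^sub>R ?g y) \<le> (t - y) * (e / 2)" .
          have "norm (?g t - ?g y) \<le> e / 2"
            using d'(2)[of y] y by (simp add: dist_norm norm_minus_commute)
          then show "norm ((t - y) *\<^sub>R (?g t - ?g y)) \<le> (t - y) * (e / 2)"
            using 2 unfolding norm_scaleR by (intro mult_mono) simp_all
        qed
        also have "\<dots> = e * norm (y - t)" using 2 by (simp add: algebra_simps)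
        finally show ?thesis .
      qed
    qed
  qed
qed

end

section \<open>Time evolution of pairings for the damped wave generator\<close>

locale damped_wave_semigroup = contraction_semigroup_on_H +
  fixes \<alpha> :: real
  assumes gen: "generator S = op_closure (G0 \<alpha>)"
begin

text \<open>Pairing with the image of (a, w) under the formal adjoint; a enters only through its
  derivative and is therefore no argument.\<close>

definition adjoint_pairing :: "(real \<Rightarrow> complex) \<Rightarrow> (real \<Rightarrow> complex) \<Rightarrow> (real \<Rightarrow> complex) \<Rightarrow> state \<Rightarrow> complex" where
  "adjoint_pairing a' w w' = pairing (\<lambda>x. - w' x) (\<lambda>x. - a' x - complex_of_real (2 * \<alpha> / x) * w x)"

text \<open>Up to \<open>H_eq\<close>, the difference quotient at S t p is the image under S t of
  the quotient at p, and S t does not increase distances.\<close>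

lemma generator_S:
  assumes "(p, q) \<in> generator S" "0 \<le> t"
  shows "(S t p, S t q) \<in> generator S"
proof -
  note pq = generator_D[OF assms(1)]
  let ?c = "\<lambda>h. complex_of_real (1 / h)"
  have "\<forall>\<^sub>F h in at_right 0. norm (H_dist (H_lincomb (?c h) (S h (S t p)) (- ?c h) (S t p)) (S t q))
      \<le> H_dist (H_lincomb (?c h) (S h p) (- ?c h) p) q"
    using eventually_at_right_less[of 0]
  proof eventually_elim
    case (elim h)
    let ?r = "H_lincomb (?c h) (S h p) (- ?c h) p" and ?r' = "H_lincomb (?c h) (S h (S t p)) (- ?c h) (S t p)"
    note mem = S_in_H[OF assms(2) pq(1)] S_in_H[OF assms(2) pq(2)]
    have hp: "S h p \<in> H" using elim pq by (intro S_in_H) auto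
    have r: "?r \<in> H" by (intro H_lincomb_in_H hp pq)
    have r': "?r' \<in> H" using elim by (intro H_lincomb_in_H S_in_H mem) auto
    have "H_eq (S (t + h) p) (S t (S h p))" "H_eq (S (h + t) p) (S h (S t p))"
      using elim assms(2) pq(1) by (intro S_add; simp)+
    then have e0: "H_eq (S t (S h p)) (S h (S t p))"
      unfolding H_eq_def add.commute[of h t] by (auto elim: eventually_elim2)
    have e1: "H_eq (S t ?r) (H_lincomb (?c h) (S t (S h p)) (- ?c h) (S t p))"
      by (rule S_lincomb[OF assms(2) hp pq(1)])
    have e2: "H_eq (S t (H_lincomb 1 ?r (-1) q)) (H_lincomb 1 (S t ?r) (-1) (S t q))"
      by (rule S_lincomb[OF assms(2) r pq(2)])
    have e3: "H_eq (S t (H_lincomb 1 ?r (-1) q)) (H_lincomb 1 ?r' (-1) (S t q))"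
      unfolding H_eq_def
    proof
      show "AE x in unit_itv. fst (S t (H_lincomb 1 ?r (-1) q)) x = fst (H_lincomb 1 ?r' (-1) (S t q)) x"
        using e0[unfolded H_eq_def, THEN conjunct1] e1[unfolded H_eq_def, THEN conjunct1] e2[unfolded H_eq_def, THEN conjunct1]
        by eventually_elim (simp add: H_lincomb_def)
      show "AE x in unit_itv. snd (S t (H_lincomb 1 ?r (-1) q)) x = snd (H_lincomb 1 ?r' (-1) (S t q)) x"
        using e0[unfolded H_eq_def, THEN conjunct2] e1[unfolded H_eq_def, THEN conjunct2] e2[unfolded H_eq_def, THEN conjunct2]
        by eventually_elim (simp add: H_lincomb_def)
    qed
    have m1: "H_lincomb 1 ?r (-1) q \<in> H" "H_lincomb 1 ?r' (-1) (S t q) \<in> H"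
      by (intro H_lincomb_in_H r r' pq mem)+
    have "H_norm (H_lincomb 1 ?r' (-1) (S t q)) = H_norm (S t (H_lincomb 1 ?r (-1) q))"
      by (rule H_norm_cong[symmetric]) (use e3 m1 S_in_H[OF assms(2) m1(1)] in auto)
    also have "\<dots> \<le> H_norm (H_lincomb 1 ?r (-1) q)" by (rule S_norm[OF assms(2) m1(1)])
    finally show ?case by (simp add: H_dist_def H_norm_nonneg)
  qed
  then have "((\<lambda>h. H_dist (H_lincomb (?c h) (S h (S t p)) (- ?c h) (S t p)) (S t q)) \<longlongrightarrow> 0) (at_right 0)"
    by (rule Lim_null_comparison[OF _ pq(3)])
  then show ?thesis using S_in_H[OF assms(2)] pq unfolding generator_def by auto
qed

lemma pairing_S_integral_generator:
  assumes "adjoint_domain a a' w w'" "p \<in> Domain (generator S)" "0 \<le> t"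
  shows "pairing a w (S t p) - pairing a w p = integral {0..t} (\<lambda>s. adjoint_pairing a' w w' (S s p))"
proof -
  from assms(2) obtain q where pq: "(p, q) \<in> generator S" by blast
  note L = adjoint_domain_L2[OF assms(1)]
  have "((\<lambda>s. adjoint_pairing a' w w' (S s p)) has_integral pairing a w (S t p) - pairing a w (S 0 p)) {0..t}"
  proof (rule fundamental_theorem_of_calculus[OF assms(3)])
    fix s assume s: "s \<in> {0..t}"
    have "(S s p, S s q) \<in> op_closure (G0 \<alpha>)" using generator_S[OF pq, of s] gen s by simp
    from op_closure_G0_pairing[OF this assms(1)]
    have "pairing a w (S s q) = adjoint_pairing a' w w' (S s p)" by (simp add: adjoint_pairing_def)
    with pairing_S_deriv[OF L(1,2) pq, of s] s
    show "((\<lambda>t. pairing a w (S t p)) has_vector_derivative adjoint_pairing a' w w' (S s p)) (at s within {0..t})"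
      by (auto elim: has_vector_derivative_within_subset)
  qed
  then show ?thesis using pairing_S_0[OF L(1,2) generator_D(1)[OF pq]] by (simp add: integral_unique)
qed

lemma adjoint_pairing_continuous:
  assumes "adjoint_domain a a' w w'" "p \<in> H" "A \<subseteq> {0..}"
  shows "continuous_on A (\<lambda>s. adjoint_pairing a' w w' (S s p))"
  unfolding adjoint_pairing_def
  by (rule continuous_on_subset[OF pairing_S_continuous[OF adjoint_domain_L2(3,4)[OF assms(1)] assms(2)] assms(3)])

text \<open>For p outside the domain of the generator, S t p need not be differentiable in time. The
  integrated identity survives: both sides are continuous in p, uniformly for times up to t, and the
  domain is dense.\<close>

lemma pairing_S_integral:
  assumes "adjoint_domain a a' w w'" "p \<in> H" "0 \<le> t"
  shows "pairing a w (S t p) - pairing a w p = integral {0..t} (\<lambda>s. adjoint_pairing a' w w' (S s p))"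
proof -
  note L = adjoint_domain_L2[OF assms(1)]
  obtain P where P: "\<And>m::nat. P m \<in> Domain (generator S)" "(\<lambda>m. H_dist (P m) p) \<longlonglongrightarrow> 0"
    unfolding gen using op_closure_G0_dense[OF assms(2)] by metis
  have PH: "P m \<in> H" for m using P(1)[of m] generator_D by blast
  have conv: "(\<lambda>m. pairing c b (S s (P m))) \<longlonglongrightarrow> pairing c b (S s p)" if "c \<in> L2" "b \<in> L2" "0 \<le> s" for c b s
  proof (rule LIM_zero_cancel, rule Lim_null_comparison)
    show "\<forall>\<^sub>F m in sequentially. norm (pairing c b (S s (P m)) - pairing c b (S s p)) \<le> (L2_norm c + L2_norm b) * H_dist (P m) p"
      by (intro always_eventually allI pairing_S_diff that PH assms)
    show "(\<lambda>m. (L2_norm c + L2_norm b) * H_dist (P m) p) \<longlonglongrightarrow> 0" by (rule tendsto_mult_right_zero[OF P(2)])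
  qed
  let ?Y = "\<lambda>p s. adjoint_pairing a' w w' (S s p)"
  let ?C = "L2_norm (\<lambda>x. - w' x) + L2_norm (\<lambda>x. - a' x - complex_of_real (2 * \<alpha> / x) * w x)"
  have int: "?Y p integrable_on {0..t}" if "p \<in> H" for p
    by (intro integrable_continuous_real adjoint_pairing_continuous[OF assms(1) that]) auto
  have "(\<lambda>m. integral {0..t} (?Y (P m))) \<longlonglongrightarrow> integral {0..t} (?Y p)"
  proof (rule LIM_zero_cancel, rule Lim_null_comparison)
    show "\<forall>\<^sub>F m in sequentially. norm (integral {0..t} (?Y (P m)) - integral {0..t} (?Y p)) \<le> ?C * H_dist (P m) p * t"
    proof (rule always_eventually, rule allI)
      fix m
      have "integral {0..t} (?Y (P m)) - integral {0..t} (?Y p) = integral {0..t} (\<lambda>s. ?Y (P m) s - ?Y p s)"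
        by (rule Henstock_Kurzweil_Integration.integral_diff[symmetric]) (intro int PH assms)+
      also have "norm \<dots> \<le> ?C * H_dist (P m) p * (t - 0)"
        using assms(3)
      proof (rule integral_bound)
        show "continuous_on {0..t} (\<lambda>s. ?Y (P m) s - ?Y p s)"
          by (intro continuous_intros adjoint_pairing_continuous[OF assms(1)] PH assms) auto
        fix s assume "s \<in> {0..t}"
        then show "norm (?Y (P m) s - ?Y p s) \<le> ?C * H_dist (P m) p"
          unfolding adjoint_pairing_def by (intro pairing_S_diff L PH assms) auto
      qed
      finally show "norm (integral {0..t} (?Y (P m)) - integral {0..t} (?Y p)) \<le> ?C * H_dist (P m) p * t" by simp
    qed
    show "(\<lambda>m. ?C * H_dist (P m) p * t) \<longlonglongrightarrow> 0"
      by (intro tendsto_mult_left_zero tendsto_mult_right_zero P)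
  qed
  moreover have "(\<lambda>m. pairing a w (S t (P m)) - pairing a w (P m)) \<longlonglongrightarrow> pairing a w (S t p) - pairing a w p"
    by (intro tendsto_diff conv pairing_tendsto L PH P assms)
  ultimately show ?thesis
    unfolding pairing_S_integral_generator[OF assms(1) P(1) assms(3)] using LIMSEQ_unique by blast
qed

text \<open>Differentiating the integrated identity makes the pairing differentiable for every p in
  \<open>H\<close>, because the operator acts on the pair and not on the state.\<close>

lemma pairing_S_has_deriv:
  assumes "adjoint_domain a a' w w'" "p \<in> H" "t \<in> {0..T}"
  shows "((\<lambda>t. pairing a w (S t p)) has_vector_derivative adjoint_pairing a' w w' (S t p)) (at t within {0..T})"
proof -
  have "((\<lambda>t. integral {0..t} (\<lambda>s. adjoint_pairing a' w w' (S s p))) has_vector_derivative adjoint_pairing a' w w' (S t p)) (at t within {0..T})"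
    by (intro integral_has_vector_derivative adjoint_pairing_continuous[OF assms(1)] assms(2,3)) auto
  from has_vector_derivative_add[OF has_vector_derivative_const this, of "pairing a w p"]
  have "((\<lambda>t. pairing a w p + integral {0..t} (\<lambda>s. adjoint_pairing a' w w' (S s p))) has_vector_derivative adjoint_pairing a' w w' (S t p)) (at t within {0..T})"
    by simp
  then show ?thesis
    by (rule has_vector_derivative_transform[OF assms(3), rotated])
      (use pairing_S_integral[OF assms(1,2)] in \<open>auto simp: algebra_simps\<close>)
qed

end

section \<open>The sideways initial value problem\<close>


lemma entire_integral:
  fixes T :: "nat \<Rightarrow> 'a \<Rightarrow> complex"
  assumes "integrable M g" "\<And>k. T k \<in> borel_measurable M"
    and "\<And>k x. x \<in> space M \<Longrightarrow> cmod (T k x) \<le> b k" "\<And>r. summable (\<lambda>k. b k * r ^ k)"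
  shows "(\<lambda>\<zeta>. LINT x|M. g x * (\<Sum>k. \<zeta> ^ k * T k x)) holomorphic_on UNIV"
proof -
  let ?f = "\<lambda>\<zeta>. LINT x|M. g x * (\<Sum>k. \<zeta> ^ k * T k x)"
  let ?a = "\<lambda>k. LINT x|M. g x * T k x"
  have i: "integrable M (\<lambda>x. g x * T k x)" for k
  proof (rule Bochner_Integration.integrable_bound)
    show "integrable M (\<lambda>x. complex_of_real (b k) * g x)" using assms(1) by simp
    show "(\<lambda>x. g x * T k x) \<in> borel_measurable M" using assms(1,2) by measurable
    show "AE x in M. norm (g x * T k x) \<le> norm (complex_of_real (b k) * g x)"
    proof (rule AE_I2)
      fix x assume "x \<in> space M"
      from assms(3)[OF this, of k] have "cmod (T k x) \<le> \<bar>b k\<bar>" by linarith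
      then have "cmod (g x) * cmod (T k x) \<le> cmod (g x) * \<bar>b k\<bar>" by (rule mult_left_mono) simp
      then show "norm (g x * T k x) \<le> norm (complex_of_real (b k) * g x)"
        by (simp add: norm_mult mult.commute)
    qed
  qed
  have le: "norm (\<zeta> ^ k * (g x * T k x)) \<le> cmod (g x) * (b k * cmod \<zeta> ^ k)" if "x \<in> space M" for \<zeta> k x
  proof -
    have "cmod \<zeta> ^ k * cmod (g x) * cmod (T k x) \<le> cmod \<zeta> ^ k * cmod (g x) * b k"
      using assms(3)[OF that, of k] by (intro mult_left_mono) auto
    then show ?thesis by (simp add: norm_mult norm_power algebra_simps)
  qed
  \<comment> \<open>Term by term integration exhibits the integral as a power series in zeta; the
    majorant b justifies the exchange and gives convergence everywhere.\<close>
  have "(\<lambda>k. ?a k * \<zeta> ^ k) sums ?f \<zeta>" for \<zeta>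
  proof -
    have b: "summable (\<lambda>k. cmod (g x) * (b k * cmod \<zeta> ^ k))" for x
      by (intro summable_mult assms)
    have "(\<lambda>k. LINT x|M. \<zeta> ^ k * (g x * T k x)) sums (LINT x|M. (\<Sum>k. \<zeta> ^ k * (g x * T k x)))"
    proof (rule sums_integral)
      show "integrable M (\<lambda>x. \<zeta> ^ k * (g x * T k x))" for k using i by simp
      show "AE x in M. summable (\<lambda>k. norm (\<zeta> ^ k * (g x * T k x)))"
        by (rule AE_I2, rule summable_comparison_test'[OF b]) (use le in simp)
      show "summable (\<lambda>k. LINT x|M. norm (\<zeta> ^ k * (g x * T k x)))"
      proof (rule summable_comparison_test')
        show "summable (\<lambda>k. (LINT x|M. cmod (g x)) * (b k * cmod \<zeta> ^ k))"
          by (intro summable_mult assms)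
        fix k :: nat
        have "(LINT x|M. norm (\<zeta> ^ k * (g x * T k x))) \<le> (LINT x|M. cmod (g x) * (b k * cmod \<zeta> ^ k))"
        proof (rule integral_mono_AE)
          show "integrable M (\<lambda>x. norm (\<zeta> ^ k * (g x * T k x)))" using i by (intro integrable_norm) simp
          show "integrable M (\<lambda>x. cmod (g x) * (b k * cmod \<zeta> ^ k))" using assms(1) by simp
          show "AE x in M. norm (\<zeta> ^ k * (g x * T k x)) \<le> cmod (g x) * (b k * cmod \<zeta> ^ k)"
            by (rule AE_I2) (rule le)
        qed
        then show "norm (LINT x|M. norm (\<zeta> ^ k * (g x * T k x))) \<le> (LINT x|M. cmod (g x)) * (b k * cmod \<zeta> ^ k)"
          by simp
      qed
    qed
    moreover have "(LINT x|M. (\<Sum>k. \<zeta> ^ k * (g x * T k x))) = ?f \<zeta>"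
    proof (rule Bochner_Integration.integral_cong[OF refl])
      fix x assume x: "x \<in> space M"
      have "summable (\<lambda>k. \<zeta> ^ k * T k x)"
      proof (rule summable_comparison_test'[OF assms(4)[of "cmod \<zeta>"]])
        fix k
        show "norm (\<zeta> ^ k * T k x) \<le> b k * cmod \<zeta> ^ k"
          using mult_left_mono[OF assms(3)[OF x, of k], of "cmod \<zeta> ^ k"] by (simp add: norm_mult norm_power mult.commute)
      qed
      from suminf_mult[OF this, of "g x"] show "(\<Sum>k. \<zeta> ^ k * (g x * T k x)) = g x * (\<Sum>k. \<zeta> ^ k * T k x)"
        by (simp add: algebra_simps)
    qed
    moreover have "(LINT x|M. \<zeta> ^ k * (g x * T k x)) = ?a k * \<zeta> ^ k" for k by simp
    ultimately have "(\<lambda>k. \<zeta> ^ k * ?a k) sums ?f \<zeta>" by simp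
    then show ?thesis by (simp only: mult.commute[of "?a _"])
  qed
  then have "?f holomorphic_on ball 0 r" for r
    by (intro power_series_holomorphic[where a = ?a]) simp
  then have "?f field_differentiable at \<zeta>" for \<zeta>
    using holomorphic_on_imp_differentiable_at[of ?f "ball 0 (cmod \<zeta> + 1)" \<zeta>] by simp
  then show ?thesis by (simp add: holomorphic_on_def field_differentiable_at_within)
qed

text \<open>The case of constant coefficients, integrated over the unit interval, whose measure is
  1.\<close>

lemma entire_series:
  assumes "\<And>k. cmod (a k) \<le> b k" "\<And>r. summable (\<lambda>k. b k * r ^ k)"
  shows "(\<lambda>\<zeta>. \<Sum>k. \<zeta> ^ k * a k) holomorphic_on UNIV"
proof -
  have "(\<lambda>\<zeta>. LINT x|unit_itv. 1 * (\<Sum>k. \<zeta> ^ k * a k)) holomorphic_on UNIV"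
    by (rule entire_integral[where b = b]) (use assms in \<open>auto intro: unit_itv_bounded_integrable\<close>)
  then show ?thesis by (simp add: integral_mult_left_zero)
qed

lemma entire_integral_exp:
  assumes "integrable M g" "h \<in> borel_measurable M" "\<And>x. x \<in> space M \<Longrightarrow> \<bar>h x\<bar> \<le> B"
  shows "(\<lambda>\<zeta>. LINT x|M. g x * exp (\<zeta> * complex_of_real (h x))) holomorphic_on UNIV"
proof -
  have "(\<lambda>\<zeta>. LINT x|M. g x * (\<Sum>k. \<zeta> ^ k * (complex_of_real (h x) ^ k / fact k))) holomorphic_on UNIV"
  proof (rule entire_integral[where b = "\<lambda>k. B ^ k / fact k", OF assms(1)])
    show "(\<lambda>x. complex_of_real (h x) ^ k / fact k) \<in> borel_measurable M" for k using assms(2) by measurable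
    show "cmod (complex_of_real (h x) ^ k / fact k) \<le> B ^ k / fact k" if "x \<in> space M" for k x
      using power_mono[OF assms(3)[OF that], of k] by (simp add: norm_divide norm_power divide_right_mono)
    show "summable (\<lambda>k. B ^ k / fact k * r ^ k)" for r
      using summable_exp[of "B * r"] by (simp add: power_mult_distrib divide_inverse mult.commute mult.left_commute)
  qed
  moreover have "(\<Sum>k. \<zeta> ^ k * (z ^ k / fact k)) = exp (\<zeta> * z)" for \<zeta> z :: complex
    by (simp add: exp_def scaleR_conv_of_real power_mult_distrib divide_inverse mult.commute mult.left_commute)
  ultimately show ?thesis by simp
qed

lemma series_has_vector_derivative:
  fixes f f' :: "nat \<Rightarrow> real \<Rightarrow> complex"
  assumes "convex A" "\<And>k x. x \<in> A \<Longrightarrow> (f k has_vector_derivative f' k x) (at x within A)"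
    and "\<And>k x. x \<in> A \<Longrightarrow> cmod (f k x) \<le> b k" "\<And>k x. x \<in> A \<Longrightarrow> cmod (f' k x) \<le> b k" "summable b"
    and "x \<in> A"
  shows "((\<lambda>x. \<Sum>k. f k x) has_vector_derivative (\<Sum>k. f' k x)) (at x within A)"
proof -
  have ul: "uniform_limit A (\<lambda>n x. \<Sum>i<n. f' i x) (\<lambda>x. \<Sum>i. f' i x) sequentially"
    by (rule Weierstrass_m_test[OF assms(4,5)])
  have "\<exists>g. \<forall>x\<in>A. (\<lambda>n. f n x) sums (g x) \<and> (g has_derivative (\<lambda>h. h *\<^sub>R (\<Sum>i. f' i x))) (at x within A)"
  proof (rule has_derivative_series[OF assms(1)])
    show "(f n has_derivative (\<lambda>h. h *\<^sub>R f' n x)) (at x within A)" if "x \<in> A" for n x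
      using assms(2)[OF that] by (simp add: has_vector_derivative_def)
    show "\<forall>\<^sub>F n in sequentially. \<forall>x\<in>A. \<forall>h. norm ((\<Sum>i<n. h *\<^sub>R f' i x) - h *\<^sub>R (\<Sum>i. f' i x)) \<le> e * norm h"
      if "e > 0" for e
      using uniform_limitD[OF ul that]
    proof eventually_elim
      case (elim n)
      show ?case
      proof (intro ballI allI)
        fix x h assume "x \<in> A"
        with elim have "norm ((\<Sum>i<n. f' i x) - (\<Sum>i. f' i x)) \<le> e" by (auto simp: dist_norm intro: less_imp_le)
        from mult_left_mono[OF this, of "\<bar>h\<bar>"]
        show "norm ((\<Sum>i<n. h *\<^sub>R f' i x) - h *\<^sub>R (\<Sum>i. f' i x)) \<le> e * norm h"
          by (simp add: mult.commute flip: scaleR_sum_right scaleR_diff_right)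
      qed
    qed
    show "x \<in> A" by fact
    show "(\<lambda>n. f n x) sums (\<Sum>n. f n x)"
      by (rule summable_sums, rule summable_comparison_test'[OF assms(5)]) (use assms(3,6) in auto)
  qed
  then obtain g where g: "\<And>x. x \<in> A \<Longrightarrow> (\<lambda>n. f n x) sums (g x)"
    "\<And>x. x \<in> A \<Longrightarrow> (g has_derivative (\<lambda>h. h *\<^sub>R (\<Sum>i. f' i x))) (at x within A)" by blast
  show ?thesis
  proof (rule has_vector_derivative_transform[OF assms(6)])
    show "(g has_vector_derivative (\<Sum>k. f' k x)) (at x within A)"
      using g(2)[OF assms(6)] by (simp add: has_vector_derivative_def)
    show "(\<Sum>k. f k x) = g x" if "x \<in> A" for x using g(1)[OF that] by (simp add: sums_iff)
  qed
qed

section \<open>Iterated primitives and the power series solution in zeta\<close>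

definition primitive :: "(real \<Rightarrow> complex) \<Rightarrow> real \<Rightarrow> complex" where
  "primitive f x = integral {0..x} f"

lemma primitive_deriv:
  "continuous_on {0..1} f \<Longrightarrow> x \<in> {0..1} \<Longrightarrow> (primitive f has_vector_derivative f x) (at x within {0..1})"
  unfolding primitive_def by (rule integral_has_vector_derivative)

lemma primitive_continuous: "continuous_on {0..1} f \<Longrightarrow> continuous_on {0..1} (primitive f)"
  by (rule continuous_on_vector_derivative[OF primitive_deriv])

text \<open>Carrying the power of x along, rather than a constant, is what produces the factorial
  decay of the Picard iteration.\<close>

lemma primitive_bound:
  assumes "continuous_on {0..1} f" "\<And>x. x \<in> {0..1} \<Longrightarrow> cmod (f x) \<le> C * x ^ m / fact m" "x \<in> {0..1}"
  shows "cmod (primitive f x) \<le> C * x ^ Suc m / fact (Suc m)"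
proof -
  have "((\<lambda>x. C * x ^ m / fact m) has_integral (C * x ^ Suc m / fact (Suc m) - C * 0 ^ Suc m / fact (Suc m))) {0..x}"
  proof (rule fundamental_theorem_of_calculus)
    fix y :: real
    have "((\<lambda>x. C * x ^ Suc m / fact (Suc m)) has_real_derivative C * (real (Suc m) * y ^ m) / fact (Suc m)) (at y within {0..x})"
      by (auto intro!: derivative_eq_intros simp del: power_Suc fact_Suc)
    moreover have "C * (real (Suc m) * y ^ m) / fact (Suc m) = C * y ^ m / fact m"
      by (simp add: fact_Suc divide_simps)
    ultimately show "((\<lambda>x. C * x ^ Suc m / fact (Suc m)) has_vector_derivative C * y ^ m / fact m) (at y within {0..x})"
      by (simp add: has_real_derivative_iff_has_vector_derivative)
  qed (use assms in auto)
  then have I: "((\<lambda>x. C * x ^ m / fact m) has_integral C * x ^ Suc m / fact (Suc m)) {0..x}" by simp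
  have "cmod (integral {0..x} f) \<le> integral {0..x} (\<lambda>x. C * x ^ m / fact m)"
    using assms I by (intro integral_norm_bound_integral integrable_continuous_real continuous_on_subset[OF assms(1)])
      (auto intro!: continuous_intros)
  also have "\<dots> = C * x ^ Suc m / fact (Suc m)" by (rule integral_unique[OF I])
  finally show ?thesis by (simp only: primitive_def)
qed

lemma primitive_zero:
  assumes "\<And>x. x \<in> {0..\<epsilon>} \<Longrightarrow> f x = 0" "x \<le> \<epsilon>"
  shows "primitive f x = 0"
proof -
  have "(f has_integral 0) {0..x}" by (rule has_integral_is_0) (use assms in auto)
  then show ?thesis by (simp add: primitive_def integral_unique)
qed

lemma power_div_fact_antimono:
  assumes "k \<le> m" "(x::real) \<in> {0..1}"
  shows "x ^ m / fact m \<le> x ^ k / fact k"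
  using assms by (intro frac_le power_decreasing fact_mono) auto

text \<open>Let J denote integration from 0 and insert z = J J (sum of zeta^k R k) into z'' = phi +
  (zeta^2 + zeta c) z. Comparing powers of zeta gives exactly these equations, so the iterates are
  the Taylor coefficients in zeta of z''.\<close>

fun picard :: "(real \<Rightarrow> complex) \<Rightarrow> (real \<Rightarrow> real) \<Rightarrow> nat \<Rightarrow> real \<Rightarrow> complex" where
  "picard \<phi> c 0 = \<phi>"
| "picard \<phi> c (Suc 0) = (\<lambda>x. complex_of_real (c x) * primitive (primitive \<phi>) x)"
| "picard \<phi> c (Suc (Suc k)) = (\<lambda>x. primitive (primitive (picard \<phi> c k)) x
      + complex_of_real (c x) * primitive (primitive (picard \<phi> c (Suc k))) x)"

text \<open>An initial value problem in which x plays the role of time, with zero data at 0. The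
  coefficient c is bounded, in contrast to 2 alpha / x; phi vanishes up to \<epsilon>, and so will
  the solution.\<close>

locale sideways =
  fixes \<phi> :: "real \<Rightarrow> complex" and c :: "real \<Rightarrow> real" and c0 M \<epsilon> :: real
  assumes phi: "continuous_on {0..1} \<phi>" "\<And>x. x \<in> {0..1} \<Longrightarrow> cmod (\<phi> x) \<le> M"
    and c: "continuous_on {0..1} c" "\<And>x. x \<in> {0..1} \<Longrightarrow> 0 \<le> c x" "\<And>x. x \<in> {0..1} \<Longrightarrow> c x \<le> c0"
    and zero: "\<epsilon> \<le> 1" "\<And>x. x \<in> {0..\<epsilon>} \<Longrightarrow> \<phi> x = 0"
begin

abbreviation "R \<equiv> picard \<phi> c"
abbreviation "K \<equiv> c0 + 1"

lemma M_nonneg: "0 \<le> M" using phi(2)[of 0] by (auto intro: order_trans[OF norm_ge_zero])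
lemma c0_nonneg: "0 \<le> c0" using c(2,3)[of 0] by auto

lemma R_continuous: "continuous_on {0..1} (R k)"
proof (induction k rule: less_induct)
  case (less k)
  have J: "continuous_on {0..1} (primitive (primitive (R j)))" if "j < k" for j
    by (intro primitive_continuous less that)
  consider "k = 0" | "k = 1" | l where "k = Suc (Suc l)" by (metis One_nat_def nat.exhaust)
  then show ?case
  proof cases
    case 1 then show ?thesis using phi by simp
  next
    case 2 then show ?thesis using J[of 0] by (auto intro!: continuous_intros c)
  next
    case 3 then show ?thesis using J[of l] J[of "Suc l"] by (auto intro!: continuous_intros c)
  qed
qed

text \<open>The double primitive of R (k - 2) gains two powers of x for two indices, that of R (k -
  1) two powers for one, so the factorial keeps pace with k. Truncated subtraction covers k = 0 and
  k = 1, where no decay is claimed.\<close>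

lemma R_bound: "x \<in> {0..1} \<Longrightarrow> cmod (R k x) \<le> M * K ^ k * x ^ (k - 2) / fact (k - 2)"
proof (induction k arbitrary: x rule: less_induct)
  case (less k)
  have K: "0 \<le> K" "1 \<le> K" using c0_nonneg by auto
  have J: "cmod (primitive (primitive (R j)) y) \<le> M * K ^ j * (y ^ m / fact m)"
    if "j < k" "y \<in> {0..1}" "m \<le> Suc (Suc (j - 2))" for j y m
  proof -
    have "cmod (primitive (primitive (R j)) y) \<le> M * K ^ j * y ^ Suc (Suc (j - 2)) / fact (Suc (Suc (j - 2)))"
      by (intro primitive_bound primitive_continuous R_continuous less that)
    also have "\<dots> = M * K ^ j * (y ^ Suc (Suc (j - 2)) / fact (Suc (Suc (j - 2))))" by simp
    also have "\<dots> \<le> M * K ^ j * (y ^ m / fact m)"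
      by (intro mult_left_mono power_div_fact_antimono that mult_nonneg_nonneg M_nonneg zero_le_power K)
    finally show ?thesis .
  qed
  have cJ: "cmod (complex_of_real (c x) * primitive (primitive (R j)) x) \<le> c0 * (M * K ^ j * (x ^ m / fact m))"
    if "j < k" "m \<le> Suc (Suc (j - 2))" for j m
    unfolding norm_mult using c less.prems J[OF that(1) less.prems that(2)] c0_nonneg
    by (intro mult_mono) auto
  consider "k = 0" | "k = 1" | l where "k = Suc (Suc l)" by (metis One_nat_def nat.exhaust)
  then show ?case
  proof cases
    case 1 then show ?thesis using phi(2)[OF less.prems] by simp
  next
    case 2
    have "cmod (R k x) \<le> c0 * (M * K ^ 0 * (x ^ 0 / fact 0))" using cJ[of 0 0] 2 by simp
    also have "\<dots> \<le> M * K" using M_nonneg by (simp add: algebra_simps)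
    finally show ?thesis using 2 by simp
  next
    case 3
    let ?e = "x ^ l / fact l"
    have "cmod (R k x) \<le> M * K ^ l * ?e + c0 * (M * K ^ Suc l * ?e)"
      unfolding 3 picard.simps using J[of l x l] cJ[of "Suc l" l] 3 less.prems
      by (intro order_trans[OF norm_triangle_ineq] add_mono) auto
    also have "\<dots> = M * K ^ l * ?e * (1 + c0 * K)" by (simp add: ring_distribs mult_ac add_divide_distrib)
    \<comment> \<open>The base K = c0 + 1 is chosen so that 1 + c0 * K <= K^2.\<close>
    also have "\<dots> \<le> M * K ^ l * ?e * (K * K)"
      using c0_nonneg less.prems M_nonneg by (intro mult_left_mono) (auto simp: algebra_simps)
    finally show ?thesis using 3 by (simp add: divide_inverse mult_ac)
  qed
qed

text \<open>The value of \<open>R_bound\<close> at x = 1. Primitives only improve the bound, so this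
  one sequence dominates R and its first two primitives.\<close>

definition "majorant k = M * K ^ k / fact (k - 2)"

lemma majorant_summable: "summable (\<lambda>k. majorant k * r ^ k)"
proof -
  \<comment> \<open>Shifting the index by 2 removes the truncated subtraction and leaves an
    exponential series.\<close>
  have "summable (\<lambda>k. M * (K * r)\<^sup>2 * ((K * r) ^ k / fact k))"
    using summable_exp[of "K * r"] by (intro summable_mult) (simp add: divide_inverse mult.commute)
  then have "summable (\<lambda>k. majorant (k + 2) * r ^ (k + 2))"
    by (rule back_subst[of summable])
      (auto simp: majorant_def power_mult_distrib power_add power2_eq_square divide_inverse mult_ac)
  then show ?thesis by (subst (asm) summable_iff_shift)
qed

lemma bounds:
  assumes "x \<in> {0..1}"
  shows "cmod (R k x) \<le> majorant k" "cmod (primitive (R k) x) \<le> majorant k"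
    "cmod (primitive (primitive (R k)) x) \<le> majorant k"
proof -
  have *: "M * K ^ k * y ^ m / fact m \<le> majorant k" if "k - 2 \<le> m" "y \<in> {0..1}" for m y
  proof -
    have "M * K ^ k * (y ^ m / fact m) \<le> M * K ^ k * (1 ^ (k - 2) / fact (k - 2))"
      using that by (intro mult_left_mono mult_nonneg_nonneg M_nonneg frac_le power_mono fact_mono)
        (auto simp: c0_nonneg power_le_one)
    then show ?thesis by (simp add: majorant_def)
  qed
  note b = primitive_bound[OF R_continuous R_bound]
  show "cmod (R k x) \<le> majorant k" by (rule order_trans[OF R_bound[OF assms] *]) (use assms in auto)
  show "cmod (primitive (R k) x) \<le> majorant k" by (rule order_trans[OF b[OF _ assms] *]) (use assms in auto)
  show "cmod (primitive (primitive (R k)) x) \<le> majorant k"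
    by (rule order_trans[OF primitive_bound[OF primitive_continuous[OF R_continuous] b assms] *]) (use assms in auto)
qed

text \<open>Summing second primitives of the iterates builds in the zero value and the zero slope at
  0.\<close>

definition "sol \<zeta> x = (\<Sum>k. \<zeta> ^ k * primitive (primitive (R k)) x)"
definition "dsol \<zeta> x = (\<Sum>k. \<zeta> ^ k * primitive (R k) x)"

lemma term_bound:
  assumes "cmod y \<le> majorant k"
  shows "cmod (\<zeta> ^ k * y) \<le> majorant k * cmod \<zeta> ^ k"
  using mult_left_mono[OF assms, of "cmod \<zeta> ^ k"] by (simp add: norm_mult norm_power mult.commute)

lemma sol_deriv:
  assumes "x \<in> {0..1}"
  shows "(sol \<zeta> has_vector_derivative dsol \<zeta> x) (at x within {0..1})"
  unfolding sol_def dsol_def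
  by (rule series_has_vector_derivative[where b = "\<lambda>k. majorant k * cmod \<zeta> ^ k"])
    (rule convex_real_interval has_vector_derivative_mult_right primitive_deriv primitive_continuous R_continuous
      term_bound bounds majorant_summable assms | assumption)+

lemma sol_summable: "x \<in> {0..1} \<Longrightarrow> summable (\<lambda>k. \<zeta> ^ k * primitive (primitive (R k)) x)"
  by (rule summable_comparison_test'[OF majorant_summable[of "cmod \<zeta>"]]) (intro term_bound bounds)

text \<open>Termwise differentiation gives the sum of zeta^k R k; splitting off its first two terms
  and applying the recursion to the rest reassembles the right-hand side of the equation.\<close>

lemma dsol_deriv:
  assumes "x \<in> {0..1}"
  shows "(dsol \<zeta> has_vector_derivative \<phi> x + (\<zeta>\<^sup>2 + \<zeta> * c x) * sol \<zeta> x) (at x within {0..1})"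
proof -
  let ?Z = "\<lambda>k. primitive (primitive (R k)) x"
  have "(dsol \<zeta> has_vector_derivative (\<Sum>k. \<zeta> ^ k * R k x)) (at x within {0..1})"
    unfolding dsol_def
    by (rule series_has_vector_derivative[where b = "\<lambda>k. majorant k * cmod \<zeta> ^ k"])
      (rule convex_real_interval has_vector_derivative_mult_right primitive_deriv R_continuous
        term_bound bounds majorant_summable assms | assumption)+
  moreover have "(\<Sum>k. \<zeta> ^ k * R k x) = \<phi> x + (\<zeta>\<^sup>2 + \<zeta> * c x) * sol \<zeta> x"
  proof -
    have s: "summable (\<lambda>k. \<zeta> ^ k * ?Z k)" by (rule sol_summable[OF assms])
    have s1: "summable (\<lambda>k. \<zeta> ^ Suc k * ?Z (Suc k))" using s by (subst summable_Suc_iff)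
    have sR: "summable (\<lambda>k. \<zeta> ^ k * R k x)"
      by (rule summable_comparison_test'[OF majorant_summable[of "cmod \<zeta>"]]) (intro term_bound bounds assms)
    have "(\<Sum>k. \<zeta> ^ k * R k x) = (\<Sum>k. \<zeta> ^ (k + 2) * R (k + 2) x) + (\<Sum>k<2. \<zeta> ^ k * R k x)"
      by (rule suminf_split_initial_segment[OF sR])
    also have "(\<lambda>k. \<zeta> ^ (k + 2) * R (k + 2) x) = (\<lambda>k. \<zeta>\<^sup>2 * (\<zeta> ^ k * ?Z k) + \<zeta> * c x * (\<zeta> ^ Suc k * ?Z (Suc k)))"
      by (rule ext) (simp add: power2_eq_square algebra_simps)
    also have "suminf \<dots> = \<zeta>\<^sup>2 * sol \<zeta> x + \<zeta> * c x * (\<Sum>k. \<zeta> ^ Suc k * ?Z (Suc k))"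
      using suminf_add[OF summable_mult[OF s, of "\<zeta>\<^sup>2"] summable_mult[OF s1, of "\<zeta> * c x"]]
        suminf_mult[OF s, of "\<zeta>\<^sup>2"] suminf_mult[OF s1, of "\<zeta> * c x"] unfolding sol_def by metis
    also have "(\<Sum>k. \<zeta> ^ Suc k * ?Z (Suc k)) = sol \<zeta> x - ?Z 0"
      using suminf_split_head[OF s] by (simp add: sol_def)
    finally show ?thesis by (simp add: numeral_2_eq_2 algebra_simps)
  qed
  ultimately show ?thesis by simp
qed

lemma R_zero: "x \<in> {0..\<epsilon>} \<Longrightarrow> R k x = 0"
proof (induction k arbitrary: x rule: less_induct)
  case (less k)
  have J: "primitive (primitive (R j)) x = 0" if "j < k" for j
    by (rule primitive_zero[where \<epsilon> = \<epsilon>], rule primitive_zero[where \<epsilon> = \<epsilon>]) (use less that in auto)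
  consider "k = 0" | "k = 1" | l where "k = Suc (Suc l)" by (metis One_nat_def nat.exhaust)
  then show ?case
  proof cases
    case 1 then show ?thesis using zero less by simp
  next
    case 2 then show ?thesis using J[of 0] by simp
  next
    case 3 then show ?thesis using J[of l] J[of "Suc l"] by simp
  qed
qed

lemma sol_zero: 
  assumes "x \<in> {0..\<epsilon>}"
  shows "sol \<zeta> x = 0" "dsol \<zeta> x = 0"
proof -
  have "primitive (R k) y = 0" if "y \<le> \<epsilon>" for k y
    by (rule primitive_zero[where \<epsilon> = \<epsilon>]) (use R_zero that in auto)
  moreover have "primitive (primitive (R k)) x = 0" for k
    by (rule primitive_zero[where \<epsilon> = \<epsilon>], rule primitive_zero[where \<epsilon> = \<epsilon>]) (use R_zero assms in auto)
  ultimately show "sol \<zeta> x = 0" "dsol \<zeta> x = 0" using assms by (auto simp: sol_def dsol_def)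
qed

lemma sol_0: "sol \<zeta> 0 = 0" "dsol \<zeta> 0 = 0"
  by (simp_all add: sol_def dsol_def primitive_def)

text \<open>With A = z' + zeta z and B = z' - zeta z the principal part becomes A' = zeta A, B' =
  -zeta B, so only Re zeta survives in the derivative of |A|^2 + |B|^2. The damping contributes c
  (|A|^2 - |B|^2) without cross terms, c being real. The result is growth in |Re zeta| alone, which
  the majorant, depending on |zeta|, could not give.\<close>

lemma energy_bound:
  assumes "x \<in> {0..1}"
  shows "(cmod (dsol \<zeta> x + \<zeta> * sol \<zeta> x))\<^sup>2 + (cmod (dsol \<zeta> x - \<zeta> * sol \<zeta> x))\<^sup>2
    \<le> 2 * M\<^sup>2 * exp (2 * \<bar>Re \<zeta>\<bar> + c0 + 1)"
proof -
  define A where "A x = dsol \<zeta> x + \<zeta> * sol \<zeta> x" for x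
  define B where "B x = dsol \<zeta> x - \<zeta> * sol \<zeta> x" for x
  define A' where "A' x = \<phi> x + (\<zeta>\<^sup>2 + \<zeta> * c x) * sol \<zeta> x + \<zeta> * dsol \<zeta> x" for x
  define B' where "B' x = \<phi> x + (\<zeta>\<^sup>2 + \<zeta> * c x) * sol \<zeta> x - \<zeta> * dsol \<zeta> x" for x
  \<comment> \<open>2 |Re zeta| + c0 bounds |2 Re zeta + c|. The summand 1 pays for phi, through the
    inequality of arithmetic and geometric means applied to |y| and M.\<close>
  define k where "k = 2 * \<bar>Re \<zeta>\<bar> + c0 + 1"
  define N where "N x = A x \<bullet> A x + B x \<bullet> B x" for x
  define N' where "N' x = 2 * (A x \<bullet> A' x + B x \<bullet> B' x)" for x
  \<comment> \<open>Gronwall's argument as monotonicity: F is nondecreasing and F 0 = 0.\<close>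
  define F where "F x = 2 * M\<^sup>2 * x - exp (- (k * x)) * N x" for x
  have A_deriv: "(A has_vector_derivative A' x) (at x within {0..1})"
    and B_deriv: "(B has_vector_derivative B' x) (at x within {0..1})" if "x \<in> {0..1}" for x
    unfolding A_def A'_def B_def B'_def using sol_deriv[OF that] dsol_deriv[OF that]
    by (auto intro!: has_vector_derivative_add has_vector_derivative_diff has_vector_derivative_mult_right)
  have N_deriv: "(N has_real_derivative N' x) (at x within {0..1})" if "x \<in> {0..1}" for x
  proof -
    have "(N has_derivative (\<lambda>h. (A x \<bullet> (h *\<^sub>R A' x) + (h *\<^sub>R A' x) \<bullet> A x) + (B x \<bullet> (h *\<^sub>R B' x) + (h *\<^sub>R B' x) \<bullet> B x))) (at x within {0..1})"
      unfolding N_def using A_deriv[OF that] B_deriv[OF that]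
      by (intro has_derivative_add has_derivative_inner) (simp_all add: has_vector_derivative_def)
    then show ?thesis
      unfolding has_field_derivative_def
      by (rule has_derivative_eq_rhs) (auto simp: N'_def inner_commute algebra_simps)
  qed
  have N_growth: "N' x \<le> k * N x + 2 * M\<^sup>2" if x: "x \<in> {0..1}" for x
  proof -
    let ?a = "A x" and ?b = "B x" and ?f = "\<phi> x" and ?c = "complex_of_real (c x)"
    have zs: "\<zeta> * sol \<zeta> x = (?a - ?b) / 2" "dsol \<zeta> x = (?a + ?b) / 2" by (simp_all add: A_def B_def)
    have A'_eq: "A' x = \<zeta> * ?a + (?c / 2) * (?a - ?b) + ?f"
    proof -
      have "A' x = ?f + \<zeta> * (\<zeta> * sol \<zeta> x) + ?c * (\<zeta> * sol \<zeta> x) + \<zeta> * dsol \<zeta> x"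
        by (simp add: A'_def power2_eq_square algebra_simps)
      also have "\<dots> = \<zeta> * ?a + (?c / 2) * (?a - ?b) + ?f" unfolding zs by (simp add: field_simps)
      finally show ?thesis .
    qed
    have B'_eq: "B' x = - \<zeta> * ?b + (?c / 2) * (?a - ?b) + ?f"
    proof -
      have "B' x = ?f + \<zeta> * (\<zeta> * sol \<zeta> x) + ?c * (\<zeta> * sol \<zeta> x) - \<zeta> * dsol \<zeta> x"
        by (simp add: B'_def power2_eq_square algebra_simps)
      also have "\<dots> = - \<zeta> * ?b + (?c / 2) * (?a - ?b) + ?f" unfolding zs by (simp add: field_simps)
      finally show ?thesis .
    qed
    have "N' x = (2 * Re \<zeta> + c x) * (?a \<bullet> ?a - ?b \<bullet> ?b) + 2 * (?a \<bullet> ?f) + 2 * (?b \<bullet> ?f)"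
      unfolding N'_def A'_eq B'_eq inner_complex_def by (simp add: field_simps)
    also have "\<dots> \<le> (2 * \<bar>Re \<zeta>\<bar> + c0) * N x + (?a \<bullet> ?a + M\<^sup>2) + (?b \<bullet> ?b + M\<^sup>2)"
    proof (intro add_mono)
      have "\<bar>?a \<bullet> ?a - ?b \<bullet> ?b\<bar> \<le> N x" unfolding N_def using inner_ge_zero[of ?a] inner_ge_zero[of ?b] by linarith
      moreover have "\<bar>2 * Re \<zeta> + c x\<bar> \<le> 2 * \<bar>Re \<zeta>\<bar> + c0" using c(2,3)[OF x] by linarith
      ultimately have "\<bar>2 * Re \<zeta> + c x\<bar> * \<bar>?a \<bullet> ?a - ?b \<bullet> ?b\<bar> \<le> (2 * \<bar>Re \<zeta>\<bar> + c0) * N x"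
        by (intro mult_mono) auto
      then show "(2 * Re \<zeta> + c x) * (?a \<bullet> ?a - ?b \<bullet> ?b) \<le> (2 * \<bar>Re \<zeta>\<bar> + c0) * N x"
        unfolding abs_mult[symmetric] by linarith
      have *: "2 * (y \<bullet> ?f) \<le> y \<bullet> y + M\<^sup>2" for y
      proof -
        have "2 * (y \<bullet> ?f) \<le> 2 * (cmod y * M)"
          using norm_cauchy_schwarz[of y ?f] mult_left_mono[OF phi(2)[OF x], of "cmod y"] by simp
        also have "\<dots> \<le> (cmod y)\<^sup>2 + M\<^sup>2" using sum_squares_bound[of "cmod y" M] by (simp add: mult.assoc)
        finally show ?thesis by (simp add: power2_norm_eq_inner)
      qed
      show "2 * (?a \<bullet> ?f) \<le> ?a \<bullet> ?a + M\<^sup>2" "2 * (?b \<bullet> ?f) \<le> ?b \<bullet> ?b + M\<^sup>2" by (rule *)+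
    qed
    also have "\<dots> = k * N x + 2 * M\<^sup>2" by (simp add: N_def k_def algebra_simps)
    finally show ?thesis .
  qed
  define F' where "F' x = 2 * M\<^sup>2 - (exp (- (k * x)) * N' x + (exp (- (k * x)) * - k) * N x)" for x
  have F_deriv: "(F has_real_derivative F' x) (at x within {0..1})" if "x \<in> {0..1}" for x
    unfolding F_def F'_def by (auto intro!: derivative_eq_intros N_deriv[OF that])
  have k: "0 \<le> k" using c0_nonneg by (simp add: k_def)
  have F_nonneg: "0 \<le> F' x" if x: "x \<in> {0..1}" for x
  proof -
    have e1: "exp (- (k * x)) \<le> 1" using x k by simp
    have "exp (- (k * x)) * N' x + (exp (- (k * x)) * - k) * N x
        = exp (- (k * x)) * (N' x - k * N x)" by (simp add: algebra_simps)
    also have "\<dots> \<le> exp (- (k * x)) * (2 * M\<^sup>2)"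
      using N_growth[OF x] by (intro mult_left_mono) auto
    also have "\<dots> \<le> 1 * (2 * M\<^sup>2)" by (intro mult_right_mono e1) simp
    finally show ?thesis by (simp add: F'_def)
  qed
  have "(F' has_integral (F x - F 0)) {0..x}"
  proof (rule fundamental_theorem_of_calculus)
    fix y assume "y \<in> {0..x}"
    then have "y \<in> {0..1}" "{0..x} \<subseteq> {0..1}" using assms by auto
    then show "(F has_vector_derivative F' y) (at y within {0..x})"
      using DERIV_subset[OF F_deriv] by (simp only: has_real_derivative_iff_has_vector_derivative[symmetric])
  qed (use assms in auto)
  from has_integral_nonneg[OF this F_nonneg] assms have "F 0 \<le> F x" by auto
  moreover have "F 0 = 0" by (simp add: F_def N_def A_def B_def sol_0)
  ultimately have "exp (- (k * x)) * N x \<le> 2 * M\<^sup>2 * x" by (simp add: F_def)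
  also have "\<dots> \<le> 2 * M\<^sup>2" using assms by (simp add: mult_left_le)
  finally have "exp (k * x) * (exp (- (k * x)) * N x) \<le> exp (k * x) * (2 * M\<^sup>2)" by (intro mult_left_mono) auto
  then have "N x \<le> exp (k * x) * (2 * M\<^sup>2)" by (simp add: mult.assoc[symmetric] exp_add[symmetric])
  also have "\<dots> \<le> exp k * (2 * M\<^sup>2)"
    using assms k by (intro mult_right_mono) (auto simp: mult_left_le)
  finally show ?thesis
    by (simp add: N_def A_def B_def power2_norm_eq_inner mult.commute add.assoc k_def)
qed

definition "growth = M * exp ((c0 + 1) / 2)"

lemma growth_nonneg: "0 \<le> growth" by (simp add: growth_def M_nonneg)

text \<open>The square of the mean is at most the mean of the squares. \<open>growth\<close> is the
  square root of what the energy bound leaves after exp (2 |r|) has been split off.\<close>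

lemma half_sum_bound:
  assumes "(cmod a)\<^sup>2 + (cmod b)\<^sup>2 \<le> 2 * M\<^sup>2 * exp (2 * \<bar>r\<bar> + c0 + 1)"
  shows "(cmod a + cmod b) / 2 \<le> growth * exp \<bar>r\<bar>"
proof (rule power2_le_imp_le)
  have "((cmod a + cmod b) / 2)\<^sup>2 \<le> ((cmod a)\<^sup>2 + (cmod b)\<^sup>2) / 2"
    using sum_squares_bound[of "cmod a" "cmod b"] by (simp add: power2_eq_square field_simps)
  also have "\<dots> \<le> M\<^sup>2 * exp (2 * \<bar>r\<bar> + c0 + 1)" using assms by simp
  also have "\<dots> = (growth * exp \<bar>r\<bar>)\<^sup>2"
    by (simp add: growth_def power_mult_distrib exp_double[symmetric] mult_exp_exp)
  finally show "((cmod a + cmod b) / 2)\<^sup>2 \<le> (growth * exp \<bar>r\<bar>)\<^sup>2" .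
qed (simp add: growth_nonneg)

lemma dsol_bound:
  assumes "x \<in> {0..1}"
  shows "cmod (dsol \<zeta> x) \<le> growth * exp \<bar>Re \<zeta>\<bar>"
proof -
  let ?a = "dsol \<zeta> x + \<zeta> * sol \<zeta> x" and ?b = "dsol \<zeta> x - \<zeta> * sol \<zeta> x"
  have "cmod (?a + ?b) \<le> cmod ?a + cmod ?b" by (rule norm_triangle_ineq)
  moreover have "cmod (?a + ?b) = 2 * cmod (dsol \<zeta> x)" by (simp add: norm_mult flip: mult_2)
  ultimately have "cmod (dsol \<zeta> x) \<le> (cmod ?a + cmod ?b) / 2" by simp
  also note half_sum_bound[OF energy_bound[OF assms]]
  finally show ?thesis .
qed

lemma zeta_sol_bound:
  assumes "x \<in> {0..1}"
  shows "cmod (\<zeta> * sol \<zeta> x) \<le> growth * exp \<bar>Re \<zeta>\<bar>"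
proof -
  let ?a = "dsol \<zeta> x + \<zeta> * sol \<zeta> x" and ?b = "dsol \<zeta> x - \<zeta> * sol \<zeta> x"
  have "cmod (?a - ?b) \<le> cmod ?a + cmod ?b" by (rule norm_triangle_ineq4)
  moreover have "cmod (?a - ?b) = 2 * cmod (\<zeta> * sol \<zeta> x)" by (simp add: norm_mult flip: mult_2)
  ultimately have "cmod (\<zeta> * sol \<zeta> x) \<le> (cmod ?a + cmod ?b) / 2" by simp
  also note half_sum_bound[OF energy_bound[OF assms]]
  finally show ?thesis .
qed

text \<open>\<open>zeta_sol_bound\<close> is of no use near zeta = 0, so the bound on
  \<open>dsol\<close> is integrated over the unit interval instead.\<close>

lemma sol_1_bound: "cmod (sol \<zeta> 1) \<le> growth * exp \<bar>Re \<zeta>\<bar>"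
proof -
  have "(dsol \<zeta> has_integral (sol \<zeta> 1 - sol \<zeta> 0)) {0..1}"
    by (rule fundamental_theorem_of_calculus) (auto intro!: sol_deriv)
  from has_integral_bound_real[OF _ _ this, of "growth * exp \<bar>Re \<zeta>\<bar>" "{}"]
  show ?thesis using dsol_bound growth_nonneg by (force simp: sol_0)
qed

lemma primitive_measurable: "primitive (R k) \<in> borel_measurable unit_itv"
  "primitive (primitive (R k)) \<in> borel_measurable unit_itv"
  by (intro L2_measurable L2_continuous primitive_continuous R_continuous)+

lemma entire_dsol: "integrable unit_itv g \<Longrightarrow> (\<lambda>\<zeta>. LINT x|unit_itv. g x * dsol \<zeta> x) holomorphic_on UNIV"
  unfolding dsol_def
  by (rule entire_integral[where b = majorant]) (auto intro: bounds majorant_summable primitive_measurable)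

lemma entire_sol: "integrable unit_itv g \<Longrightarrow> (\<lambda>\<zeta>. LINT x|unit_itv. g x * sol \<zeta> x) holomorphic_on UNIV"
  unfolding sol_def
  by (rule entire_integral[where b = majorant]) (auto intro: bounds majorant_summable primitive_measurable)

lemma entire_sol_1: "(\<lambda>\<zeta>. sol \<zeta> 1) holomorphic_on UNIV"
  unfolding sol_def by (rule entire_series[where b = majorant]) (auto intro: bounds majorant_summable)

end

section \<open>The regular solution and the Laguerre polynomial\<close>


text \<open>The polynomial s -> L_n^(1)(-2 s) over the complex numbers; the sign (-1)^j of the
  Laguerre coefficients is absorbed by the argument.\<close>

definition laguerre_poly :: "nat \<Rightarrow> complex poly" where
  "laguerre_poly n = (\<Sum>j\<le>n. monom (of_nat ((n + 1) choose (n - j)) * 2 ^ j / fact j) j)"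

lemma coeff_laguerre_poly:
  "coeff (laguerre_poly n) j = (if j \<le> n then of_nat ((n + 1) choose (n - j)) * 2 ^ j / fact j else 0)"
  by (simp add: laguerre_poly_def coeff_sum)

lemma poly_laguerre_poly:
  "poly (laguerre_poly n) (complex_of_real x) = complex_of_real (laguerre1 n (- 2 * x))"
  by (simp add: laguerre_poly_def laguerre1_def poly_sum poly_monom power_mult_distrib atMost_atLeast0 algebra_simps)

lemma degree_laguerre_poly: "degree (laguerre_poly n) = n"
proof (rule antisym)
  show "degree (laguerre_poly n) \<le> n" by (rule degree_le) (simp add: coeff_laguerre_poly)
  show "n \<le> degree (laguerre_poly n)" by (rule le_degree) (simp add: coeff_laguerre_poly)
qed

text \<open>Neighbouring binomials are compared by the absorption identities; at m = n the factor n
  - m vanishes together with the next coefficient.\<close>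

lemma laguerre_poly_coeff_rec:
  "of_nat (m + 1) * of_nat (m + 2) * coeff (laguerre_poly n) (m + 1) = 2 * (of_nat n - of_nat m) * coeff (laguerre_poly n) m"
proof -
  consider "m < n" | "m = n" | "n < m" by linarith
  then show ?thesis
  proof cases
    case 1
    define j where "j = n - (m + 1)"
    have n: "n = m + 1 + j" using 1 by (simp add: j_def)
    have "(Suc n choose Suc j) * Suc j = (Suc n choose j) * (Suc n - j)"
      by (metis binomial_absorb_comp binomial_absorption mult.commute)
    then have "of_nat ((n + 1) choose (n - m)) * (of_nat (Suc j) :: complex) = of_nat ((n + 1) choose (n - (m + 1))) * of_nat (m + 2)"
      unfolding of_nat_mult[symmetric] by (simp add: n)
    moreover have "of_nat (Suc j) = (of_nat n - of_nat m :: complex)" by (simp add: n)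
    ultimately have *: "of_nat ((n + 1) choose (n - m)) * (of_nat n - of_nat m :: complex) = of_nat ((n + 1) choose (n - (m + 1))) * of_nat (m + 2)"
      by simp
    have "of_nat (m + 1) * of_nat (m + 2) * coeff (laguerre_poly n) (m + 1)
        = (of_nat ((n + 1) choose (n - (m + 1))) * of_nat (m + 2)) * (2 * 2 ^ m / fact m)"
      using 1 by (simp add: coeff_laguerre_poly field_simps del: of_nat_Suc of_nat_add)
    also have "\<dots> = 2 * (of_nat n - of_nat m) * coeff (laguerre_poly n) m"
      using 1 unfolding *[symmetric] by (simp add: coeff_laguerre_poly)
    finally show ?thesis .
  qed (simp_all add: coeff_laguerre_poly)
qed

text \<open>Laguerre's differential equation with parameter 1, transported to the argument -2 s;
  coefficient by coefficient it is the recurrence.\<close>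

lemma laguerre_poly_ode:
  "s * poly (pderiv (pderiv (laguerre_poly n))) s + 2 * poly (pderiv (laguerre_poly n)) s
    + 2 * s * poly (pderiv (laguerre_poly n)) s = 2 * of_nat n * poly (laguerre_poly n) s"
proof -
  let ?p = "laguerre_poly n"
  have "pCons 0 (pderiv (pderiv ?p)) + smult 2 (pderiv ?p) + smult 2 (pCons 0 (pderiv ?p)) = smult (2 * of_nat n) ?p"
  proof (rule poly_eqI)
    fix m
    have "of_nat m * (of_nat (m + 1) * coeff ?p (m + 1)) + 2 * (of_nat (m + 1) * coeff ?p (m + 1)) + 2 * (of_nat m * coeff ?p m)
       = of_nat (m + 1) * of_nat (m + 2) * coeff ?p (m + 1) + 2 * of_nat m * coeff ?p m"
      by (simp add: algebra_simps)
    also have "\<dots> = 2 * of_nat n * coeff ?p m"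
      unfolding laguerre_poly_coeff_rec by (simp add: algebra_simps)
    finally show "coeff (pCons 0 (pderiv (pderiv ?p)) + smult 2 (pderiv ?p) + smult 2 (pCons 0 (pderiv ?p))) m
        = coeff (smult (2 * of_nat n) ?p) m"
      by (cases m) (simp_all add: coeff_pderiv algebra_simps)
  qed
  then have "poly (pCons 0 (pderiv (pderiv ?p)) + smult 2 (pderiv ?p) + smult 2 (pCons 0 (pderiv ?p))) s = poly (smult (2 * of_nat n) ?p) s"
    by simp
  then show ?thesis by (simp add: mult.assoc mult.left_commute)
qed

section \<open>Exponential polynomials and the regular solution\<close>

definition exp_poly :: "complex poly \<Rightarrow> complex \<Rightarrow> real \<Rightarrow> complex" where
  "exp_poly q \<zeta> x = exp (\<zeta> * of_real x) * poly q (\<zeta> * of_real x)"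

lemma exp_poly_deriv:
  "(exp_poly q \<zeta> has_vector_derivative \<zeta> * exp_poly (q + pderiv q) \<zeta> x) (at x within A)"
proof -
  have "((\<lambda>z. exp (\<zeta> * z) * poly q (\<zeta> * z)) has_field_derivative
      \<zeta> * (exp (\<zeta> * of_real x) * (poly q (\<zeta> * of_real x) + poly (pderiv q) (\<zeta> * of_real x)))) (at (of_real x))"
    by (auto intro!: derivative_eq_intros simp: algebra_simps)
  from has_vector_derivative_real_field[OF this]
  have "(exp_poly q \<zeta> has_vector_derivative \<zeta> * exp_poly (q + pderiv q) \<zeta> x) (at x)"
    by (simp add: exp_poly_def[abs_def])
  then show ?thesis by (rule has_vector_derivative_at_within)
qed

lemma exp_poly_continuous: "continuous_on A (exp_poly q \<zeta>)"
  unfolding exp_poly_def[abs_def] by (intro continuous_intros)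

text \<open>With the normalisation exp (-zeta) the exponent becomes -zeta (1 - x), whose real part
  is at most |Re zeta|; for |zeta| >= 1 all powers up to d are absorbed into |zeta|^d.\<close>

lemma exp_poly_bound:
  assumes "degree q \<le> d"
  obtains C where "0 \<le> C" "\<And>\<zeta> x. 1 \<le> cmod \<zeta> \<Longrightarrow> x \<in> {0..1} \<Longrightarrow>
    cmod (exp (- \<zeta>) * exp_poly q \<zeta> x) \<le> C * cmod \<zeta> ^ d * exp \<bar>Re \<zeta>\<bar>"
proof -
  let ?C = "\<Sum>i\<le>degree q. cmod (coeff q i)"
  show ?thesis
  proof (rule that[of ?C])
    show "0 \<le> ?C" by (intro sum_nonneg) simp
    fix \<zeta> :: complex and x :: real assume z: "1 \<le> cmod \<zeta>" and x: "x \<in> {0..1}"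
    have "cmod (poly q (\<zeta> * of_real x)) \<le> (\<Sum>i\<le>degree q. cmod (coeff q i) * cmod \<zeta> ^ d)"
      unfolding poly_altdef
    proof (rule sum_norm_le)
      fix i assume "i \<in> {..degree q}"
      moreover have "cmod \<zeta> * \<bar>x\<bar> \<le> cmod \<zeta> * 1" using x by (intro mult_left_mono) auto
      ultimately have "(cmod \<zeta> * \<bar>x\<bar>) ^ i \<le> (cmod \<zeta> * 1) ^ i" "cmod \<zeta> ^ i \<le> cmod \<zeta> ^ d"
        using z assms by (intro power_mono power_increasing; simp)+
      then have "(cmod \<zeta> * \<bar>x\<bar>) ^ i \<le> cmod \<zeta> ^ d" by simp
      then show "cmod (coeff q i * (\<zeta> * of_real x) ^ i) \<le> cmod (coeff q i) * cmod \<zeta> ^ d"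
        by (simp add: norm_mult norm_power mult_left_mono)
    qed
    also have "\<dots> = ?C * cmod \<zeta> ^ d" by (simp add: sum_distrib_right)
    finally have 1: "cmod (poly q (\<zeta> * of_real x)) \<le> ?C * cmod \<zeta> ^ d" .
    have "- Re \<zeta> + Re \<zeta> * x = - Re \<zeta> * (1 - x)" by (simp add: algebra_simps)
    also have "\<dots> \<le> \<bar>Re \<zeta>\<bar> * 1" by (rule order_trans[OF abs_ge_self]) (use x in \<open>simp add: abs_mult mult_left_le\<close>)
    finally have 2: "cmod (exp (- \<zeta>) * exp (\<zeta> * of_real x)) \<le> exp \<bar>Re \<zeta>\<bar>"
      by (simp add: mult_exp_exp)
    have "cmod (exp (- \<zeta>) * exp_poly q \<zeta> x) = cmod (exp (- \<zeta>) * exp (\<zeta> * of_real x)) * cmod (poly q (\<zeta> * of_real x))"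
      by (simp add: exp_poly_def norm_mult)
    also have "\<dots> \<le> exp \<bar>Re \<zeta>\<bar> * (?C * cmod \<zeta> ^ d)" by (intro mult_mono 1 2) auto
    finally show "cmod (exp (- \<zeta>) * exp_poly q \<zeta> x) \<le> ?C * cmod \<zeta> ^ d * exp \<bar>Re \<zeta>\<bar>" by (simp add: mult_ac)
  qed
qed

text \<open>Expanding q reduces the claim to integrals of g x^k against exp (zeta x).\<close>

lemma entire_exp_poly:
  assumes "integrable unit_itv g"
  shows "(\<lambda>\<zeta>. LINT x|unit_itv. g x * exp_poly q \<zeta> x) holomorphic_on UNIV"
proof -
  have id: "(\<lambda>x::real. x) \<in> borel_measurable unit_itv"
    by (rule measurable_unit_itv_continuous) (auto intro!: continuous_intros)
  have i: "integrable unit_itv (\<lambda>x. g x * h x)" if h: "continuous_on {0..1} h" for h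
  proof -
    obtain B where B: "0 < B" "\<And>x. 0 \<le> x \<Longrightarrow> x \<le> 1 \<Longrightarrow> cmod (h x) \<le> B"
      by (rule continuous_01_bounded[OF h]) simp
    have meas: "h \<in> borel_measurable unit_itv" by (rule L2_measurable[OF L2_continuous[OF h]])
    show ?thesis
    proof (rule Bochner_Integration.integrable_bound)
      show "integrable unit_itv (\<lambda>x. complex_of_real B * g x)" using assms by simp
      show "(\<lambda>x. g x * h x) \<in> borel_measurable unit_itv" using meas assms by measurable
      show "AE x in unit_itv. norm (g x * h x) \<le> norm (complex_of_real B * g x)"
      proof (rule AE_unit_itv_I)
        fix x :: real assume "0 < x" "x < 1"
        then have "cmod (h x) * cmod (g x) \<le> B * cmod (g x)" by (intro mult_right_mono B) auto
        then show "norm (g x * h x) \<le> norm (complex_of_real B * g x)"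
          using B(1) by (simp add: norm_mult mult.commute)
      qed
    qed
  qed
  have ig: "integrable unit_itv (\<lambda>x. g x * of_real x ^ k)" for k by (intro i continuous_intros)
  have "(\<lambda>\<zeta>. \<Sum>k\<le>degree q. coeff q k * \<zeta> ^ k * (LINT x|unit_itv. (g x * of_real x ^ k) * exp (\<zeta> * complex_of_real x))) holomorphic_on UNIV"
    by (intro holomorphic_intros entire_integral_exp[OF ig id, of 1]) auto
  also have "(\<lambda>\<zeta>. \<Sum>k\<le>degree q. coeff q k * \<zeta> ^ k * (LINT x|unit_itv. (g x * of_real x ^ k) * exp (\<zeta> * complex_of_real x)))
      = (\<lambda>\<zeta>. LINT x|unit_itv. g x * exp_poly q \<zeta> x)"
  proof
    fix \<zeta>
    have ii: "integrable unit_itv (\<lambda>x. (g x * of_real x ^ k) * exp (\<zeta> * complex_of_real x))" for k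
      unfolding mult.assoc by (intro i continuous_intros)
    have "(\<Sum>k\<le>degree q. coeff q k * \<zeta> ^ k * (LINT x|unit_itv. (g x * of_real x ^ k) * exp (\<zeta> * complex_of_real x)))
        = (\<Sum>k\<le>degree q. (LINT x|unit_itv. coeff q k * \<zeta> ^ k * ((g x * of_real x ^ k) * exp (\<zeta> * complex_of_real x))))"
      by simp
    also have "\<dots> = (LINT x|unit_itv. (\<Sum>k\<le>degree q. coeff q k * \<zeta> ^ k * ((g x * of_real x ^ k) * exp (\<zeta> * complex_of_real x))))"
      by (rule Bochner_Integration.integral_sum[symmetric]) (intro integrable_mult_right ii)
    also have "\<dots> = (LINT x|unit_itv. g x * exp_poly q \<zeta> x)"
      by (rule Bochner_Integration.integral_cong)
        (simp_all add: exp_poly_def poly_altdef sum_distrib_left power_mult_distrib mult_ac)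
    finally show "(\<Sum>k\<le>degree q. coeff q k * \<zeta> ^ k * (LINT x|unit_itv. (g x * of_real x ^ k) * exp (\<zeta> * complex_of_real x)))
      = (LINT x|unit_itv. g x * exp_poly q \<zeta> x)" .
  qed
  finally show ?thesis .
qed

text \<open>The solution of z'' = (zeta^2 + 2 (n + 1) zeta / x) z that vanishes at 0. For real zeta
  = m it is \<open>fk n m\<close>.\<close>

definition regular_sol :: "nat \<Rightarrow> complex \<Rightarrow> real \<Rightarrow> complex" where
  "regular_sol n \<zeta> x = of_real x * exp_poly (laguerre_poly n) \<zeta> x"

text \<open>With p = \<open>laguerre_poly n\<close>, the derivative of s exp(s) p(s) is exp(s) times
  this polynomial; s = zeta x gives the derivative of \<open>regular_sol\<close>.\<close>

definition regular_sol_poly :: "nat \<Rightarrow> complex poly" where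
  "regular_sol_poly n = laguerre_poly n + pCons 0 (laguerre_poly n + pderiv (laguerre_poly n))"

lemma zeta_regular_sol: "\<zeta> * regular_sol n \<zeta> x = exp_poly (pCons 0 (laguerre_poly n)) \<zeta> x"
  by (simp add: regular_sol_def exp_poly_def)

lemma regular_sol_deriv:
  "(regular_sol n \<zeta> has_vector_derivative exp_poly (regular_sol_poly n) \<zeta> x) (at x within A)"
proof -
  let ?p = "laguerre_poly n"
  have "((\<lambda>x. complex_of_real x) has_vector_derivative of_real 1) (at x within A)"
    by (intro has_vector_derivative_of_real derivative_intros)
  from has_vector_derivative_mult[OF this exp_poly_deriv]
  have "(regular_sol n \<zeta> has_vector_derivative of_real x * (\<zeta> * exp_poly (?p + pderiv ?p) \<zeta> x) + of_real 1 * exp_poly ?p \<zeta> x) (at x within A)"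
    by (simp add: regular_sol_def[abs_def])
  then show ?thesis by (simp add: exp_poly_def regular_sol_poly_def algebra_simps)
qed

text \<open>Collecting terms leaves s p'' + 2 p' + 2 s p', which Laguerre's equation turns into 2 n
  p. With the term 2 p already present this makes the factor 2 (n + 1), that is, 2 alpha.\<close>

lemma regular_sol_ode:
  assumes "x \<noteq> 0"
  shows "(exp_poly (regular_sol_poly n) \<zeta> has_vector_derivative
    (\<zeta>\<^sup>2 + \<zeta> * of_real (2 * (real n + 1) / x)) * regular_sol n \<zeta> x) (at x within A)"
proof -
  let ?p = "laguerre_poly n" and ?s = "\<zeta> * complex_of_real x"
  have "\<zeta> * exp_poly (regular_sol_poly n + pderiv (regular_sol_poly n)) \<zeta> x
      = \<zeta> * exp ?s * ((?s * poly (pderiv (pderiv ?p)) ?s + 2 * poly (pderiv ?p) ?s + 2 * ?s * poly (pderiv ?p) ?s)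
          + 2 * poly ?p ?s + ?s * poly ?p ?s)"
    by (simp add: exp_poly_def regular_sol_poly_def pderiv_add pderiv_pCons algebra_simps)
  also have "\<dots> = \<zeta> * exp ?s * ((2 * (of_nat n + 1) + ?s) * poly ?p ?s)"
    unfolding laguerre_poly_ode by (simp add: algebra_simps)
  also have "\<dots> = (\<zeta>\<^sup>2 + \<zeta> * of_real (2 * (real n + 1) / x)) * regular_sol n \<zeta> x"
    using assms by (simp add: regular_sol_def exp_poly_def power2_eq_square field_simps)
  finally show ?thesis using exp_poly_deriv[of "regular_sol_poly n" \<zeta> x A] by simp
qed

lemma degree_regular_sol_poly: "degree (regular_sol_poly n) \<le> n + 1"
  unfolding regular_sol_poly_def
  by (intro degree_add_le order_trans[OF degree_pCons_le])
    (simp_all add: degree_laguerre_poly degree_add_le degree_pderiv)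

section \<open>Splitting off distinct zeros of polynomials and entire functions\<close>

lemma poly_distinct_roots:
  fixes p :: "'a::field poly"
  assumes "finite A" "\<And>a. a \<in> A \<Longrightarrow> poly p a = 0"
  shows "\<exists>q. p = (\<Prod>a\<in>A. [:- a, 1:]) * q"
  using assms
proof (induction A arbitrary: p rule: finite_induct)
  case (insert a A)
  then obtain q where q: "p = (\<Prod>a\<in>A. [:- a, 1:]) * q" by blast
  have "poly (\<Prod>a\<in>A. [:- a, 1:]) a \<noteq> 0" using insert(1,2) by (auto simp: poly_prod)
  then have "poly q a = 0" using insert(4)[of a] q by simp
  then obtain r where r: "q = [:- a, 1:] * r" unfolding poly_eq_0_iff_dvd dvd_def by blast
  show ?case by (rule exI[of _ r]) (simp only: q r prod.insert[OF insert(1,2)] mult_ac)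
qed simp

text \<open>n distinct roots use up the whole degree, so the cofactor is a constant and A contains
  every complex root.\<close>

lemma laguerre_poly_factorization:
  assumes "finite A" "card A = n" "\<And>a. a \<in> A \<Longrightarrow> poly (laguerre_poly n) a = 0"
  obtains k where "k \<noteq> 0" "\<And>s. poly (laguerre_poly n) s = k * (\<Prod>a\<in>A. s - a)"
proof -
  obtain q where q: "laguerre_poly n = (\<Prod>a\<in>A. [:- a, 1:]) * q" using poly_distinct_roots assms by metis
  have "coeff (laguerre_poly n) n \<noteq> 0" by (simp add: coeff_laguerre_poly)
  then have nz: "laguerre_poly n \<noteq> 0" by auto
  then have q0: "q \<noteq> 0" "(\<Prod>a\<in>A. [:- a, 1:]) \<noteq> 0" using q by auto
  have "degree (\<Prod>a\<in>A. [:- a, 1:]) = n" using assms(1,2) by (subst degree_prod_eq_sum_degree) auto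
  then have "degree q = 0" using degree_mult_eq[OF q0(2,1)] q degree_laguerre_poly[of n] by simp
  then obtain k where k: "q = [:k:]" by (metis degree_eq_zeroE)
  show ?thesis
  proof (rule that[of k])
    show "k \<noteq> 0" using q0 k by auto
    show "poly (laguerre_poly n) s = k * (\<Prod>a\<in>A. s - a)" for s unfolding q k by (simp add: poly_prod)
  qed
qed

text \<open>Zeros are removed one at a time. As they are distinct, the factors already removed do
  not vanish at the next one, so the quotient does.\<close>

lemma entire_divide_roots:
  assumes "finite A" "f holomorphic_on UNIV" "\<And>a. a \<in> A \<Longrightarrow> f a = 0"
  shows "\<exists>g. g holomorphic_on UNIV \<and> (\<forall>z. f z = (\<Prod>a\<in>A. z - a) * g z)"
  using assms
proof (induction A rule: finite_induct)
  case (insert a A)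
  then obtain g where g: "g holomorphic_on UNIV" "\<And>z. f z = (\<Prod>a\<in>A. z - a) * g z" by blast
  have "(\<Prod>b\<in>A. a - b) \<noteq> 0" using insert(1,2) by auto
  then have "g a = 0" using insert(5)[of a] g(2)[of a] by simp
  \<comment> \<open>The removable singularity at a is filled by the derivative.\<close>
  let ?h = "\<lambda>z. if z = a then deriv g a else (g z - g a) / (z - a)"
  have "?h holomorphic_on UNIV" by (rule pole_lemma_open[OF g(1)]) simp
  moreover have "g z = (z - a) * ?h z" for z using \<open>g a = 0\<close> by simp
  ultimately show ?case using g(2) insert(1,2) by (intro exI[of _ ?h]) (simp add: mult_ac)
next
  case empty
  then show ?case by (intro exI[of _ f]) simp
qed

section \<open>A Paley-Wiener argument\<close>


text \<open>The remainder after cutting the Laplace integral at a, rescaled by exp (a zeta), is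
  bounded by L / Re zeta to the right and polynomially bounded everywhere far out. Liouville makes
  it a polynomial, and the decay along the positive axis makes it 0.\<close>

lemma laplace_support:
  fixes f :: "real \<Rightarrow> complex"
  assumes contf: "continuous_on {0..} f" and bd: "\<And>t. 0 \<le> t \<Longrightarrow> cmod (f t) \<le> L"
    and E: "E holomorphic_on UNIV"
    and lap: "\<And>\<zeta>. 0 < Re \<zeta> \<Longrightarrow> ((\<lambda>T. integral {0..T} (\<lambda>t. exp (- \<zeta> * of_real t) * f t)) \<longlongrightarrow> E \<zeta>) at_top"
    and growth: "\<And>\<zeta>. r \<le> cmod \<zeta> \<Longrightarrow> cmod (E \<zeta>) \<le> B * cmod \<zeta> ^ m * exp (2 * \<bar>Re \<zeta>\<bar>)"
    and a: "2 \<le> a"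
  shows "E \<zeta> = integral {0..a} (\<lambda>t. exp (- \<zeta> * of_real t) * f t)"
proof -
  let ?e = "\<lambda>\<zeta> t. exp (- \<zeta> * complex_of_real t) * f t"
  define I where "I \<zeta> T = integral {0..T} (?e \<zeta>)" for \<zeta> T
  \<comment> \<open>The factor exp (zeta a) moves the time origin to a: for Re zeta > 0, D is the
    Laplace transform of t -> f (a + t).\<close>
  define D where "D \<zeta> = exp (\<zeta> * of_real a) * (E \<zeta> - I \<zeta> a)" for \<zeta>
  have L: "0 \<le> L" using bd[of 0] by (auto intro: order_trans[OF norm_ge_zero])
  have cont: "continuous_on A (?e \<zeta>)" if "A \<subseteq> {0..}" for A \<zeta>
    by (intro continuous_intros continuous_on_subset[OF contf that])
  have I_hol: "(\<lambda>\<zeta>. I \<zeta> a) holomorphic_on UNIV"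
  proof -
    have int: "integrable (lebesgue_on {0..a}) f"
      by (intro absolutely_integrable_imp_integrable absolutely_integrable_continuous_real continuous_on_subset[OF contf]) auto
    have "(\<lambda>\<zeta>. LINT t|lebesgue_on {0..a}. f t * exp (\<zeta> * complex_of_real (- t))) holomorphic_on UNIV"
      by (rule entire_integral_exp[OF int, of _ a])
        (auto intro!: continuous_imp_measurable_on_sets_lebesgue continuous_intros)
    moreover have "(LINT t|lebesgue_on {0..a}. f t * exp (\<zeta> * complex_of_real (- t))) = I \<zeta> a" for \<zeta>
    proof -
      have "integrable (lebesgue_on {0..a}) (?e \<zeta>)"
        by (intro absolutely_integrable_imp_integrable absolutely_integrable_continuous_real cont) auto
      from lebesgue_integral_eq_integral[OF this] show ?thesis
        by (simp add: I_def mult.commute)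
    qed
    ultimately show ?thesis by simp
  qed
  have D_hol: "D holomorphic_on UNIV"
    unfolding D_def by (intro holomorphic_intros E I_hol)
  have D_right: "cmod (D \<zeta>) \<le> L / Re \<zeta>" if "0 < Re \<zeta>" for \<zeta>
  proof (rule tendsto_upperbound)
    show "((\<lambda>T. cmod (exp (\<zeta> * of_real a) * (I \<zeta> T - I \<zeta> a))) \<longlongrightarrow> cmod (D \<zeta>)) at_top"
      unfolding D_def by (intro tendsto_intros lap[OF that, folded I_def])
    show "\<forall>\<^sub>F T in at_top. cmod (exp (\<zeta> * of_real a) * (I \<zeta> T - I \<zeta> a)) \<le> L / Re \<zeta>"
      using eventually_ge_at_top[of a]
    proof eventually_elim
      case (elim T)
      have "I \<zeta> T = I \<zeta> a + integral {a..T} (?e \<zeta>)"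
        unfolding I_def using a elim
        by (intro Henstock_Kurzweil_Integration.integral_combine[symmetric] integrable_continuous_real cont) auto
      then have "exp (\<zeta> * of_real a) * (I \<zeta> T - I \<zeta> a) = integral {a..T} (\<lambda>t. exp (\<zeta> * of_real a) * ?e \<zeta> t)"
        by simp
      also have "cmod \<dots> \<le> integral {a..T} (\<lambda>t. L * exp (- Re \<zeta> * (t - a)))"
      proof (rule Henstock_Kurzweil_Integration.integral_norm_bound_integral)
        show "(\<lambda>t. exp (\<zeta> * of_real a) * ?e \<zeta> t) integrable_on {a..T}"
          using a by (intro integrable_continuous_real continuous_on_mult_left cont) auto
        show "(\<lambda>t. L * exp (- Re \<zeta> * (t - a))) integrable_on {a..T}"
          by (intro integrable_continuous_real continuous_intros)
        fix t assume "t \<in> {a..T}"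
        then have "cmod (f t) \<le> L" using a by (intro bd) auto
        then have "exp (- Re \<zeta> * (t - a)) * cmod (f t) \<le> exp (- Re \<zeta> * (t - a)) * L"
          by (rule mult_left_mono) simp
        moreover have "exp (\<zeta> * of_real a) * ?e \<zeta> t = exp (\<zeta> * of_real a + - \<zeta> * of_real t) * f t"
          by (simp only: exp_add mult.assoc)
        moreover have "Re (\<zeta> * of_real a + - \<zeta> * of_real t) = - Re \<zeta> * (t - a)" by (simp add: algebra_simps)
        ultimately show "cmod (exp (\<zeta> * of_real a) * ?e \<zeta> t) \<le> L * exp (- Re \<zeta> * (t - a))"
          by (simp only: norm_mult norm_exp_eq_Re mult.commute)
      qed
      also have "\<dots> = L / Re \<zeta> - L * exp (- Re \<zeta> * (T - a)) / Re \<zeta>"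
      proof -
        have "((\<lambda>t. L * exp (- Re \<zeta> * (t - a))) has_integral
            (- L * exp (- Re \<zeta> * (T - a)) / Re \<zeta>) - (- L * exp (- Re \<zeta> * (a - a)) / Re \<zeta>)) {a..T}"
          by (rule fundamental_theorem_of_calculus[OF elim])
            (use that in \<open>auto intro!: derivative_eq_intros simp: has_real_derivative_iff_has_vector_derivative[symmetric]\<close>)
        from integral_unique[OF this] show ?thesis by simp
      qed
      also have "\<dots> \<le> L / Re \<zeta>" using that L by simp
      finally show ?case .
    qed
  qed simp
  let ?r = "max r 1"
  \<comment> \<open>The product with exp (2 a) serves Re zeta < 1, the summand L serves Re zeta >=
    1.\<close>
  let ?B = "exp (2 * a) * (\<bar>B\<bar> + a * L) + L"
  have D_growth: "cmod (D \<zeta>) \<le> ?B * cmod \<zeta> ^ m" if z: "?r \<le> cmod \<zeta>" for \<zeta>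
  proof -
    have p1: "1 \<le> cmod \<zeta> ^ m" using z by (intro one_le_power) simp
    show ?thesis
    \<comment> \<open>L / Re zeta is useless near the imaginary axis. Up to Re zeta = 1 the growth
      of E is used instead, and there exp (a (Re zeta + |Re zeta|)) <= exp (2 a).\<close>
    proof (cases "1 \<le> Re \<zeta>")
      case True
      then have "cmod (D \<zeta>) \<le> L / Re \<zeta>" by (intro D_right) simp
      also have "\<dots> \<le> L * 1" using True L mult_left_mono[of 1 "Re \<zeta>" L] by (simp add: divide_le_eq)
      also have "\<dots> \<le> ?B * cmod \<zeta> ^ m" using p1 L a by (intro mult_mono) auto
      finally show ?thesis .
    next
      case False
      have "cmod (I \<zeta> a) \<le> (L * exp (a * \<bar>Re \<zeta>\<bar>)) * (a - 0)"
        unfolding I_def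
      proof (rule integral_bound)
        fix t assume t: "t \<in> {0..a}"
        have "- Re \<zeta> * t \<le> \<bar>Re \<zeta>\<bar> * a"
          by (rule order_trans[OF abs_ge_self]) (use t in \<open>simp add: abs_mult mult_left_mono\<close>)
        then have "exp (- Re \<zeta> * t) * cmod (f t) \<le> exp (a * \<bar>Re \<zeta>\<bar>) * L"
          using bd[of t] t by (intro mult_mono) (auto simp: mult.commute)
        then show "cmod (?e \<zeta> t) \<le> L * exp (a * \<bar>Re \<zeta>\<bar>)" by (simp add: norm_mult mult.commute)
      qed (use a cont in auto)
      \<comment> \<open>Here 2 <= a lets the cut absorb the exponential type of E.\<close>
      moreover have "cmod (E \<zeta>) \<le> \<bar>B\<bar> * cmod \<zeta> ^ m * exp (a * \<bar>Re \<zeta>\<bar>)"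
      proof -
        have "cmod (E \<zeta>) \<le> B * cmod \<zeta> ^ m * exp (2 * \<bar>Re \<zeta>\<bar>)" using z by (intro growth) simp
        also have "\<dots> \<le> \<bar>B\<bar> * cmod \<zeta> ^ m * exp (a * \<bar>Re \<zeta>\<bar>)"
          using a by (intro mult_mono mult_right_mono) (auto intro: mult_right_mono)
        finally show ?thesis .
      qed
      ultimately have "cmod (E \<zeta> - I \<zeta> a) \<le> \<bar>B\<bar> * cmod \<zeta> ^ m * exp (a * \<bar>Re \<zeta>\<bar>) + (L * exp (a * \<bar>Re \<zeta>\<bar>)) * (a - 0)"
        by (intro order_trans[OF norm_triangle_ineq4] add_mono)
      also have "\<dots> = (\<bar>B\<bar> * cmod \<zeta> ^ m + a * L * 1) * exp (a * \<bar>Re \<zeta>\<bar>)" by (simp add: algebra_simps)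
      also have "\<dots> \<le> (\<bar>B\<bar> * cmod \<zeta> ^ m + a * L * cmod \<zeta> ^ m) * exp (a * \<bar>Re \<zeta>\<bar>)"
        using p1 L a by (intro mult_right_mono add_left_mono mult_left_mono) auto
      finally have "cmod (D \<zeta>) \<le> exp (Re \<zeta> * a) * ((\<bar>B\<bar> * cmod \<zeta> ^ m + a * L * cmod \<zeta> ^ m) * exp (a * \<bar>Re \<zeta>\<bar>))"
        unfolding D_def norm_mult by (intro mult_mono) auto
      also have "\<dots> = exp (a * (Re \<zeta> + \<bar>Re \<zeta>\<bar>)) * ((\<bar>B\<bar> + a * L) * cmod \<zeta> ^ m)"
        by (simp add: exp_add algebra_simps)
      also have "\<dots> \<le> exp (2 * a) * ((\<bar>B\<bar> + a * L) * cmod \<zeta> ^ m)"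
      proof (rule mult_right_mono)
        have "a * (Re \<zeta> + \<bar>Re \<zeta>\<bar>) \<le> a * 2" using False a by (intro mult_left_mono) auto
        then show "exp (a * (Re \<zeta> + \<bar>Re \<zeta>\<bar>)) \<le> exp (2 * a)" by simp
        show "0 \<le> (\<bar>B\<bar> + a * L) * cmod \<zeta> ^ m" using a L by simp
      qed
      also have "\<dots> \<le> ?B * cmod \<zeta> ^ m" using L by (simp add: algebra_simps)
      finally show ?thesis .
    qed
  qed
  define c where "c k = (deriv ^^ k) D 0 / fact k" for k
  have poly: "D \<zeta> = (\<Sum>k\<le>m. c k * \<zeta> ^ k)" for \<zeta>
    unfolding c_def by (rule Liouville_polynomial[OF D_hol D_growth])
  \<comment> \<open>A nonzero coefficient of positive degree makes |D| at least L + 1 far out,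
    whereas |D| <= L at real points beyond 1.\<close>
  have "c k = 0" if "k \<noteq> 0" "k \<le> m" for k
  proof (rule ccontr)
    assume "c k \<noteq> 0"
    then have "\<forall>\<^sub>F z in at_infinity. L + 1 \<le> cmod (\<Sum>i\<le>m. c i * z ^ i)"
      using that by (intro polyfun_extremal) auto
    then obtain b where b: "\<And>z. b \<le> cmod z \<Longrightarrow> L + 1 \<le> cmod (D z)"
      unfolding poly[symmetric] eventually_at_infinity by blast
    let ?x = "complex_of_real (max b 1)"
    have "L + 1 \<le> cmod (D ?x)" by (rule b) simp
    also have "\<dots> \<le> L / Re ?x" by (rule D_right) simp
    also have "\<dots> \<le> L" using L mult_left_mono[of 1 "max b 1" L] by (simp add: divide_le_eq)
    finally show False by simp
  qed
  then have const: "D \<zeta> = c 0" for \<zeta>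
    unfolding poly by (subst sum.remove[of _ 0]) auto
  have "c 0 = 0"
  proof (rule ccontr)
    assume "c 0 \<noteq> 0"
    \<comment> \<open>Chosen so that L / Re ?x = |c 0| L / (L + 1), which is less than |c
      0|.\<close>
    let ?x = "complex_of_real ((L + 1) / cmod (c 0))"
    have "cmod (c 0) = cmod (D ?x)" by (simp only: const)
    also have "\<dots> \<le> L / Re ?x"
      by (rule D_right) (use L \<open>c 0 \<noteq> 0\<close> in simp)
    also have "\<dots> < cmod (c 0)" using L \<open>c 0 \<noteq> 0\<close> by (simp add: field_simps)
    finally show False by simp
  qed
  then have "D \<zeta> = 0" using const by simp
  then show ?thesis by (simp add: D_def I_def)
qed

section \<open>Evolution of the pairings\<close>


lemma pairing_scale: "pairing (\<lambda>x. k * a x) (\<lambda>x. k * b x) p = k * pairing a b p"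
  by (simp add: pairing_def mult.left_commute distrib_left)

lemma pairing_only_snd: "pairing (\<lambda>_. 0) b p = (LINT x|unit_itv. snd p x * b x)"
  and pairing_only_fst: "pairing a (\<lambda>_. 0) p = (LINT x|unit_itv. weak_deriv (fst p) x * a x)"
  by (simp_all add: pairing_def)

lemma L2_imp_integrable: "f \<in> L2 \<Longrightarrow> integrable unit_itv f"
  using L2_mult_integrable[of f "\<lambda>_. 1"] L2_bounded[of "\<lambda>_. 1" 1] by simp

lemma W12_0_AE_0_deriv:
  assumes "f \<in> W12_0" "AE x in unit_itv. f x = 0"
  shows "AE x in unit_itv. weak_deriv f x = 0"
proof -
  have "has_weak_deriv (\<lambda>_. 0) (\<lambda>_. 0)" by (rule has_weak_deriv_C1) auto
  then have "AE x in unit_itv. weak_deriv (\<lambda>_. 0) x = 0" by (rule weak_deriv_AE)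
  moreover have "AE x in unit_itv. weak_deriv f x = weak_deriv (\<lambda>_. 0) x"
    by (rule weak_deriv_cong_AE[OF assms]) simp
  ultimately show ?thesis by eventually_elim simp
qed

lemma has_vector_derivative_cnj_fun:
  assumes "(f has_vector_derivative f') F"
  shows "((\<lambda>x. cnj (f x)) has_vector_derivative cnj f') F"
  using bounded_linear.has_vector_derivative[OF bounded_linear_cnj assms] .

lemma test_functions_cnj:
  assumes "\<phi> \<in> test_functions"
  shows "(\<lambda>x. cnj (\<phi> x)) \<in> test_functions"
proof -
  obtain a b where ab: "0 < a" "a < b" "b < 1" "\<And>x. x \<notin> {a..b} \<Longrightarrow> \<phi> x = 0"
    using test_functions_support[OF assms] by blast
  obtain D where D: "D 0 = \<phi>" "\<And>k x. (D k has_vector_derivative D (Suc k) x) (at x)"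
    using test_functions_smooth[OF assms] unfolding smooth_def by blast
  have "smooth (\<lambda>x. cnj (\<phi> x))"
    unfolding smooth_def
    by (rule exI[of _ "\<lambda>k x. cnj (D k x)"]) (use D in \<open>auto intro: has_vector_derivative_cnj_fun\<close>)
  then show ?thesis by (rule test_functionsI[of _ a b]) (simp_all add: ab)
qed

text \<open>Conjugates of test functions are test functions, so u' is orthogonal, in the Hermitian
  sense, to the derivatives of its own approximants and in the limit to itself.\<close>

lemma W12_0_orthogonal_derivs:
  assumes "u \<in> W12_0" "\<And>w. w \<in> test_functions \<Longrightarrow> (LINT x|unit_itv. weak_deriv u x * vector_derivative w (at x)) = 0"
  shows "AE x in unit_itv. u x = 0"
proof -
  obtain \<phi> where phi: "\<And>m::nat. \<phi> m \<in> test_functions"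
    "(\<lambda>m. L2_norm (\<lambda>x. vector_derivative (\<phi> m) (at x) - weak_deriv u x)) \<longlonglongrightarrow> 0"
    using W12_0_approx[OF assms(1)] by blast
  let ?d = "\<lambda>m x. vector_derivative (\<phi> m) (at x)"
  have u: "weak_deriv u \<in> L2" by (rule W12_0_L2[OF assms(1)])
  have d: "?d m \<in> L2" for m by (intro test_functions_L2 test_functions_deriv phi)
  have "(\<lambda>m. LINT x|unit_itv. cnj (?d m x) * weak_deriv u x) \<longlonglongrightarrow> (LINT x|unit_itv. cnj (weak_deriv u x) * weak_deriv u x)"
  proof (rule L2_integral_tendsto[OF L2_cnj[OF d] L2_cnj[OF u] u])
    show "(\<lambda>m. L2_norm (\<lambda>x. cnj (?d m x) - cnj (weak_deriv u x))) \<longlonglongrightarrow> 0"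
      using phi(2) by (simp add: L2_norm_def flip: complex_cnj_diff)
  qed
  moreover have "(LINT x|unit_itv. cnj (?d m x) * weak_deriv u x) = 0" for m
  proof -
    have "vector_derivative (\<lambda>x. cnj (\<phi> m x)) (at x) = cnj (?d m x)" for x
      by (rule vector_derivative_at, rule has_vector_derivative_cnj_fun, rule test_functions_has_deriv[OF phi(1)])
    then show ?thesis using assms(2)[OF test_functions_cnj[OF phi(1)], of m] by (simp add: mult.commute)
  qed
  ultimately have "(LINT x|unit_itv. cnj (weak_deriv u x) * weak_deriv u x) = 0"
    using LIMSEQ_unique[OF _ tendsto_const[of 0]] by simp
  then have "L2_inner (weak_deriv u) (weak_deriv u) = 0" by (simp add: L2_inner_def mult.commute)
  then have "L2_norm (weak_deriv u) = 0" by (simp add: L2_inner_self)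
  from W12_0_deriv_0[OF assms(1) L2_norm_eq_0[OF u this]] show ?thesis .
qed

section \<open>Passing extinction from one component to the other; Duhamel's formula\<close>

context damped_wave_semigroup begin

lemma pairing_S_deriv_at:
  assumes "adjoint_domain a a' w w'" "p \<in> H" "0 < t"
  shows "((\<lambda>t. pairing a w (S t p)) has_vector_derivative adjoint_pairing a' w w' (S t p)) (at t)"
proof -
  have "((\<lambda>t. pairing a w (S t p)) has_vector_derivative adjoint_pairing a' w w' (S t p)) (at t within {0..t + 1})"
    by (rule pairing_S_has_deriv[OF assms(1,2)]) (use assms in auto)
  moreover have "at t within {0..t + 1} = at t" using assms by (intro at_within_interior) auto
  ultimately show ?thesis by simp
qed

lemma adjoint_pairing_vanishes:
  assumes "adjoint_domain a a' w w'" "p \<in> H" "0 \<le> T" "\<And>t. T < t \<Longrightarrow> pairing a w (S t p) = 0" "T < t"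
  shows "adjoint_pairing a' w w' (S t p) = 0"
proof -
  have "((\<lambda>_. 0) has_vector_derivative 0) (at t)" by simp
  then have "((\<lambda>t. pairing a w (S t p)) has_vector_derivative 0) (at t)"
    by (rule has_vector_derivative_transform_within_open[where S = "{T<..}"]) (use assms in auto)
  with pairing_S_deriv_at[OF assms(1,2)] assms(3,5) show ?thesis
    using vector_derivative_unique_at by (metis le_less_trans)
qed

text \<open>Pairing with (0, w) is the weak form of v_t = u'' - 2 alpha v / x. Once v is 0 for good,
  only the integral of u' w' is left and must vanish, so u solves u'' = 0 weakly with zero boundary
  values.\<close>

lemma snd_vanishes_imp_fst_vanishes:
  assumes "p \<in> H" "0 \<le> T" "\<And>t. T < t \<Longrightarrow> AE x in unit_itv. snd (S t p) x = 0" "T < t"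
  shows "AE x in unit_itv. fst (S t p) x = 0"
proof (rule W12_0_orthogonal_derivs)
  have mem: "S s p \<in> H" if "T < s" for s using that assms by (intro S_in_H) auto
  show "fst (S t p) \<in> W12_0" by (rule H_D(1)[OF mem[OF assms(4)]])
  fix w assume w: "w \<in> test_functions"
  let ?w' = "\<lambda>x. vector_derivative w (at x)"
  have snd0: "(LINT x|unit_itv. snd (S s p) x * h x) = 0" if "T < s" "h \<in> L2" for s h
  proof -
    have "(LINT x|unit_itv. snd (S s p) x * h x) = (LINT x|unit_itv. 0)"
      using assms(3)[OF that(1)] L2_mult_integrable[OF H_D(2)[OF mem[OF that(1)]] that(2)]
      by (intro integral_cong_AE) (auto elim: eventually_mono)
    then show ?thesis by simp
  qed
  have ad: "adjoint_domain (\<lambda>_. 0) (\<lambda>_. 0) w ?w'"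
    unfolding adjoint_domain_def using test_functions_boundary[OF w]
    by (auto intro: test_functions_has_deriv[OF w] test_functions_continuous[OF test_functions_deriv[OF w]])
  have "adjoint_pairing (\<lambda>_. 0) w ?w' (S t p) = 0"
    by (rule adjoint_pairing_vanishes[OF ad assms(1,2) _ assms(4)])
      (simp add: pairing_only_snd snd0 test_functions_L2[OF w])
  then have "(LINT x|unit_itv. weak_deriv (fst (S t p)) x * - ?w' x) = 0"
    using snd0[OF assms(4) adjoint_domain_L2(4)[OF ad]] by (simp add: adjoint_pairing_def pairing_def)
  then show "(LINT x|unit_itv. weak_deriv (fst (S t p)) x * ?w' x) = 0" by simp
qed

text \<open>Pairing with (a, 0) is the weak form of (u')_t = v'. With a primitive of phi as a, its
  time derivative is minus the integral of v phi.\<close>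

lemma fst_vanishes_imp_snd_vanishes:
  assumes "p \<in> H" "0 \<le> T" "\<And>t. T < t \<Longrightarrow> AE x in unit_itv. fst (S t p) x = 0" "T < t"
  shows "AE x in unit_itv. snd (S t p) x = 0"
proof (rule L2_orthogonal_test_AE_0)
  have mem: "S s p \<in> H" if "T < s" for s using that assms by (intro S_in_H) auto
  show "snd (S t p) \<in> L2" by (rule H_D(2)[OF mem[OF assms(4)]])
  fix \<phi> assume phi: "\<phi> \<in> test_functions"
  have cont: "continuous_on {0..1} \<phi>" by (rule test_functions_continuous[OF phi])
  have ad: "adjoint_domain (primitive \<phi>) \<phi> (\<lambda>_. 0) (\<lambda>_. 0)"
    unfolding adjoint_domain_def by (auto intro: cont primitive_deriv[OF cont, simplified])
  have "adjoint_pairing \<phi> (\<lambda>_. 0) (\<lambda>_. 0) (S t p) = 0"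
  proof (rule adjoint_pairing_vanishes[OF ad assms(1,2) _ assms(4)])
    fix s assume s: "T < s"
    have "(LINT x|unit_itv. weak_deriv (fst (S s p)) x * primitive \<phi> x) = (LINT x|unit_itv. 0)"
      using W12_0_AE_0_deriv[OF H_D(1)[OF mem[OF s]] assms(3)[OF s]]
        L2_mult_integrable[OF H_D(4)[OF mem[OF s]] L2_continuous[OF primitive_continuous[OF cont]]]
      by (intro integral_cong_AE) (auto elim: eventually_mono)
    then show "pairing (primitive \<phi>) (\<lambda>_. 0) (S s p) = 0" by (simp add: pairing_only_fst)
  qed
  then show "(LINT x|unit_itv. snd (S t p) x * \<phi> x) = 0"
    by (simp add: adjoint_pairing_def pairing_def)
qed

text \<open>The formal adjoint sends (a, - zeta z) to zeta (a, - zeta z) - (0, phi): the singular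
  term in the equation for a' cancels the one in the adjoint.\<close>

lemma adjoint_pairing_resolvent:
  assumes "adjoint_domain a a' (\<lambda>x. - \<zeta> * z x) (\<lambda>x. - \<zeta> * a x)" "\<phi> \<in> L2" "p \<in> H"
    and "\<And>x. 0 < x \<Longrightarrow> x < 1 \<Longrightarrow> a' x = \<phi> x + (\<zeta>\<^sup>2 + \<zeta> * of_real (2 * \<alpha> / x)) * z x"
  shows "adjoint_pairing a' (\<lambda>x. - \<zeta> * z x) (\<lambda>x. - \<zeta> * a x) p
    = \<zeta> * pairing a (\<lambda>x. - \<zeta> * z x) p - pairing (\<lambda>_. 0) \<phi> p"
proof -
  note L = adjoint_domain_L2[OF assms(1)]
  have "(LINT x|unit_itv. snd p x * (- a' x - complex_of_real (2 * \<alpha> / x) * (- \<zeta> * z x)))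
      = (LINT x|unit_itv. \<zeta> * (snd p x * (- \<zeta> * z x)) - snd p x * \<phi> x)"
    by (rule Bochner_Integration.integral_cong) (simp_all add: assms(4) power2_eq_square algebra_simps)
  also have "\<dots> = \<zeta> * (LINT x|unit_itv. snd p x * (- \<zeta> * z x)) - (LINT x|unit_itv. snd p x * \<phi> x)"
    unfolding Bochner_Integration.integral_diff[OF integrable_mult_right[OF L2_mult_integrable[OF H_D(2)[OF assms(3)] L(2)]]
        L2_mult_integrable[OF H_D(2)[OF assms(3)] assms(2)]] integral_mult_right_zero ..
  finally have 1: "(LINT x|unit_itv. snd p x * (- a' x - complex_of_real (2 * \<alpha> / x) * (- \<zeta> * z x)))
    = \<zeta> * (LINT x|unit_itv. snd p x * (- \<zeta> * z x)) - (LINT x|unit_itv. snd p x * \<phi> x)" .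
  have "(LINT x|unit_itv. weak_deriv (fst p) x * - (- \<zeta> * a x)) = (LINT x|unit_itv. \<zeta> * (weak_deriv (fst p) x * a x))"
    by (simp add: mult_ac)
  then have 2: "(LINT x|unit_itv. weak_deriv (fst p) x * - (- \<zeta> * a x)) = \<zeta> * (LINT x|unit_itv. weak_deriv (fst p) x * a x)"
    by simp
  show ?thesis
    unfolding adjoint_pairing_def pairing_def 1 2 by (simp add: ring_distribs)
qed

text \<open>Variation of constants for y' = zeta y - f, with integrating factor exp (- zeta
  t).\<close>

lemma duhamel:
  assumes ad: "adjoint_domain a a' (\<lambda>x. - \<zeta> * z x) (\<lambda>x. - \<zeta> * a x)" and phi: "\<phi> \<in> L2" and p: "p \<in> H"
    and ode: "\<And>x. 0 < x \<Longrightarrow> x < 1 \<Longrightarrow> a' x = \<phi> x + (\<zeta>\<^sup>2 + \<zeta> * of_real (2 * \<alpha> / x)) * z x"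
    and T: "0 \<le> T"
  shows "exp (- \<zeta> * of_real T) * pairing a (\<lambda>x. - \<zeta> * z x) (S T p) = pairing a (\<lambda>x. - \<zeta> * z x) p
    - integral {0..T} (\<lambda>t. exp (- \<zeta> * of_real t) * pairing (\<lambda>_. 0) \<phi> (S t p))"
proof -
  let ?y = "\<lambda>t. pairing a (\<lambda>x. - \<zeta> * z x) (S t p)" and ?f = "\<lambda>t. pairing (\<lambda>_. 0) \<phi> (S t p)"
  let ?e = "\<lambda>t. exp (- \<zeta> * complex_of_real t)"
  note L = adjoint_domain_L2[OF ad]
  have "((\<lambda>t. - (?e t * ?f t)) has_integral (?e T * ?y T - ?e 0 * ?y 0)) {0..T}"
  proof (rule fundamental_theorem_of_calculus[OF T])
    fix t assume t: "t \<in> {0..T}"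
    have "((\<lambda>z. exp (- \<zeta> * z)) has_field_derivative (- \<zeta> * ?e t)) (at (of_real t))"
      by (auto intro!: derivative_eq_intros)
    from has_vector_derivative_real_field[OF this]
    have e: "(?e has_vector_derivative (- \<zeta> * ?e t)) (at t within {0..T})"
      by (rule has_vector_derivative_at_within)
    have "S t p \<in> H" using t p by (intro S_in_H) auto
    from pairing_S_has_deriv[OF ad p t] adjoint_pairing_resolvent[OF ad phi this ode]
    have y: "(?y has_vector_derivative (\<zeta> * ?y t - ?f t)) (at t within {0..T})" by simp
    from has_vector_derivative_mult[OF e y]
    show "((\<lambda>t. ?e t * ?y t) has_vector_derivative - (?e t * ?f t)) (at t within {0..T})"
      by (simp add: algebra_simps)
  qed
  from has_integral_neg[OF this]
  have "integral {0..T} (\<lambda>t. ?e t * ?f t) = ?y 0 - ?e T * ?y T" by (simp add: integral_unique)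
  then show ?thesis using pairing_S_0[OF L(1,2) p] by simp
qed

end

text \<open>At a root of \<open>laguerre_poly n\<close> the regular solution meets both boundary
  conditions, and this is the pairing with an eigenvector of the formal adjoint. The other zeta
  provide an entire continuation from which the roots can be divided out.\<close>

definition eigen_pairing :: "nat \<Rightarrow> complex \<Rightarrow> state \<Rightarrow> complex" where
  "eigen_pairing n \<zeta> = pairing (exp_poly (regular_sol_poly n) \<zeta>) (\<lambda>x. - \<zeta> * regular_sol n \<zeta> x)"

lemma regular_sol_0: "regular_sol n \<zeta> 0 = 0"
  by (simp add: regular_sol_def)

lemma regular_sol_1: "regular_sol n \<zeta> 1 = exp \<zeta> * poly (laguerre_poly n) \<zeta>"
  by (simp add: regular_sol_def exp_poly_def)

text \<open>Two formulas for the derivative of one function. The left-hand side is continuous also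
  at x = 0, as \<open>adjoint_domain\<close> requires of a', whereas the right-hand side contains a
  singular quotient.\<close>

lemma regular_sol_second_deriv:
  assumes "x \<noteq> 0"
  shows "\<zeta> * exp_poly (regular_sol_poly n + pderiv (regular_sol_poly n)) \<zeta> x
    = (\<zeta>\<^sup>2 + \<zeta> * of_real (2 * (real n + 1) / x)) * regular_sol n \<zeta> x"
  using vector_derivative_unique_at[OF exp_poly_deriv regular_sol_ode[OF assms]] .

lemma exp_poly_L2: "exp_poly q \<zeta> \<in> L2"
  by (rule L2_continuous[OF exp_poly_continuous])

lemma eigen_pairing_entire:
  assumes "p \<in> H"
  shows "(\<lambda>\<zeta>. eigen_pairing n \<zeta> p) holomorphic_on UNIV"
proof -
  have "eigen_pairing n \<zeta> p = (LINT x|unit_itv. weak_deriv (fst p) x * exp_poly (regular_sol_poly n) \<zeta> x)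
      - (LINT x|unit_itv. snd p x * exp_poly (pCons 0 (laguerre_poly n)) \<zeta> x)" for \<zeta>
    unfolding eigen_pairing_def pairing_def by (simp add: zeta_regular_sol)
  then show ?thesis
    by (simp only:) (intro holomorphic_on_diff entire_exp_poly L2_imp_integrable H_D assms)
qed

text \<open>The exponent n + 1 bounds the degrees of both polynomials involved; the exponential is
  that of \<open>exp_poly_bound\<close>.\<close>

lemma eigen_pairing_bound:
  assumes "p \<in> H"
  obtains C where "0 \<le> C" "\<And>\<zeta>. 1 \<le> cmod \<zeta> \<Longrightarrow> cmod (exp (- \<zeta>) * eigen_pairing n \<zeta> p) \<le> C * cmod \<zeta> ^ (n + 1) * exp \<bar>Re \<zeta>\<bar>"
proof -
  obtain C1 where C1: "0 \<le> C1" "\<And>\<zeta> x. 1 \<le> cmod \<zeta> \<Longrightarrow> x \<in> {0..1} \<Longrightarrow>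
    cmod (exp (- \<zeta>) * exp_poly (regular_sol_poly n) \<zeta> x) \<le> C1 * cmod \<zeta> ^ (n + 1) * exp \<bar>Re \<zeta>\<bar>"
    using exp_poly_bound[OF degree_regular_sol_poly] by blast
  have "degree (pCons 0 (laguerre_poly n)) \<le> n + 1"
    using degree_pCons_le[of 0 "laguerre_poly n"] by (simp add: degree_laguerre_poly)
  then obtain C2 where C2: "0 \<le> C2" "\<And>\<zeta> x. 1 \<le> cmod \<zeta> \<Longrightarrow> x \<in> {0..1} \<Longrightarrow>
    cmod (exp (- \<zeta>) * exp_poly (pCons 0 (laguerre_poly n)) \<zeta> x) \<le> C2 * cmod \<zeta> ^ (n + 1) * exp \<bar>Re \<zeta>\<bar>"
    using exp_poly_bound by blast
  show ?thesis
  proof (rule that[of "(C1 + C2) * H_norm p"])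
    show "0 \<le> (C1 + C2) * H_norm p" using C1 C2 H_norm_nonneg by simp
    fix \<zeta> :: complex assume z: "1 \<le> cmod \<zeta>"
    let ?g = "cmod \<zeta> ^ (n + 1) * exp \<bar>Re \<zeta>\<bar>"
    let ?a = "\<lambda>x. exp (- \<zeta>) * exp_poly (regular_sol_poly n) \<zeta> x"
    let ?b = "\<lambda>x. exp (- \<zeta>) * (- \<zeta> * regular_sol n \<zeta> x)"
    have b_eq: "?b = (\<lambda>x. - (exp (- \<zeta>) * exp_poly (pCons 0 (laguerre_poly n)) \<zeta> x))"
      by (simp add: zeta_regular_sol[symmetric])
    have a: "?a \<in> L2" by (intro L2_cmult exp_poly_L2)
    have b: "?b \<in> L2" unfolding b_eq by (intro L2_uminus L2_cmult exp_poly_L2)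
    have "L2_norm ?a \<le> C1 * ?g"
      using C1 z a by (intro L2_norm_le_bound L2_measurable) (auto simp: mult.assoc)
    moreover have "L2_norm ?b \<le> C2 * ?g"
      by (intro L2_norm_le_bound L2_measurable[OF b]) (use C2 z b_eq in \<open>auto simp: mult.assoc fun_eq_iff\<close>)
    ultimately have "(L2_norm ?a + L2_norm ?b) * H_norm p \<le> (C1 * ?g + C2 * ?g) * H_norm p"
      by (intro mult_right_mono add_mono H_norm_nonneg)
    moreover have "exp (- \<zeta>) * eigen_pairing n \<zeta> p = pairing ?a ?b p"
      by (simp only: eigen_pairing_def pairing_scale)
    ultimately show "cmod (exp (- \<zeta>) * eigen_pairing n \<zeta> p) \<le> (C1 + C2) * H_norm p * cmod \<zeta> ^ (n + 1) * exp \<bar>Re \<zeta>\<bar>"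
      using pairing_bound[OF a b assms] by (simp add: algebra_simps)
  qed
qed

lemma fk_regular_sol: "fk n m = regular_sol n (complex_of_real m)"
proof
  fix x
  have "poly (laguerre_poly n) (complex_of_real m * complex_of_real x) = complex_of_real (laguerre1 n (- 2 * (m * x)))"
    unfolding of_real_mult[symmetric] by (rule poly_laguerre_poly)
  moreover have "exp (complex_of_real m * complex_of_real x) = complex_of_real (exp (m * x))"
    by (simp add: exp_of_real[symmetric])
  ultimately show "fk n m x = regular_sol n (complex_of_real m) x"
    by (simp add: fk_def regular_sol_def exp_poly_def mult.assoc)
qed

text \<open>For real m the function \<open>fk n m\<close> is real, so the conjugation in
  \<open>H_inner\<close> disappears and the bilinear pairing is recovered.\<close>

lemma H_inner_fk:
  assumes "p \<in> H"
  shows "H_inner p (fk n m, \<lambda>x. - complex_of_real m * fk n m x) = eigen_pairing n (complex_of_real m) p"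
proof -
  let ?z = "complex_of_real m" and ?D = "exp_poly (regular_sol_poly n) (complex_of_real m)"
  have d: "(fk n m has_vector_derivative ?D x) (at x within A)" for x A
    unfolding fk_regular_sol by (rule regular_sol_deriv)
  have "cnj (fk n m x) = fk n m x" for x by (simp add: fk_def)
  \<comment> \<open>Realness of the derivative comes from uniqueness of derivatives instead of an
    inspection of its formula.\<close>
  then have "(fk n m has_vector_derivative cnj (?D x)) (at x)" for x
    using has_vector_derivative_cnj_fun[OF d, of x UNIV] by simp
  then have D: "cnj (?D x) = ?D x" for x using vector_derivative_unique_at d by blast
  have wd: "has_weak_deriv (fk n m) ?D" by (intro has_weak_deriv_C1 exp_poly_continuous d)
  have "L2_inner (weak_deriv (fst p)) (weak_deriv (fk n m)) = (LINT x|unit_itv. weak_deriv (fst p) x * ?D x)"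
    unfolding L2_inner_def
  proof (rule integral_cong_AE)
    show "(\<lambda>x. weak_deriv (fst p) x * cnj (weak_deriv (fk n m) x)) \<in> borel_measurable unit_itv"
      by (intro borel_measurable_integrable L2_mult_integrable L2_cnj H_D assms
        has_weak_deriv_L2(2)[OF has_weak_deriv_weak_deriv[OF wd]])
    show "(\<lambda>x. weak_deriv (fst p) x * ?D x) \<in> borel_measurable unit_itv"
      by (intro borel_measurable_integrable L2_mult_integrable exp_poly_L2 H_D assms)
    show "AE x in unit_itv. weak_deriv (fst p) x * cnj (weak_deriv (fk n m) x) = weak_deriv (fst p) x * ?D x"
      using weak_deriv_AE[OF wd] by eventually_elim (simp add: D)
  qed
  moreover have "L2_inner (snd p) (\<lambda>x. - complex_of_real m * fk n m x) = (LINT x|unit_itv. snd p x * (- ?z * regular_sol n ?z x))"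
    unfolding L2_inner_def fk_regular_sol[symmetric]
    by (rule Bochner_Integration.integral_cong) (simp_all add: fk_def)
  ultimately show ?thesis by (simp add: H_inner_def eigen_pairing_def pairing_def)
qed

section \<open>Finite-time extinction\<close>


context damped_wave_semigroup begin

text \<open>The set A exhausts the roots of \<open>laguerre_poly n\<close>, all in the left
  half-plane. So the boundary value problem is solvable for every zeta with Re zeta > 0, where the
  Laplace integral lives.\<close>

lemma orthogonal_imp_snd_vanishes:
  assumes \<alpha>: "\<alpha> = real n + 1" and p: "p \<in> H"
    and A: "finite A" "card A = n" "\<And>a. a \<in> A \<Longrightarrow> poly (laguerre_poly n) a = 0" "\<And>a. a \<in> A \<Longrightarrow> Re a < 0"
    and orth: "\<And>a. a \<in> A \<Longrightarrow> eigen_pairing n a p = 0"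
    and t: "2 < t"
  shows "AE x in unit_itv. snd (S t p) x = 0"
proof (rule L2_orthogonal_test_AE_0)
  show "snd (S t p) \<in> L2" using t by (intro H_D S_in_H p) auto
  fix \<phi> assume test: "\<phi> \<in> test_functions"
  obtain \<epsilon> b where eb: "0 < \<epsilon>" "\<epsilon> < b" "b < 1" "\<And>x. x \<notin> {\<epsilon>..b} \<Longrightarrow> \<phi> x = 0"
    using test_functions_support[OF test] by blast
  have phi_cont: "continuous_on {0..1} \<phi>" by (rule test_functions_continuous[OF test])
  have phi_L2: "\<phi> \<in> L2" by (rule test_functions_L2[OF test])
  obtain M where M: "0 < M" "\<And>x. 0 \<le> x \<Longrightarrow> x \<le> 1 \<Longrightarrow> cmod (\<phi> x) \<le> M"
    using continuous_01_bounded[OF phi_cont] by metis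
  \<comment> \<open>Half of \<epsilon> leaves room: phi is 0 on the closed interval
    [0, \<epsilon> / 2], and c equals 2 alpha / x beyond it.\<close>
  define c where "c x = 2 * \<alpha> / max x (\<epsilon> / 2)" for x
  interpret sideways \<phi> c "2 * \<alpha> / (\<epsilon> / 2)" M "\<epsilon> / 2"
  proof
    show "continuous_on {0..1} c" unfolding c_def using eb by (intro continuous_intros) auto
    show "c x \<le> 2 * \<alpha> / (\<epsilon> / 2)" if "x \<in> {0..1}" for x
      unfolding c_def using eb \<alpha> by (intro divide_left_mono) auto
    show "0 \<le> c x" for x unfolding c_def using eb \<alpha> by simp
    show "\<phi> x = 0" if "x \<in> {0..\<epsilon> / 2}" for x using that eb by (intro eb) auto
  qed (use phi_cont M eb in auto)

  obtain k where k: "k \<noteq> 0" "\<And>s. poly (laguerre_poly n) s = k * (\<Prod>a\<in>A. s - a)"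
    using laguerre_poly_factorization[OF A(1-3)] by blast
  have "(\<lambda>\<zeta>. exp (- \<zeta>) * eigen_pairing n \<zeta> p) holomorphic_on UNIV"
    by (intro holomorphic_intros eigen_pairing_entire p)
  \<comment> \<open>The orthogonality conditions enter here and nowhere else: they make the division
    by the roots possible.\<close>
  from entire_divide_roots[OF A(1) this] orth
  obtain Q where Q: "Q holomorphic_on UNIV" "\<And>\<zeta>. exp (- \<zeta>) * eigen_pairing n \<zeta> p = (\<Prod>a\<in>A. \<zeta> - a) * Q \<zeta>"
    by auto
  \<comment> \<open>The pairing at time 0 with the corrected solution, written with the poles
    already cancelled so that it makes sense for every zeta.\<close>
  define E where "E \<zeta> = pairing (dsol \<zeta>) (\<lambda>x. - \<zeta> * sol \<zeta> x) p - sol \<zeta> 1 * Q \<zeta> / k" for \<zeta>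
  define f where "f t = pairing (\<lambda>_. 0) \<phi> (S t p)" for t

  have sol_cont: "continuous_on {0..1} (sol \<zeta>)" and dsol_cont: "continuous_on {0..1} (dsol \<zeta>)" for \<zeta>
    by (rule continuous_on_vector_derivative[OF sol_deriv], assumption)
       (rule continuous_on_vector_derivative[OF dsol_deriv], assumption)
  have sol_L2: "dsol \<zeta> \<in> L2" "(\<lambda>x. - \<zeta> * sol \<zeta> x) \<in> L2" for \<zeta>
    by (intro L2_continuous continuous_intros sol_cont dsol_cont)+

  have E_hol: "E holomorphic_on UNIV"
  proof -
    have "pairing (dsol \<zeta>) (\<lambda>x. - \<zeta> * sol \<zeta> x) p = (LINT x|unit_itv. weak_deriv (fst p) x * dsol \<zeta> x)
        - \<zeta> * (LINT x|unit_itv. snd p x * sol \<zeta> x)" for \<zeta>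
      unfolding pairing_def by (simp add: mult.left_commute)
    then show ?thesis
      unfolding E_def using k(1)
      by (simp only:) (intro holomorphic_intros entire_dsol entire_sol entire_sol_1 L2_imp_integrable H_D p Q; simp)
  qed

  \<comment> \<open>Beyond this radius every |zeta - a| is at least 1, so |Q| is bounded by its
    numerator; moreover r >= 1.\<close>
  define r where "r = 1 + (\<Sum>a\<in>A. cmod a)"
  obtain C where C: "0 \<le> C" "\<And>\<zeta>. 1 \<le> cmod \<zeta> \<Longrightarrow> cmod (exp (- \<zeta>) * eigen_pairing n \<zeta> p) \<le> C * cmod \<zeta> ^ (n + 1) * exp \<bar>Re \<zeta>\<bar>"
    using eigen_pairing_bound[OF p] by blast
  \<comment> \<open>The first summand belongs to the solution vanishing near 0, of type 1; the
    second to the correction, whose two factors have type 1 each.\<close>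
  let ?B = "2 * growth * H_norm p + growth * C / cmod k"
  have E_growth: "cmod (E \<zeta>) \<le> ?B * cmod \<zeta> ^ (n + 1) * exp (2 * \<bar>Re \<zeta>\<bar>)" if z: "r \<le> cmod \<zeta>" for \<zeta>
  proof -
    let ?e = "exp \<bar>Re \<zeta>\<bar>"
    have r1: "1 \<le> r" unfolding r_def by (simp add: sum_nonneg)
    have z1: "1 \<le> cmod \<zeta>" using z r1 by simp
    have p1: "1 \<le> cmod \<zeta> ^ (n + 1)" by (rule one_le_power[OF z1])
    have e2: "exp (2 * \<bar>Re \<zeta>\<bar>) = ?e * ?e" by (simp add: mult_exp_exp)
    have e1: "1 \<le> ?e" by simp
    have g: "L2_norm (dsol \<zeta>) \<le> growth * ?e" "L2_norm (\<lambda>x. - \<zeta> * sol \<zeta> x) \<le> growth * ?e"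
      by (intro L2_norm_le_bound L2_measurable sol_L2 mult_nonneg_nonneg growth_nonneg;
          use dsol_bound zeta_sol_bound growth_nonneg in \<open>auto simp: norm_mult\<close>)+
    have "cmod (pairing (dsol \<zeta>) (\<lambda>x. - \<zeta> * sol \<zeta> x) p) \<le> (L2_norm (dsol \<zeta>) + L2_norm (\<lambda>x. - \<zeta> * sol \<zeta> x)) * H_norm p"
      by (rule pairing_bound[OF sol_L2 p])
    also have "\<dots> \<le> (growth * ?e + growth * ?e) * H_norm p"
      by (intro mult_right_mono add_mono g H_norm_nonneg)
    also have "\<dots> = 2 * growth * H_norm p * (1 * (1 * ?e))" by (simp add: algebra_simps)
    also have "\<dots> \<le> 2 * growth * H_norm p * (cmod \<zeta> ^ (n + 1) * (?e * ?e))"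
      using p1 e1 by (intro mult_left_mono mult_mono mult_nonneg_nonneg growth_nonneg H_norm_nonneg) auto
    finally have 1: "cmod (pairing (dsol \<zeta>) (\<lambda>x. - \<zeta> * sol \<zeta> x) p)
        \<le> 2 * growth * H_norm p * (cmod \<zeta> ^ (n + 1) * (?e * ?e))" .
    have "1 \<le> cmod (\<zeta> - a)" if "a \<in> A" for a
    proof -
      have "cmod a \<le> (\<Sum>a\<in>A. cmod a)" by (rule member_le_sum[OF that]) (use A in auto)
      then show ?thesis using norm_triangle_ineq2[of \<zeta> a] z unfolding r_def by linarith
    qed
    then have "1 \<le> cmod (\<Prod>a\<in>A. \<zeta> - a)" unfolding prod_norm[symmetric] by (intro prod_ge_1) auto
    then have "1 * cmod (Q \<zeta>) \<le> cmod (\<Prod>a\<in>A. \<zeta> - a) * cmod (Q \<zeta>)" by (rule mult_right_mono) simp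
    also have "\<dots> = cmod (exp (- \<zeta>) * eigen_pairing n \<zeta> p)" by (simp only: Q(2) norm_mult)
    also have "\<dots> \<le> C * cmod \<zeta> ^ (n + 1) * ?e" by (rule C(2)[OF z1])
    finally have "cmod (Q \<zeta>) \<le> C * cmod \<zeta> ^ (n + 1) * ?e" by simp
    then have "cmod (sol \<zeta> 1) * cmod (Q \<zeta>) \<le> (growth * ?e) * (C * cmod \<zeta> ^ (n + 1) * ?e)"
      by (intro mult_mono sol_1_bound mult_nonneg_nonneg growth_nonneg) auto
    then have "cmod (sol \<zeta> 1) * cmod (Q \<zeta>) / cmod k \<le> (growth * ?e) * (C * cmod \<zeta> ^ (n + 1) * ?e) / cmod k"
      by (rule divide_right_mono) simp
    also have "\<dots> = growth * C / cmod k * (cmod \<zeta> ^ (n + 1) * (?e * ?e))" by (simp add: mult_ac)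
    finally have 2: "cmod (sol \<zeta> 1 * Q \<zeta> / k) \<le> growth * C / cmod k * (cmod \<zeta> ^ (n + 1) * (?e * ?e))"
      by (simp add: norm_mult norm_divide)
    have "cmod (E \<zeta>) \<le> 2 * growth * H_norm p * (cmod \<zeta> ^ (n + 1) * (?e * ?e)) + growth * C / cmod k * (cmod \<zeta> ^ (n + 1) * (?e * ?e))"
      unfolding E_def by (rule order_trans[OF norm_triangle_ineq4 add_mono[OF 1 2]])
    also have "\<dots> = ?B * cmod \<zeta> ^ (n + 1) * exp (2 * \<bar>Re \<zeta>\<bar>)" unfolding e2 by (simp only: distrib_right mult.assoc)
    finally show ?thesis .
  qed

  \<comment> \<open>The corrected solution changes with zeta, so its properties are packed into one
    existential statement, to be used for general zeta and again at zeta = 1.\<close>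
  have resolvent: "\<exists>a z. a \<in> L2 \<and> (\<lambda>x. - \<zeta> * z x) \<in> L2 \<and> pairing a (\<lambda>x. - \<zeta> * z x) p = E \<zeta> \<and>
      (\<forall>T\<ge>0. exp (- \<zeta> * of_real T) * pairing a (\<lambda>x. - \<zeta> * z x) (S T p)
        = E \<zeta> - integral {0..T} (\<lambda>t. exp (- \<zeta> * of_real t) * f t)) \<and>
      (\<forall>t>0. ((\<lambda>t. pairing a (\<lambda>x. - \<zeta> * z x) (S t p)) has_vector_derivative
        \<zeta> * pairing a (\<lambda>x. - \<zeta> * z x) (S t p) - f t) (at t))"
    if z: "0 < Re \<zeta>" for \<zeta>
  proof -
    have L: "poly (laguerre_poly n) \<zeta> \<noteq> 0" using k A(1) A(4)[of \<zeta>] z by auto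
    then have F1: "regular_sol n \<zeta> 1 \<noteq> 0" by (simp add: regular_sol_1)
    define \<kappa> where "\<kappa> = sol \<zeta> 1 / regular_sol n \<zeta> 1"
    let ?q = "regular_sol_poly n"
    define z where "z x = sol \<zeta> x + (- \<kappa>) * regular_sol n \<zeta> x" for x
    define a where "a x = dsol \<zeta> x + (- \<kappa>) * exp_poly ?q \<zeta> x" for x
    define a' where "a' x = (\<phi> x + (\<zeta>\<^sup>2 + \<zeta> * c x) * sol \<zeta> x) + (- \<kappa>) * (\<zeta> * exp_poly (?q + pderiv ?q) \<zeta> x)" for x
    have z_deriv: "(z has_vector_derivative a x) (at x within {0..1})" if "x \<in> {0..1}" for x
      unfolding z_def a_def
      by (intro has_vector_derivative_add has_vector_derivative_mult_right sol_deriv regular_sol_deriv that)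
    have a_deriv: "(a has_vector_derivative a' x) (at x within {0..1})" if "x \<in> {0..1}" for x
      unfolding a_def a'_def
      by (intro has_vector_derivative_add has_vector_derivative_mult_right dsol_deriv exp_poly_deriv that)
    have ad: "adjoint_domain a a' (\<lambda>x. - \<zeta> * z x) (\<lambda>x. - \<zeta> * a x)"
      unfolding adjoint_domain_def
    proof (intro conjI ballI)
      show "continuous_on {0..1} a'"
        unfolding a'_def by (intro continuous_intros phi_cont c sol_cont exp_poly_continuous)
      show "continuous_on {0..1} (\<lambda>x. - \<zeta> * a x)"
        unfolding a_def by (intro continuous_intros dsol_cont exp_poly_continuous)
      show "- \<zeta> * z 0 = 0" by (simp add: z_def sol_0 regular_sol_0)
      show "- \<zeta> * z 1 = 0" using F1 by (simp add: z_def \<kappa>_def)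
      show "(a has_vector_derivative a' x) (at x within {0..1})" if "x \<in> {0..1}" for x by (rule a_deriv[OF that])
      show "((\<lambda>x. - \<zeta> * z x) has_vector_derivative - \<zeta> * a x) (at x within {0..1})" if "x \<in> {0..1}" for x
        by (intro has_vector_derivative_mult_right z_deriv that)
    qed
    have ode: "a' x = \<phi> x + (\<zeta>\<^sup>2 + \<zeta> * of_real (2 * \<alpha> / x)) * z x" if x: "0 < x" "x < 1" for x
    proof -
      \<comment> \<open>c and 2 alpha / x differ only below \<epsilon> / 2, where \<open>sol\<close>
        is 0.\<close>
      have "complex_of_real (c x) * sol \<zeta> x = of_real (2 * \<alpha> / x) * sol \<zeta> x"
      proof (cases "x \<le> \<epsilon> / 2")
        case True
        then show ?thesis using sol_zero(1)[of x \<zeta>] x by simp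
      qed (simp add: c_def max_def)
      then have c: "(\<zeta>\<^sup>2 + \<zeta> * c x) * sol \<zeta> x = (\<zeta>\<^sup>2 + \<zeta> * of_real (2 * \<alpha> / x)) * sol \<zeta> x"
        by (simp only: distrib_right mult.assoc)
      have e: "\<zeta> * exp_poly (?q + pderiv ?q) \<zeta> x = (\<zeta>\<^sup>2 + \<zeta> * of_real (2 * \<alpha> / x)) * regular_sol n \<zeta> x"
        using regular_sol_second_deriv[of x \<zeta> n] x \<alpha> by simp
      have "u + K * v + (- \<kappa>) * (K * w) = u + K * (v + (- \<kappa>) * w)" for u v w K by (simp add: algebra_simps)
      then show ?thesis unfolding a'_def z_def c e .
    qed
    have E: "pairing a (\<lambda>x. - \<zeta> * z x) p = E \<zeta>"
    proof -
      have ip: "integrable unit_itv (\<lambda>x. weak_deriv (fst p) x * dsol \<zeta> x)" "integrable unit_itv (\<lambda>x. weak_deriv (fst p) x * exp_poly ?q \<zeta> x)"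
        "integrable unit_itv (\<lambda>x. snd p x * (- \<zeta> * sol \<zeta> x))" "integrable unit_itv (\<lambda>x. snd p x * (- \<zeta> * regular_sol n \<zeta> x))"
        by (intro L2_mult_integrable H_D p sol_L2 exp_poly_L2 L2_cmult L2_continuous continuous_on_vector_derivative[OF regular_sol_deriv])+
      have "(LINT x|unit_itv. weak_deriv (fst p) x * a x) = (LINT x|unit_itv. weak_deriv (fst p) x * dsol \<zeta> x + (- \<kappa>) * (weak_deriv (fst p) x * exp_poly ?q \<zeta> x))"
        by (rule Bochner_Integration.integral_cong) (simp_all add: a_def algebra_simps)
      also have "\<dots> = (LINT x|unit_itv. weak_deriv (fst p) x * dsol \<zeta> x) + (- \<kappa>) * (LINT x|unit_itv. weak_deriv (fst p) x * exp_poly ?q \<zeta> x)"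
        unfolding Bochner_Integration.integral_add[OF ip(1) integrable_mult_right[OF ip(2)]] integral_mult_right_zero ..
      finally have 1: "(LINT x|unit_itv. weak_deriv (fst p) x * a x) = (LINT x|unit_itv. weak_deriv (fst p) x * dsol \<zeta> x) + (- \<kappa>) * (LINT x|unit_itv. weak_deriv (fst p) x * exp_poly ?q \<zeta> x)" .
      have "(LINT x|unit_itv. snd p x * (- \<zeta> * z x)) = (LINT x|unit_itv. snd p x * (- \<zeta> * sol \<zeta> x) + (- \<kappa>) * (snd p x * (- \<zeta> * regular_sol n \<zeta> x)))"
        by (rule Bochner_Integration.integral_cong) (simp_all add: z_def algebra_simps)
      also have "\<dots> = (LINT x|unit_itv. snd p x * (- \<zeta> * sol \<zeta> x)) + (- \<kappa>) * (LINT x|unit_itv. snd p x * (- \<zeta> * regular_sol n \<zeta> x))"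
        unfolding Bochner_Integration.integral_add[OF ip(3) integrable_mult_right[OF ip(4)]] integral_mult_right_zero ..
      finally have 2: "(LINT x|unit_itv. snd p x * (- \<zeta> * z x)) = (LINT x|unit_itv. snd p x * (- \<zeta> * sol \<zeta> x)) + (- \<kappa>) * (LINT x|unit_itv. snd p x * (- \<zeta> * regular_sol n \<zeta> x))" .
      have 3: "pairing a (\<lambda>x. - \<zeta> * z x) p = pairing (dsol \<zeta>) (\<lambda>x. - \<zeta> * sol \<zeta> x) p - \<kappa> * eigen_pairing n \<zeta> p"
      proof -
        have "(v + (- \<kappa>) * w) + (v' + (- \<kappa>) * w') = (v + v') - \<kappa> * (w + w')" for v w v' w' by (simp add: algebra_simps)
        then show ?thesis unfolding pairing_def eigen_pairing_def 1 2 .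
      qed
      \<comment> \<open>The factor exp zeta in the boundary value of the regular solution becomes
        the normalisation exp (-zeta) in the definition of Q, and the product over A
        cancels.\<close>
      have "\<kappa> * eigen_pairing n \<zeta> p = sol \<zeta> 1 * (exp (- \<zeta>) * eigen_pairing n \<zeta> p) / poly (laguerre_poly n) \<zeta>"
        by (simp add: \<kappa>_def regular_sol_1 exp_minus divide_inverse mult_ac)
      also have "\<dots> = sol \<zeta> 1 * Q \<zeta> / k" using L unfolding Q(2) k(2) by (simp add: field_simps)
      finally show ?thesis using 3 by (simp only: E_def)
    qed
    note aL = adjoint_domain_L2[OF ad]
    have der: "((\<lambda>t. pairing a (\<lambda>x. - \<zeta> * z x) (S t p)) has_vector_derivative
        \<zeta> * pairing a (\<lambda>x. - \<zeta> * z x) (S t p) - f t) (at t)" if "0 < t" for t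
      using pairing_S_deriv_at[OF ad p that] adjoint_pairing_resolvent[OF ad phi_L2 S_in_H[OF less_imp_le[OF that] p] ode]
      by (simp add: f_def)
    show ?thesis
    proof (rule exI[of _ a], rule exI[of _ z], intro conjI allI impI)
      show "a \<in> L2" "(\<lambda>x. - \<zeta> * z x) \<in> L2" by (fact aL)+
      show "pairing a (\<lambda>x. - \<zeta> * z x) p = E \<zeta>" by (fact E)
      show "exp (- \<zeta> * of_real T) * pairing a (\<lambda>x. - \<zeta> * z x) (S T p)
        = E \<zeta> - integral {0..T} (\<lambda>t. exp (- \<zeta> * of_real t) * f t)" if "0 \<le> T" for T
        using duhamel[OF ad phi_L2 p ode that] unfolding E f_def .
      show "((\<lambda>t. pairing a (\<lambda>x. - \<zeta> * z x) (S t p)) has_vector_derivative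
        \<zeta> * pairing a (\<lambda>x. - \<zeta> * z x) (S t p) - f t) (at t)" if "0 < t" for t
        by (rule der[OF that])
    qed
  qed

  have f_cont: "continuous_on {0..} f"
    unfolding f_def by (rule pairing_S_continuous[OF L2_zero phi_L2 p])
  have f_bd: "cmod (f s) \<le> (L2_norm (\<lambda>_. 0) + L2_norm \<phi>) * H_norm p" if "0 \<le> s" for s
    unfolding f_def by (rule pairing_S_bound[OF L2_zero phi_L2 p that])
  have lap: "((\<lambda>T. integral {0..T} (\<lambda>t. exp (- \<zeta> * of_real t) * f t)) \<longlongrightarrow> E \<zeta>) at_top" if z: "0 < Re \<zeta>" for \<zeta>
  proof -
    obtain a w where aw: "a \<in> L2" "w \<in> L2" and du: "\<And>T. 0 \<le> T \<Longrightarrow> exp (- \<zeta> * of_real T) * pairing a w (S T p)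
        = E \<zeta> - integral {0..T} (\<lambda>t. exp (- \<zeta> * of_real t) * f t)"
      using resolvent[OF z] by blast
    let ?C = "(L2_norm a + L2_norm w) * H_norm p"
    \<comment> \<open>Contractivity keeps the pairing bounded in time, so the decaying exponential
      wins.\<close>
    have "((\<lambda>T. exp (- \<zeta> * of_real T) * pairing a w (S T p)) \<longlongrightarrow> 0) at_top"
    proof (rule Lim_null_comparison)
      show "\<forall>\<^sub>F T in at_top. norm (exp (- \<zeta> * of_real T) * pairing a w (S T p)) \<le> exp (- (Re \<zeta> * T)) * ?C"
        using eventually_ge_at_top[of 0]
        by eventually_elim (auto simp: norm_mult intro!: mult_left_mono pairing_S_bound aw p)
      show "((\<lambda>T. exp (- (Re \<zeta> * T)) * ?C) \<longlongrightarrow> 0) at_top"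
        by (intro tendsto_mult_left_zero filterlim_compose[OF exp_at_bot] filterlim_uminus_at_bot_at_top[THEN filterlim_compose]
            filterlim_tendsto_pos_mult_at_top[OF tendsto_const z filterlim_ident])
    qed
    then have "((\<lambda>T. E \<zeta> - exp (- \<zeta> * of_real T) * pairing a w (S T p)) \<longlongrightarrow> E \<zeta> - 0) at_top"
      by (intro tendsto_intros)
    then have "((\<lambda>T. E \<zeta> - exp (- \<zeta> * of_real T) * pairing a w (S T p)) \<longlongrightarrow> E \<zeta>) at_top" by simp
    moreover have "\<forall>\<^sub>F T in at_top. E \<zeta> - exp (- \<zeta> * of_real T) * pairing a w (S T p) = integral {0..T} (\<lambda>t. exp (- \<zeta> * of_real t) * f t)"
      using eventually_ge_at_top[of 0] by eventually_elim (subst du, assumption, simp)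
    ultimately show ?thesis by (rule Lim_transform_eventually)
  qed

  \<comment> \<open>One point of the right half-plane is enough: if y is the pairing for zeta = 1
    and y = 0 from time 2 on, then f = y - y' vanishes after time 2. No Laplace transform has to be
    inverted.\<close>
  obtain a w where aw: "\<And>T. 0 \<le> T \<Longrightarrow> exp (- 1 * of_real T) * pairing a w (S T p)
        = E 1 - integral {0..T} (\<lambda>t. exp (- 1 * of_real t) * f t)"
      "\<And>t. 0 < t \<Longrightarrow> ((\<lambda>t. pairing a w (S t p)) has_vector_derivative 1 * pairing a w (S t p) - f t) (at t)"
  proof -
    have "0 < Re 1" by simp
    from resolvent[OF this] that show ?thesis by blast
  qed
  have y0: "pairing a w (S s p) = 0" if "2 \<le> s" for s
  proof -
    \<comment> \<open>Cutting at s itself, any s >= 2, the integral already accounts for all of E 1,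
      and Duhamel's formula leaves nothing for the state at time s.\<close>
    have "E 1 = integral {0..s} (\<lambda>t. exp (- 1 * of_real t) * f t)"
      by (rule laplace_support[OF f_cont f_bd E_hol lap E_growth that])
    moreover have "0 \<le> s" using that by simp
    ultimately have "exp (- 1 * of_real s) * pairing a w (S s p) = 0" using aw(1)[of s] by (simp only: diff_self)
    then show ?thesis by simp
  qed
  have "((\<lambda>_. 0) has_vector_derivative 0) (at t)" by simp
  then have "((\<lambda>t. pairing a w (S t p)) has_vector_derivative 0) (at t)"
    by (rule has_vector_derivative_transform_within_open[where S = "{2<..}"]) (use y0 t in auto)
  from vector_derivative_unique_at[OF this aw(2)[of t]] t y0[of t]
  have "f t = 0" by simp
  then show "(LINT x|unit_itv. snd (S t p) x * \<phi> x) = 0" by (simp add: f_def pairing_only_snd)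
qed

text \<open>At a root the regular solution is admissible in Duhamel's formula with phi = 0, which
  ties the initial pairing to the pairing with the extinct state. Since the pairing also sees the
  second component, that one has to be shown extinct first.\<close>

lemma vanishing_imp_orthogonal:
  assumes \<alpha>: "\<alpha> = real n + 1" and p: "p \<in> H" and T: "0 \<le> T" "\<And>t. T < t \<Longrightarrow> AE x in unit_itv. fst (S t p) x = 0"
    and root: "poly (laguerre_poly n) \<zeta> = 0"
  shows "eigen_pairing n \<zeta> p = 0"
proof -
  let ?q = "regular_sol_poly n" and ?t = "T + 1"
  have ad: "adjoint_domain (exp_poly ?q \<zeta>) (\<lambda>x. \<zeta> * exp_poly (?q + pderiv ?q) \<zeta> x) (\<lambda>x. - \<zeta> * regular_sol n \<zeta> x) (\<lambda>x. - \<zeta> * exp_poly ?q \<zeta> x)"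
    unfolding adjoint_domain_def
    by (intro conjI ballI continuous_intros exp_poly_continuous exp_poly_deriv has_vector_derivative_mult_right regular_sol_deriv)
      (simp_all add: regular_sol_0 regular_sol_1 root)
  note L = adjoint_domain_L2[OF ad]
  have ode: "\<zeta> * exp_poly (?q + pderiv ?q) \<zeta> x = 0 + (\<zeta>\<^sup>2 + \<zeta> * of_real (2 * \<alpha> / x)) * regular_sol n \<zeta> x" if "0 < x" for x
    using regular_sol_second_deriv[of x \<zeta> n] that \<alpha> by simp
  have mem: "S ?t p \<in> H" using T by (intro S_in_H p) auto
  have "AE x in unit_itv. snd (S ?t p) x = 0"
    by (rule fst_vanishes_imp_snd_vanishes[OF p T]) auto
  then have "(LINT x|unit_itv. snd (S ?t p) x * (- \<zeta> * regular_sol n \<zeta> x)) = (LINT x|unit_itv. 0)"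
    by (intro integral_cong_AE borel_measurable_integrable[OF L2_mult_integrable[OF H_D(2)[OF mem] L(2)]])
      (auto elim: eventually_mono)
  moreover have "AE x in unit_itv. weak_deriv (fst (S ?t p)) x = 0"
    by (rule W12_0_AE_0_deriv[OF H_D(1)[OF mem] T(2)]) simp
  then have "(LINT x|unit_itv. weak_deriv (fst (S ?t p)) x * exp_poly ?q \<zeta> x) = (LINT x|unit_itv. 0)"
    by (intro integral_cong_AE borel_measurable_integrable[OF L2_mult_integrable[OF H_D(4)[OF mem] L(1)]])
      (auto elim: eventually_mono)
  ultimately have "pairing (exp_poly ?q \<zeta>) (\<lambda>x. - \<zeta> * regular_sol n \<zeta> x) (S ?t p) = 0" by (simp add: pairing_def)
  moreover have "exp (- \<zeta> * of_real ?t) * pairing (exp_poly ?q \<zeta>) (\<lambda>x. - \<zeta> * regular_sol n \<zeta> x) (S ?t p)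
      = eigen_pairing n \<zeta> p - integral {0..?t} (\<lambda>t. exp (- \<zeta> * of_real t) * pairing (\<lambda>_. 0) (\<lambda>_. 0) (S t p))"
    unfolding eigen_pairing_def by (rule duhamel[OF ad L2_zero p ode]) (use T in auto)
  ultimately show ?thesis by (simp add: pairing_def)
qed

end

theorem theorem3p1:
  fixes n :: nat and \<alpha> :: real and \<mu> :: "nat \<Rightarrow> real"
    and S :: "real \<Rightarrow> state \<Rightarrow> state" and u0 u1 :: "real \<Rightarrow> complex"
  assumes "n \<ge> 1"
    and "\<alpha> = real n + 1"
    and "bij_betw \<mu> {1..n} {m. m < 0 \<and> laguerre1 n (- 2 * m) = 0}"
    and "contraction_semigroup S"
    and "generator S = op_closure (G0 \<alpha>)"
    and "(u0, u1) \<in> H"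
  shows "((\<exists>T>0. \<forall>t>T. vanishes_at S (u0, u1) t) \<longleftrightarrow>
      (\<forall>k\<in>{1..n}. H_inner (u0, u1)
         (fk n (\<mu> k), \<lambda>x. - complex_of_real (\<mu> k) * fk n (\<mu> k) x) = 0))
    \<and> ((\<exists>T>0. \<forall>t>T. vanishes_at S (u0, u1) t) \<longrightarrow>
      (\<forall>t>2. vanishes_at S (u0, u1) t))"
proof -
  interpret damped_wave_semigroup S \<alpha> using assms(4,5) by unfold_locales
  let ?p = "(u0, u1)" and ?A = "(\<lambda>k. complex_of_real (\<mu> k)) ` {1..n}"
  have \<mu>: "\<mu> k < 0" "laguerre1 n (- 2 * \<mu> k) = 0" if "k \<in> {1..n}" for k
    using bij_betwE[OF assms(3)] that by auto
  have root: "poly (laguerre_poly n) (complex_of_real (\<mu> k)) = 0" if "k \<in> {1..n}" for k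
    unfolding poly_laguerre_poly \<mu>(2)[OF that] by simp
  have inner: "H_inner ?p (fk n (\<mu> k), \<lambda>x. - complex_of_real (\<mu> k) * fk n (\<mu> k) x) = eigen_pairing n (complex_of_real (\<mu> k)) ?p" for k
    by (rule H_inner_fk[OF assms(6)])
  \<comment> \<open>Injectivity of \<mu> provides as many distinct roots as the degree allows, so
    there are no others, real or complex.\<close>
  have card: "card ?A = n"
  proof -
    have "inj_on (\<lambda>k. complex_of_real (\<mu> k)) {1..n}"
      using bij_betw_imp_inj_on[OF assms(3)] unfolding inj_on_def of_real_eq_iff .
    then show ?thesis by (simp add: card_image)
  qed
  have nec: "eigen_pairing n (complex_of_real (\<mu> k)) ?p = 0"
    if "\<exists>T>0. \<forall>t>T. vanishes_at S ?p t" "k \<in> {1..n}" for k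
  proof -
    from that(1) obtain T where "T > 0" "\<And>t. T < t \<Longrightarrow> AE x in unit_itv. fst (S t ?p) x = 0"
      unfolding vanishes_at_def by blast
    then show ?thesis by (intro vanishing_imp_orthogonal[OF assms(2,6), of T] root that) auto
  qed
  have suf: "vanishes_at S ?p t"
    if "\<And>k. k \<in> {1..n} \<Longrightarrow> eigen_pairing n (complex_of_real (\<mu> k)) ?p = 0" "2 < t" for t
  proof -
    have "AE x in unit_itv. snd (S s ?p) x = 0" if "2 < s" for s
      using \<mu>(1) root \<open>\<And>k. k \<in> {1..n} \<Longrightarrow> eigen_pairing n (complex_of_real (\<mu> k)) ?p = 0\<close>
      by (intro orthogonal_imp_snd_vanishes[OF assms(2,6) _ card _ _ _ that]) auto
    then show ?thesis
      unfolding vanishes_at_def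
      by (intro snd_vanishes_imp_fst_vanishes[OF assms(6), of 2] that(2)) auto
  qed
  \<comment> \<open>Orthogonality yields extinction with T = 2 as witness; necessity followed by
    sufficiency gives the second conjunct.\<close>
  show ?thesis unfolding inner using nec suf by (metis zero_less_numeral)
qed

end
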